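(* Let $R=k[x_1,\ldots,x_n,x_{n+1}]$, with $n\ge2$, and let $I\subset R$ denote the base ideal of a generalized de Jonquières transformation of degree $d\ge2$ with identity support. Then the Rees algebra $\mathcal{R}(I)$ is almost Cohen–Macaulay.
   Context: $k$ is an infinite field. A polynomial is an $x_{n+1}$-monoid if its degree in $x_{n+1}$ is at most $1$. A generalized de Jonquières transformation of degree $d\ge2$ with identity support is a Cremona transformation $(x_1f:\cdots:x_nf:g)$ of $\mathbb{P}^n_k$, where $f,g\in R$ are forms of degrees $d-1$ and $d$ with $\gcd(f,g)=1$, both $x_{n+1}$-monoids, at least one of which involves $x_{n+1}$ effectively. Its base ideal is $I=(x_1f,\ldots,x_nf,g)\subset R$. The Rees algebra is $\mathcal{R}(I)=R[It]\subset R[t]$, a bigraded quotient of $R[y_1,\ldots,y_{n+1}]$ via $y_i\mapsto x_ift$ $(1\le i\le n)$, $y_{n+1}\mapsto gt$. "Almost Cohen–Macaulay" means $\mathrm{depth}\,\mathcal{R}(I)\ge\dim\mathcal{R}(I)-1$, where depth is taken with respect to the homogeneous maximal ideal; here $\dim\mathcal{R}(I)=n+2$. *)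

theory Defs
  imports
    "HOL-Algebra.UnivPoly"
    "HOL-Algebra.Generated_Rings"
    "HOL-Algebra.Divisibility"
    "HOL-Library.Poly_Mapping"
    "HOL-Library.Extended_Nat"
begin

text \<open>A monomial is an exponent vector \<open>nat \<Rightarrow>\<^sub>0 nat\<close>; the variables carry the indices
  \<open>1, \<dots>, N\<close>, so the index \<open>0\<close> does not occur.\<close>

type_synonym 'k mpol = "(nat \<Rightarrow>\<^sub>0 nat) \<Rightarrow>\<^sub>0 'k"

definition var :: "nat \<Rightarrow> 'k::field mpol" where
  "var i = Poly_Mapping.single (Poly_Mapping.single i 1) 1"

definition mpol_ring :: "nat \<Rightarrow> 'k::field mpol ring" where
  "mpol_ring N =
     \<lparr> carrier = {p. \<forall>m\<in>Poly_Mapping.keys p. Poly_Mapping.keys m \<subseteq> {1..N}},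
       monoid.mult = (*), one = 1, ring.zero = 0, add = (+) \<rparr>"

text \<open>The zero polynomial counts as a form of every degree.\<close>

definition form :: "nat \<Rightarrow> nat \<Rightarrow> 'k::field mpol \<Rightarrow> bool" where
  "form N d p \<longleftrightarrow> p \<in> carrier (mpol_ring N) \<and>
     (\<forall>m\<in>Poly_Mapping.keys p. (\<Sum>i\<in>Poly_Mapping.keys m. Poly_Mapping.lookup m i) = d)"

definition var_monoid :: "nat \<Rightarrow> 'k::field mpol \<Rightarrow> bool" where
  "var_monoid i p \<longleftrightarrow> (\<forall>m\<in>Poly_Mapping.keys p. Poly_Mapping.lookup m i \<le> 1)"

definition involves :: "nat \<Rightarrow> 'k::field mpol \<Rightarrow> bool" where
  "involves i p \<longleftrightarrow> (\<exists>m\<in>Poly_Mapping.keys p. Poly_Mapping.lookup m i \<noteq> 0)"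

definition mpol_subst :: "(nat \<Rightarrow> 'k::field mpol) \<Rightarrow> 'k mpol \<Rightarrow> 'k mpol" where
  "mpol_subst G p =
     (\<Sum>m\<in>Poly_Mapping.keys p. Poly_Mapping.single 0 (Poly_Mapping.lookup p m) *
        (\<Prod>i\<in>Poly_Mapping.keys m. G i ^ Poly_Mapping.lookup m i))"

text \<open>A rational self-map of the projective space with coordinates \<open>x\<^sub>1, \<dots>, x\<^sub>N\<close> is
  represented by a tuple \<open>(F\<^sub>1 : \<dots> : F\<^sub>N)\<close> of forms of a common degree, not all zero.
  Two tuples represent the same map iff they are proportional over the fraction field, that is,
  iff all their \<open>2 \<times> 2\<close> minors vanish.\<close>

definition rational_map :: "nat \<Rightarrow> (nat \<Rightarrow> 'k::field mpol) \<Rightarrow> bool" where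
  "rational_map N F \<longleftrightarrow> (\<exists>d. \<forall>i\<in>{1..N}. form N d (F i)) \<and> (\<exists>i\<in>{1..N}. F i \<noteq> 0)"

definition same_rational_map ::
  "nat \<Rightarrow> (nat \<Rightarrow> 'k::field mpol) \<Rightarrow> (nat \<Rightarrow> 'k mpol) \<Rightarrow> bool" where
  "same_rational_map N F G \<longleftrightarrow> rational_map N F \<and> rational_map N G \<and>
     (\<forall>i\<in>{1..N}. \<forall>j\<in>{1..N}. F i * G j = F j * G i)"

definition cremona :: "nat \<Rightarrow> (nat \<Rightarrow> 'k::field mpol) \<Rightarrow> bool" where
  "cremona N F \<longleftrightarrow> rational_map N F \<and>
     (\<exists>G. rational_map N G \<and>
        same_rational_map N (\<lambda>i. mpol_subst G (F i)) var \<and>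
        same_rational_map N (\<lambda>i. mpol_subst F (G i)) var)"

definition dejonq_map :: "nat \<Rightarrow> 'k::field mpol \<Rightarrow> 'k mpol \<Rightarrow> nat \<Rightarrow> 'k mpol" where
  "dejonq_map n f g i = (if i \<le> n then var i * f else g)"

definition generalized_dejonquieres ::
  "nat \<Rightarrow> nat \<Rightarrow> 'k::field mpol \<Rightarrow> 'k mpol \<Rightarrow> bool" where
  "generalized_dejonquieres n d f g \<longleftrightarrow>
     d \<ge> 2 \<and> form (n + 1) (d - 1) f \<and> form (n + 1) d g \<and>
     \<one>\<^bsub>mpol_ring (n + 1)\<^esub> gcdof\<^bsub>mpol_ring (n + 1)\<^esub> f g \<and>
     var_monoid (n + 1) f \<and> var_monoid (n + 1) g \<and>
     (involves (n + 1) f \<or> involves (n + 1) g) \<and>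
     cremona (n + 1) (dejonq_map n f g)"

definition base_ideal :: "nat \<Rightarrow> 'k::field mpol \<Rightarrow> 'k mpol \<Rightarrow> 'k mpol set" where
  "base_ideal n f g = Idl\<^bsub>mpol_ring (n + 1)\<^esub> (dejonq_map n f g ` {1..n + 1})"

text \<open>\<open>R[It] \<subseteq> R[t]\<close>, where \<open>R[t]\<close> is \<open>UP R\<close>.\<close>

definition rees_algebra :: "('a, 'b) ring_scheme \<Rightarrow> 'a set \<Rightarrow> ('a, nat \<Rightarrow> 'a) up_ring" where
  "rees_algebra R I = (UP R)\<lparr>carrier := generate_ring (UP R)
     ((\<lambda>r. monom (UP R) r 0) ` carrier R \<union> (\<lambda>a. monom (UP R) a 1) ` I)\<rparr>"

text \<open>For \<open>R = k[x\<^sub>1, \<dots>, x\<^sub>N]\<close> and \<open>I\<close> homogeneous and proper, this is the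
  homogeneous maximal ideal of the bigraded ring \<open>R[It]\<close>.\<close>

definition rees_max_ideal :: "nat \<Rightarrow> 'k::field mpol set \<Rightarrow> (nat \<Rightarrow> 'k mpol) set" where
  "rees_max_ideal N I = Idl\<^bsub>rees_algebra (mpol_ring N) I\<^esub>
     ((\<lambda>i. monom (UP (mpol_ring N)) (var i) 0) ` {1..N} \<union>
      (\<lambda>a. monom (UP (mpol_ring N)) a 1) ` I)"

definition krull_dim :: "('a, 'b) ring_scheme \<Rightarrow> enat" where
  "krull_dim A = Sup {enat r | r. \<exists>P :: nat \<Rightarrow> 'a set.
     (\<forall>i\<le>r. primeideal (P i) A) \<and> (\<forall>i<r. P i \<subset> P (Suc i))}"

definition regular_sequence :: "('a, 'b) ring_scheme \<Rightarrow> 'a list \<Rightarrow> bool" where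
  "regular_sequence A as \<longleftrightarrow> set as \<subseteq> carrier A \<and>
     (\<forall>i<length as. \<forall>b\<in>carrier A.
        as ! i \<otimes>\<^bsub>A\<^esub> b \<in> Idl\<^bsub>A\<^esub> (set (take i as)) \<longrightarrow> b \<in> Idl\<^bsub>A\<^esub> (set (take i as))) \<and>
     Idl\<^bsub>A\<^esub> (set as) \<noteq> carrier A"

text \<open>For \<open>A\<close> noetherian and \<open>M\<close> maximal this coincides with the depth of the localization of \<open>A\<close> at \<open>M\<close>.\<close>

definition depth :: "('a, 'b) ring_scheme \<Rightarrow> 'a set \<Rightarrow> enat" where
  "depth A M = Sup {enat (length as) | as. set as \<subseteq> M \<and> regular_sequence A as}"

definition almost_cohen_macaulay :: "('a, 'b) ring_scheme \<Rightarrow> 'a set \<Rightarrow> bool" where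
  "almost_cohen_macaulay A M \<longleftrightarrow> depth A M \<ge> krull_dim A - 1"

end

theory Submission
  imports Defs "HOL-Computational_Algebra.Polynomial"
begin

text \<open>Write \<open>s\<close> for \<open>f t\<close> and \<open>w\<close> for \<open>g t\<close>. The Rees algebra \<open>k[x\<^sub>1, \<dots>, x\<^sub>n\<^sub>+\<^sub>1, x\<^sub>1 s, \<dots>, x\<^sub>n s, w]\<close>
  is a quotient of the monomial algebra \<open>B \<subseteq> k[x, s, w]\<close> spanned by the monomials of weight \<open>\<ge> 0\<close>,
  where \<open>x\<^sub>1, \<dots>, x\<^sub>n\<close> have weight \<open>1\<close>, \<open>s\<close> has weight \<open>-1\<close> and \<open>x\<^sub>n\<^sub>+\<^sub>1\<close>, \<open>w\<close> have weight \<open>0\<close>.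
  As \<open>f\<close>, \<open>g\<close> are coprime, the kernel of \<open>k[x, s, w] \<rightarrow> k[x, t]\<close> is generated by
  \<open>h = g s - f w\<close> (this needs unique factorization in \<open>k[x]\<close>). The monoid hypothesis says that the
  lowest weight occurring in \<open>h\<close> is \<open>d - 2\<close>, so the Rees algebra is \<open>B / h N\<close> with \<open>N\<close> spanned by the
  monomials of weight \<open>\<ge> - (d - 2)\<close>.

  A regular sequence of length \<open>n + 1\<close> in \<open>B / h N\<close> is given by binomials \<open>v - l x\<^sub>j s\<close> that eliminate
  \<open>w\<close>, \<open>x\<^sub>n\<^sub>+\<^sub>1\<close>, \<open>x\<^sub>1, \<dots>, x\<^sub>n\<^sub>-\<^sub>1\<close> in turn: each elimination is a substitution that maps \<open>B\<close> and \<open>N\<close> onto the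
  analogous objects in one variable less with changed weights, and since \<open>k\<close> is infinite, \<open>l\<close> can be
  chosen such that the image of \<open>h\<close> stays nonzero. On the other hand, a chain of \<open>r + 1\<close> primes in a
  subalgebra of a polynomial ring in \<open>n + 2\<close> variables gives \<open>r\<close> algebraically independent
  elements, whence \<open>r \<le> n + 2\<close> by counting monomials.\<close>

section \<open>Unique factorization in polynomial rings\<close>

text \<open>One dimension is lost because of where the eliminations stop. They leave only
  \<open>x\<^sub>n\<close> and \<open>s\<close>, of weights n and -1, together with the image of
  \<open>h\<close>: the last quotient has dimension at most 1, and no further variable is left
  against which \<open>x\<^sub>n\<close> could be traded. The module N enters because the kernel in
  B is what h k[x, s, w] cuts out on B: a product h p lies in B as soon as p has weight at least -
  (d - 2), even if p itself is not in B. So the pair (B, N) has to be carried through all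
  eliminations, and the weights are raised precisely so that the images of both remain described by
  weight bounds alone.

  All rings met on the way are subsets of one type of polynomials with arbitrarily many variables,
  so that an elimination does not change the type. The records of HOL-Algebra, in which the theorem
  is stated, enter only at the end, through an injective homomorphism. For the same reason unique
  factorization is developed for subsets of a domain, and without fraction fields, which would leave
  the type.\<close>

locale idom_subring =
  fixes A :: "'a::idom set"
  assumes one_closed: "1 \<in> A"
    and diff_closed: "a \<in> A \<Longrightarrow> b \<in> A \<Longrightarrow> a - b \<in> A"
    and mult_closed: "a \<in> A \<Longrightarrow> b \<in> A \<Longrightarrow> a * b \<in> A"
begin

lemma zero_closed: "0 \<in> A"
  using diff_closed[OF one_closed one_closed] by simp

lemma uminus_closed: "a \<in> A \<Longrightarrow> - a \<in> A"
  using diff_closed[OF zero_closed, of a] by simp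

lemma add_closed: "a \<in> A \<Longrightarrow> b \<in> A \<Longrightarrow> a + b \<in> A"
  using diff_closed[OF _ uminus_closed, of a b] by simp

lemma power_closed: "a \<in> A \<Longrightarrow> a ^ n \<in> A"
  by (induction n) (auto intro: one_closed mult_closed)

lemma sum_closed: "(\<And>i. i \<in> I \<Longrightarrow> h i \<in> A) \<Longrightarrow> sum h I \<in> A"
  by (induction I rule: infinite_finite_induct) (auto intro: zero_closed add_closed)

lemma prod_closed: "(\<And>i. i \<in> I \<Longrightarrow> h i \<in> A) \<Longrightarrow> prod h I \<in> A"
  by (induction I rule: infinite_finite_induct) (auto intro: one_closed mult_closed)

end

definition dvd_on :: "'a::idom set \<Rightarrow> 'a \<Rightarrow> 'a \<Rightarrow> bool" where
  "dvd_on A a b \<longleftrightarrow> (\<exists>c\<in>A. b = a * c)"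

definition prime_on :: "'a::idom set \<Rightarrow> 'a \<Rightarrow> bool" where
  "prime_on A p \<longleftrightarrow> p \<in> A \<and> p \<noteq> 0 \<and> \<not> dvd_on A p 1 \<and>
     (\<forall>a\<in>A. \<forall>b\<in>A. dvd_on A p (a * b) \<longrightarrow> dvd_on A p a \<or> dvd_on A p b)"

definition factors_on :: "'a::idom set \<Rightarrow> 'a \<Rightarrow> 'a list \<Rightarrow> bool" where
  "factors_on A a ps \<longleftrightarrow>
     (\<exists>u\<in>A. dvd_on A u 1 \<and> (\<forall>p\<in>set ps. prime_on A p) \<and> a = u * prod_list ps)"

text \<open>Factorizations into primes, not just into irreducibles, are demanded: uniqueness is then
  automatic, and existence is all that has to be carried over to A[X].\<close>

definition ufd_on :: "'a::idom set \<Rightarrow> bool" where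
  "ufd_on A \<longleftrightarrow> idom_subring A \<and> (\<forall>a\<in>A. a \<noteq> 0 \<longrightarrow> (\<exists>ps. factors_on A a ps))"

definition polys_over :: "'a::idom set \<Rightarrow> 'a poly set" where
  "polys_over A = {P. \<forall>i. poly.coeff P i \<in> A}"

context idom_subring
begin

lemma factors_on_closed:
  assumes "factors_on A a ps"
  shows "a \<in> A"
proof -
  have "prod_list ps \<in> A" if "\<forall>p\<in>set ps. prime_on A p"
    using that by (induction ps) (auto intro: one_closed mult_closed simp: prime_on_def)
  then show ?thesis using assms unfolding factors_on_def by (auto intro: mult_closed)
qed

lemma factors_on_Cons:
  assumes "prime_on A p" "factors_on A a ps"
  shows "factors_on A (p * a) (p # ps)"
  using assms unfolding factors_on_def by (auto simp: mult_ac)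

lemma factors_on_unit: "u \<in> A \<Longrightarrow> dvd_on A u 1 \<Longrightarrow> factors_on A u []"
  unfolding factors_on_def by auto

lemma factors_on_mult:
  assumes "factors_on A a ps" "factors_on A b qs"
  shows "factors_on A (a * b) (ps @ qs)"
proof -
  obtain u where u: "u \<in> A" "dvd_on A u 1" "\<forall>p\<in>set ps. prime_on A p" "a = u * prod_list ps"
    using assms(1) unfolding factors_on_def by blast
  obtain v where v: "v \<in> A" "dvd_on A v 1" "\<forall>p\<in>set qs. prime_on A p" "b = v * prod_list qs"
    using assms(2) unfolding factors_on_def by blast
  obtain u' v' where "u' \<in> A" "1 = u * u'" "v' \<in> A" "1 = v * v'"
    using u(2) v(2) unfolding dvd_on_def by auto
  then have "dvd_on A (u * v) 1"
    unfolding dvd_on_def by (intro bexI[of _ "u' * v'"]) (simp_all add: mult_closed, metis mult.commute mult.left_commute mult.right_neutral)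
  then show ?thesis
    unfolding factors_on_def using u v by (intro bexI[of _ "u * v"]) (auto intro: mult_closed simp: mult_ac)
qed

lemma factors_on_Cons_cancel:
  assumes "factors_on A a (p # ps)"
  shows "\<exists>b. a = p * b \<and> prime_on A p \<and> factors_on A b ps"
  using assms unfolding factors_on_def by (auto simp: mult_ac)

text \<open>The prime divides one of the listed primes, and a prime dividing a prime is associated
  to it; the unit is absorbed by the unit factor in \<open>factors_on\<close>. That exactly one
  entry disappears makes the length of the list an induction measure in
  \<open>ufd_on_polys_over\<close>.\<close>

lemma prime_on_dvd_factor:
  assumes "prime_on A \<pi>" "factors_on A a ps" "dvd_on A \<pi> a"
  shows "\<exists>b qs. a = \<pi> * b \<and> factors_on A b qs \<and> length ps = Suc (length qs)"
  using assms(2,3)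
proof (induction ps arbitrary: a)
  case Nil
  then obtain u u' c where "a = u" "u' \<in> A" "1 = u * u'" "c \<in> A" "a = \<pi> * c"
    unfolding factors_on_def dvd_on_def by auto
  then have "dvd_on A \<pi> 1"
    unfolding dvd_on_def by (intro bexI[of _ "c * u'"]) (auto intro: mult_closed simp: mult_ac)
  then show ?case using assms(1) unfolding prime_on_def by blast
next
  case (Cons p ps)
  obtain b where b: "a = p * b" "prime_on A p" "factors_on A b ps"
    using factors_on_Cons_cancel[OF Cons.prems(1)] by blast
  have bA: "b \<in> A" using b(3) by (rule factors_on_closed)
  have "dvd_on A \<pi> p \<or> dvd_on A \<pi> b"
    using assms(1) b bA Cons.prems(2) unfolding prime_on_def by blast
  then show ?case
  proof
    assume "dvd_on A \<pi> b"
    then obtain b' qs where q: "b = \<pi> * b'" "factors_on A b' qs" "length ps = Suc (length qs)"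
      using Cons.IH[OF b(3)] by blast
    then show ?thesis
      using factors_on_Cons[OF b(2) q(2)] b(1)
      by (intro exI[of _ "p * b'"] exI[of _ "p # qs"]) (auto simp: mult_ac)
  next
    assume "dvd_on A \<pi> p"
    then obtain c where c: "c \<in> A" "p = \<pi> * c" unfolding dvd_on_def by auto
    have "\<pi> \<in> A" using assms(1) unfolding prime_on_def by auto
    have "dvd_on A p (\<pi> * c)" using c unfolding dvd_on_def by (auto intro: bexI[of _ 1] one_closed)
    then consider "dvd_on A p \<pi>" | "dvd_on A p c"
      using b(2) c \<open>\<pi> \<in> A\<close> unfolding prime_on_def by blast
    then have "dvd_on A c 1"
    proof cases
      case 1
      then obtain e where "e \<in> A" "\<pi> = p * e" unfolding dvd_on_def by auto
      then have "\<pi> * 1 = \<pi> * (c * e)" using c by (simp add: mult_ac)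
      then have "1 = c * e" using assms(1) unfolding prime_on_def by (metis mult_left_cancel)
      then show ?thesis using \<open>e \<in> A\<close> unfolding dvd_on_def by auto
    next
      case 2
      then obtain e where "e \<in> A" "c = p * e" unfolding dvd_on_def by auto
      then have "p * 1 = p * (\<pi> * e)" using c by (simp add: mult_ac)
      then have "1 = \<pi> * e" using b(2) unfolding prime_on_def by (metis mult_left_cancel)
      then have "dvd_on A \<pi> 1" using \<open>e \<in> A\<close> unfolding dvd_on_def by auto
      then show ?thesis using assms(1) unfolding prime_on_def by blast
    qed
    then have "factors_on A (c * b) ([] @ ps)"
      using factors_on_mult[OF factors_on_unit b(3)] c by blast
    then show ?thesis using c b by (intro exI[of _ "c * b"] exI[of _ ps]) (auto simp: mult_ac)
  qed
qed

lemma dvd_on_diff: "dvd_on A p a \<Longrightarrow> dvd_on A p b \<Longrightarrow> dvd_on A p (a - b)"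
  unfolding dvd_on_def by (metis diff_closed right_diff_distrib)

lemma dvd_on_mult: "dvd_on A p a \<Longrightarrow> b \<in> A \<Longrightarrow> dvd_on A p (a * b)"
  unfolding dvd_on_def by (metis mult.assoc mult_closed)

lemma dvd_on_mult2: "dvd_on A p a \<Longrightarrow> b \<in> A \<Longrightarrow> dvd_on A p (b * a)"
  using dvd_on_mult by (simp add: mult.commute)

lemma polys_over_pCons [simp]: "pCons a P \<in> polys_over A \<longleftrightarrow> a \<in> A \<and> P \<in> polys_over A"
  unfolding polys_over_def by (auto simp: coeff_pCons split: nat.split dest: spec[of _ 0] spec[of _ "Suc _"])

lemma polys_over_coeff: "P \<in> polys_over A \<Longrightarrow> poly.coeff P i \<in> A"
  unfolding polys_over_def by auto

lemma idom_subring_polys_over: "idom_subring (polys_over A)"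
proof
  show "1 \<in> polys_over A"
    using one_closed zero_closed unfolding polys_over_def by (auto simp: coeff_1)
  show "P - Q \<in> polys_over A" if "P \<in> polys_over A" "Q \<in> polys_over A" for P Q
    using that diff_closed unfolding polys_over_def by auto
  show "P * Q \<in> polys_over A" if "P \<in> polys_over A" "Q \<in> polys_over A" for P Q
    using that unfolding polys_over_def by (auto simp: Polynomial.coeff_mult intro!: sum_closed mult_closed)
qed

interpretation polys: idom_subring "polys_over A"
  by (rule idom_subring_polys_over)

lemma smult_polys_over: "a \<in> A \<Longrightarrow> P \<in> polys_over A \<Longrightarrow> Polynomial.smult a P \<in> polys_over A"
  unfolding polys_over_def by (auto intro: mult_closed)

lemma dvd_on_polys_const:
  "dvd_on (polys_over A) [:p:] Q \<longleftrightarrow> (\<forall>i. dvd_on A p (poly.coeff Q i))"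
proof
  assume "dvd_on (polys_over A) [:p:] Q"
  then show "\<forall>i. dvd_on A p (poly.coeff Q i)"
    unfolding dvd_on_def by (auto intro: polys_over_coeff)
next
  assume "\<forall>i. dvd_on A p (poly.coeff Q i)"
  then show "dvd_on (polys_over A) [:p:] Q"
  proof (induction Q)
    case 0
    then show ?case unfolding dvd_on_def by (auto intro: bexI[of _ 0] polys.zero_closed)
  next
    case (pCons a Q)
    have "dvd_on A p a" using pCons.prems[rule_format, of 0] by simp
    moreover have "dvd_on (polys_over A) [:p:] Q"
      using pCons.IH pCons.prems by (metis coeff_pCons_Suc)
    ultimately obtain c C where "c \<in> A" "a = p * c" "C \<in> polys_over A" "Q = [:p:] * C"
      unfolding dvd_on_def by auto
    then show ?case unfolding dvd_on_def by (intro bexI[of _ "pCons c C"]) auto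
  qed
qed

lemma dvd_on_pCons_0:
  "dvd_on (polys_over A) [:p:] (pCons 0 Q) \<Longrightarrow> dvd_on (polys_over A) [:p:] Q"
  unfolding dvd_on_polys_const by (metis coeff_pCons_Suc)

text \<open>Gauss's lemma, by comparing constant coefficients: if p divides that of U, it is
  stripped from U; otherwise primality makes p divide that of V, and V is stripped until nothing is
  left.\<close>

lemma prime_on_polys_const:
  assumes p: "prime_on A p"
  shows "prime_on (polys_over A) [:p:]"
proof -
  let ?D = "dvd_on (polys_over A) [:p:]"
  have pA: "p \<in> A" using p unfolding prime_on_def by auto
  have const: "?D [:a:]" if "dvd_on A p a" for a
    using that zero_closed unfolding dvd_on_polys_const
    by (auto simp: coeff_pCons dvd_on_def split: nat.split intro: bexI[of _ 0])
  have main: "?D U \<or> ?D V" if "U \<in> polys_over A" "V \<in> polys_over A" "?D (U * V)" for U V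
    using that
  proof (induction U arbitrary: V)
    case 0
    then show ?case unfolding dvd_on_def by (auto intro: bexI[of _ 0] polys.zero_closed)
  next
    case (pCons a U)
    show ?case
    proof (cases "dvd_on A p a")
      case True
      have "?D ([:a:] * V)" using const[OF True] pCons.prems(2) by (rule polys.dvd_on_mult)
      then have "?D (pCons a U * V - [:a:] * V)" using pCons.prems(3) polys.dvd_on_diff by blast
      then have "?D (pCons 0 (U * V))" by simp
      then have "?D U \<or> ?D V" using pCons dvd_on_pCons_0 by (metis polys_over_pCons)
      then show ?thesis
      proof
        assume "?D U"
        then have "?D (pCons a U)"
          using True unfolding dvd_on_polys_const by (auto simp: coeff_pCons split: nat.split)
        then show ?thesis ..
      qed simp
    next
      case False
      have "?D V" using pCons.prems(2,3)
      proof (induction V)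
        case 0
        then show ?case unfolding dvd_on_def by (auto intro: bexI[of _ 0] polys.zero_closed)
      next
        case (pCons b V)
        have aA: "a \<in> A" "b \<in> A" and UP: "pCons a U \<in> polys_over A" "V \<in> polys_over A"
          using pCons.prems(1) \<open>pCons a U \<in> polys_over A\<close> by auto
        have "dvd_on A p (poly.coeff (pCons a U * pCons b V) 0)"
          using pCons.prems(2) unfolding dvd_on_polys_const by blast
        then have "dvd_on A p (a * b)" by (simp add: mult.commute)
        then have b: "dvd_on A p b" using False p aA unfolding prime_on_def by blast
        have "?D (pCons a U * [:b:])" using const[OF b] UP(1) by (rule polys.dvd_on_mult2)
        then have "?D (pCons a U * pCons b V - pCons a U * [:b:])"
          using pCons.prems(2) polys.dvd_on_diff by blast
        moreover have "pCons a U * pCons b V - pCons a U * [:b:] = pCons 0 (pCons a U * V)"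
          by (simp add: mult.commute[of _ "[:b:]"])
        ultimately have "?D V" using pCons.IH UP dvd_on_pCons_0 by metis
        then show ?case
          using b unfolding dvd_on_polys_const by (auto simp: coeff_pCons split: nat.split)
      qed
      then show ?thesis ..
    qed
  qed
  have "\<not> ?D 1"
  proof
    assume "?D 1"
    then have "dvd_on A p (poly.coeff 1 0)" unfolding dvd_on_polys_const by blast
    then show False using p unfolding prime_on_def by simp
  qed
  moreover have "[:p:] \<noteq> 0" "[:p:] \<in> polys_over A"
    using p pA polys.zero_closed unfolding prime_on_def by auto
  ultimately show ?thesis using main unfolding prime_on_def by blast
qed

text \<open>Replaces the passage to the fraction field: an equality up to the constant c becomes an
  honest factorization of P, because by Gauss's lemma each prime of c divides Q or E and can be
  cancelled there. A unit c goes wholly to Q.\<close>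

lemma const_mult_split:
  assumes "factors_on A c ps" "P \<in> polys_over A" "Q \<in> polys_over A" "E \<in> polys_over A"
    "[:c:] * P = Q * E"
  shows "\<exists>c1\<in>A. \<exists>c2\<in>A. \<exists>Q'\<in>polys_over A. \<exists>E'\<in>polys_over A.
    c = c1 * c2 \<and> Q = [:c1:] * Q' \<and> E = [:c2:] * E' \<and> P = Q' * E'"
  using assms
proof (induction ps arbitrary: c P Q E)
  case Nil
  then obtain u where u: "c \<in> A" "u \<in> A" "1 = c * u"
    unfolding factors_on_def dvd_on_def by auto
  have "Q = [:c:] * ([:u:] * Q)" using u(3) by (simp add: mult.commute)
  moreover have "P = [:u:] * ([:c:] * P)" using u(3) by (simp add: mult.commute[of u])
  then have "P = [:u:] * Q * E" unfolding Nil.prems(5) by (simp only: mult.assoc)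
  moreover have "[:u:] * Q \<in> polys_over A"
    using u Nil.prems by (intro polys.mult_closed) (auto intro: polys.zero_closed)
  ultimately show ?case
    using Nil.prems u by (intro bexI[of _ c] bexI[of _ 1] bexI[of _ "[:u:] * Q"] bexI[of _ E])
      (auto intro: one_closed)
next
  case (Cons p ps)
  obtain b where b: "c = p * b" "prime_on A p" "factors_on A b ps"
    using factors_on_Cons_cancel[OF Cons.prems(1)] by blast
  have bA: "b \<in> A" using b(3) by (rule factors_on_closed)
  have p: "p \<noteq> 0" "p \<in> A" using b(2) unfolding prime_on_def by auto
  have "[:b:] * P \<in> polys_over A"
    using bA Cons.prems by (intro polys.mult_closed) (auto intro: polys.zero_closed)
  moreover have pb: "[:p:] * ([:b:] * P) = Q * E" using Cons.prems(5) b(1) by (simp add: mult.commute)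
  ultimately have "dvd_on (polys_over A) [:p:] (Q * E)" unfolding dvd_on_def by metis
  then consider "dvd_on (polys_over A) [:p:] Q" | "dvd_on (polys_over A) [:p:] E"
    using prime_on_polys_const[OF b(2)] Cons.prems unfolding prime_on_def by blast
  then show ?case
  proof cases
    case 1
    then obtain Q0 where Q0: "Q0 \<in> polys_over A" "Q = [:p:] * Q0" unfolding dvd_on_def by auto
    then have "[:p:] * ([:b:] * P) = [:p:] * (Q0 * E)" using pb by (simp add: mult.assoc)
    then have "[:b:] * P = Q0 * E" using p by (metis mult_left_cancel pCons_eq_0_iff)
    then obtain c1 c2 Q' E' where *: "c1 \<in> A" "c2 \<in> A" "Q' \<in> polys_over A" "E' \<in> polys_over A"
      "b = c1 * c2" "Q0 = [:c1:] * Q'" "E = [:c2:] * E'" "P = Q' * E'"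
      using Cons.IH[OF b(3) Cons.prems(2) Q0(1) Cons.prems(4)] by blast
    then show ?thesis using Q0 b p
      by (intro bexI[of _ "p * c1"] bexI[of _ c2] bexI[of _ Q'] bexI[of _ E'])
        (auto intro: mult_closed simp: mult_ac)
  next
    case 2
    then obtain E0 where E0: "E0 \<in> polys_over A" "E = [:p:] * E0" unfolding dvd_on_def by auto
    then have "[:p:] * ([:b:] * P) = [:p:] * (Q * E0)" using pb by (simp add: mult.assoc mult.left_commute)
    then have "[:b:] * P = Q * E0" using p by (metis mult_left_cancel pCons_eq_0_iff)
    then obtain c1 c2 Q' E' where *: "c1 \<in> A" "c2 \<in> A" "Q' \<in> polys_over A" "E' \<in> polys_over A"
      "b = c1 * c2" "Q = [:c1:] * Q'" "E0 = [:c2:] * E'" "P = Q' * E'"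
      using Cons.IH[OF b(3) Cons.prems(2,3) E0(1)] by blast
    then show ?thesis using E0 b p
      by (intro bexI[of _ c1] bexI[of _ "p * c2"] bexI[of _ Q'] bexI[of _ E'])
        (auto intro: mult_closed simp: mult_ac)
  qed
qed

text \<open>Instead of inverting the leading coefficient of E, it is multiplied into the dividend,
  once per coefficient of F. The remainder is bounded through its coefficients, so that a zero
  remainder by a constant E is no special case.\<close>

lemma pseudo_division:
  assumes "E \<in> polys_over A" "E \<noteq> 0" "F \<in> polys_over A"
  shows "\<exists>c\<in>A. c \<noteq> 0 \<and> (\<exists>q\<in>polys_over A. \<exists>r\<in>polys_over A.
    [:c:] * F = q * E + r \<and> (\<forall>i\<ge>Polynomial.degree E. poly.coeff r i = 0))"
  using assms(3)
proof (induction F)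
  case 0
  then show ?case
    by (intro bexI[of _ 1] conjI bexI[of _ 0]) (auto intro: one_closed polys.zero_closed)
next
  case (pCons a F)
  then obtain c q r where IH: "c \<in> A" "c \<noteq> 0" "q \<in> polys_over A" "r \<in> polys_over A"
    "[:c:] * F = q * E + r" "\<forall>i\<ge>Polynomial.degree E. poly.coeff r i = 0"
    by auto
  define l where "l = Polynomial.lead_coeff E"
  define r' where "r' = pCons (c * a) r"
  define t where "t = poly.coeff r' (Polynomial.degree E)"
  have lA: "l \<in> A" "l \<noteq> 0" using assms polys_over_coeff unfolding l_def by auto
  have r': "r' \<in> polys_over A" using IH pCons.prems unfolding r'_def by (auto intro: mult_closed)
  then have t: "t \<in> A" unfolding t_def by (rule polys_over_coeff)
  have r'0: "poly.coeff r' i = 0" if "i > Polynomial.degree E" for i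
    using that IH(6) unfolding r'_def by (auto simp: coeff_pCons split: nat.split)
  have "[:c:] * pCons a F = pCons 0 q * E + r'"
    using IH(5) unfolding r'_def by (simp add: mult.commute)
  moreover have "[:l * c:] * pCons a F = [:l:] * ([:c:] * pCons a F)" by (simp add: mult_ac)
  ultimately have "[:l * c:] * pCons a F = [:l:] * (pCons 0 q * E + r')" by (simp only:)
  also have "\<dots> = ([:l:] * pCons 0 q + [:t:]) * E + ([:l:] * r' - [:t:] * E)"
    by (simp add: algebra_simps)
  finally have eq: "[:l * c:] * pCons a F = ([:l:] * pCons 0 q + [:t:]) * E + ([:l:] * r' - [:t:] * E)" .
  have deg: "\<forall>i\<ge>Polynomial.degree E. poly.coeff ([:l:] * r' - [:t:] * E) i = 0"
  proof (intro allI impI)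
    fix i assume "i \<ge> Polynomial.degree E"
    then consider "i = Polynomial.degree E" | "i > Polynomial.degree E" by linarith
    then show "poly.coeff ([:l:] * r' - [:t:] * E) i = 0"
      by cases (simp_all add: l_def t_def r'0 coeff_eq_0 mult.commute)
  qed
  have "[:l:] \<in> polys_over A" "[:t:] \<in> polys_over A" "pCons 0 q \<in> polys_over A"
    using lA t IH polys.zero_closed zero_closed by auto
  then have "[:l:] * pCons 0 q + [:t:] \<in> polys_over A" "[:l:] * r' - [:t:] * E \<in> polys_over A"
    using r' assms(1) polys.mult_closed polys.add_closed polys.diff_closed by metis+
  moreover have "l * c \<in> A" "l * c \<noteq> 0" using lA IH mult_closed by auto
  ultimately show ?case using eq deg by blast
qed

text \<open>A prime factor of c would be a constant prime factor of P; so the factorization of c is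
  empty.\<close>

lemma const_factor_of_primitive:
  assumes "ufd_on A" "\<And>p. prime_on A p \<Longrightarrow> \<not> dvd_on (polys_over A) [:p:] P" "P \<noteq> 0"
    and "c \<in> A" "P' \<in> polys_over A" "P = [:c:] * P'"
  shows "dvd_on A c 1"
proof -
  have "c \<noteq> 0" using assms by auto
  then obtain ps where ps: "factors_on A c ps" using assms unfolding ufd_on_def by blast
  show ?thesis
  proof (cases ps)
    case Nil
    then show ?thesis using ps unfolding factors_on_def by auto
  next
    case (Cons p qs)
    obtain b where b: "c = p * b" "prime_on A p" "factors_on A b qs"
      using factors_on_Cons_cancel ps Cons by blast
    have "b \<in> A" using b(3) by (rule factors_on_closed)
    then have "[:b:] * P' \<in> polys_over A" using assms by (auto intro!: smult_polys_over)
    moreover have "P = [:p:] * ([:b:] * P')" unfolding assms(6) b(1) by (simp add: mult_ac)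
    ultimately have "dvd_on (polys_over A) [:p:] P" unfolding dvd_on_def by blast
    then show ?thesis using assms b by blast
  qed
qed

text \<open>An element of least degree in the ideal \<open>(P, U)\<close> plays the role of the greatest common
  divisor over the fraction field.\<close>

lemma primitive_indecomposable_prime:
  assumes ufd: "ufd_on A" and P: "P \<in> polys_over A" "Polynomial.degree P > 0"
    and prim: "\<And>p. prime_on A p \<Longrightarrow> \<not> dvd_on (polys_over A) [:p:] P"
    and ind: "\<And>Q R. Q \<in> polys_over A \<Longrightarrow> R \<in> polys_over A \<Longrightarrow> P = Q * R \<Longrightarrow>
      Polynomial.degree Q = 0 \<or> Polynomial.degree R = 0"
  shows "prime_on (polys_over A) P"
proof -
  let ?AP = "polys_over A"
  have P0: "P \<noteq> 0" using P by auto
  have fac: "\<exists>ps. factors_on A a ps" if "a \<in> A" "a \<noteq> 0" for a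
    using ufd that unfolding ufd_on_def by blast
  have unit: "dvd_on A c 1" if "c \<in> A" "Q \<in> ?AP" "P = [:c:] * Q" for c Q
    using const_factor_of_primitive[OF ufd prim P0] that by blast
  have main: "dvd_on ?AP P U \<or> dvd_on ?AP P V" if U: "U \<in> ?AP" and V: "V \<in> ?AP" and UV: "dvd_on ?AP P (U * V)" for U V
  proof -
    define J where "J = {\<alpha> * P + \<beta> * U | \<alpha> \<beta>. \<alpha> \<in> ?AP \<and> \<beta> \<in> ?AP}"
    have J_sub: "J \<subseteq> ?AP" unfolding J_def using P U by (auto intro: polys.add_closed polys.mult_closed)
    have J_lin: "x * F - y * E \<in> J" if F: "F \<in> J" and E: "E \<in> J" and xy: "x \<in> ?AP" "y \<in> ?AP" for x y F E
    proof -
      obtain a b a' b' where *: "F = a * P + b * U" "E = a' * P + b' * U" "a \<in> ?AP" "b \<in> ?AP" "a' \<in> ?AP" "b' \<in> ?AP"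
        using F E unfolding J_def by blast
      then have "x * F - y * E = (x * a - y * a') * P + (x * b - y * b') * U"
        by (simp add: algebra_simps)
      then show ?thesis using * xy unfolding J_def
        by (blast intro: polys.diff_closed polys.mult_closed)
    qed
    have "P = 1 * P + 0 * U" "U = 0 * P + 1 * U" by simp_all
    then have PJ: "P \<in> J" and UJ: "U \<in> J"
      unfolding J_def using polys.one_closed polys.zero_closed by blast+
    define E where "E = arg_min Polynomial.degree (\<lambda>E. E \<in> J \<and> E \<noteq> 0)"
    have E: "E \<in> J" "E \<noteq> 0" and Emin: "\<And>F. F \<in> J \<Longrightarrow> F \<noteq> 0 \<Longrightarrow> Polynomial.degree E \<le> Polynomial.degree F"
      using arg_min_nat_lemma[of "\<lambda>E. E \<in> J \<and> E \<noteq> 0" P Polynomial.degree] PJ P0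
      unfolding E_def by auto
    have EA: "E \<in> ?AP" using E J_sub by auto
    \<comment> \<open>The pseudo-remainder of F lies in J and is zero or of smaller degree than E,
      so minimality makes it zero: up to a constant, E divides every element of J.\<close>
    have Jdvd: "\<exists>c\<in>A. c \<noteq> 0 \<and> (\<exists>q\<in>?AP. [:c:] * F = q * E)" if F: "F \<in> J" for F
    proof -
      obtain c q r where r: "c \<in> A" "c \<noteq> 0" "q \<in> ?AP" "r \<in> ?AP" "[:c:] * F = q * E + r"
        "\<forall>i\<ge>Polynomial.degree E. poly.coeff r i = 0"
        using pseudo_division[OF EA E(2), of F] F J_sub by blast
      have "[:c:] * F - q * E \<in> J"
        using J_lin[OF F E(1), of "[:c:]" q] r polys.zero_closed by auto
      then have "r \<in> J" using r(5) by simp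
      moreover have "r = 0 \<or> Polynomial.degree r < Polynomial.degree E"
        using r(6) by (metis leading_coeff_0_iff not_le)
      ultimately have "r = 0" using Emin by (metis not_le)
      then show ?thesis using r by auto
    qed
    obtain c q where c: "c \<in> A" "c \<noteq> 0" "q \<in> ?AP" "[:c:] * P = q * E"
      using Jdvd[OF PJ] by blast
    obtain ps where "factors_on A c ps" using fac c by blast
    from const_mult_split[OF this P(1) c(3) EA c(4)]
    obtain c1 c2 q' E' where E': "c1 \<in> A" "c2 \<in> A" "q' \<in> ?AP" "E' \<in> ?AP"
      "E = [:c2:] * E'" "P = q' * E'" by blast
    show ?thesis
      using ind[OF E'(3,4,6)]
    proof (rule disjE)
      \<comment> \<open>Here E agrees with P up to constants and divides U up to a constant. The
        constants that fall on P are units because P is primitive, so P divides U.\<close>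
      assume "Polynomial.degree q' = 0"
      then obtain k where "q' = [:k:]" using degree_eq_zeroE by blast
      then have "k \<in> A" "P = [:k:] * E'" using E' by auto
      then have "dvd_on A k 1" using unit E' by blast
      then obtain k' where k': "k' \<in> A" "k * k' = 1" unfolding dvd_on_def by auto
      have E'P: "E' = [:k':] * P" using k' \<open>P = [:k:] * E'\<close> by (simp add: mult.commute)
      obtain b r where b: "b \<in> A" "b \<noteq> 0" "r \<in> ?AP" "[:b:] * U = r * E" using Jdvd[OF UJ] by blast
      then have "[:b:] * U = r * ([:c2:] * ([:k':] * P))"
        unfolding E'P[symmetric] E'(5)[symmetric] by simp
      then have "[:b:] * U = ([:c2:] * r * [:k':]) * P" by (simp only: mult_ac)
      moreover obtain qs where "factors_on A b qs" using fac b by blast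
      moreover have "[:c2:] * r * [:k':] \<in> ?AP"
        using E' b k' polys.zero_closed by (auto intro!: polys.mult_closed simp del: mult_pCons_left mult_pCons_right)
      ultimately obtain b1 b2 r' P' where r': "b1 \<in> A" "b2 \<in> A" "r' \<in> ?AP" "P' \<in> ?AP"
        "P = [:b2:] * P'" "U = r' * P'"
        using const_mult_split[of b qs U _ P] U P by blast
      then have "dvd_on A b2 1" using unit by blast
      then obtain d where d: "d \<in> A" "b2 * d = 1" unfolding dvd_on_def by auto
      then have "P' = [:d:] * P" unfolding r'(5) by (simp add: mult.commute)
      then have "U = P * ([:d:] * r')" using r'(6) by (simp only: mult_ac)
      moreover have "[:d:] * r' \<in> ?AP" using d r' by (auto intro: smult_polys_over)
      ultimately show ?thesis unfolding dvd_on_def by blast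
    next
      \<comment> \<open>A constant e in the ideal is a Bezout relation e = \<alpha> P + \<beta> U.
        After multiplication by V both summands are multiples of P, so P divides e V and, being
        primitive, V.\<close>
      assume "Polynomial.degree E' = 0"
      then have "Polynomial.degree E = 0" using E' by (simp add: Polynomial.degree_smult_eq)
      then obtain e where e: "E = [:e:]" using degree_eq_zeroE by blast
      then have eA: "e \<in> A" "e \<noteq> 0" using EA E by auto
      obtain \<alpha> \<beta> where ab: "\<alpha> \<in> ?AP" "\<beta> \<in> ?AP" "E = \<alpha> * P + \<beta> * U" using E(1) unfolding J_def by blast
      obtain W where W: "W \<in> ?AP" "U * V = P * W" using UV unfolding dvd_on_def by blast
      have "[:e:] * V = (\<alpha> * V + \<beta> * W) * P"
      proof -
        have "[:e:] * V = \<alpha> * V * P + \<beta> * (U * V)" unfolding e[symmetric] ab(3) by (simp add: algebra_simps)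
        then show ?thesis unfolding W(2) by (simp add: algebra_simps)
      qed
      moreover obtain qs where "factors_on A e qs" using fac eA by blast
      moreover have "\<alpha> * V + \<beta> * W \<in> ?AP" using ab V W by (auto intro: polys.mult_closed polys.add_closed)
      ultimately obtain b1 b2 r' P' where r': "b1 \<in> A" "b2 \<in> A" "r' \<in> ?AP" "P' \<in> ?AP"
        "P = [:b2:] * P'" "V = r' * P'"
        using const_mult_split[of e qs V _ P] V P by blast
      then have "dvd_on A b2 1" using unit by blast
      then obtain d where d: "d \<in> A" "b2 * d = 1" unfolding dvd_on_def by auto
      then have "P' = [:d:] * P" unfolding r'(5) by (simp add: mult.commute)
      then have "V = P * ([:d:] * r')" using r'(6) by (simp only: mult_ac)
      moreover have "[:d:] * r' \<in> ?AP" using d r' by (auto intro: smult_polys_over)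
      ultimately show ?thesis unfolding dvd_on_def by blast
    qed
  qed
  have "\<not> dvd_on ?AP P 1"
  proof
    assume "dvd_on ?AP P 1"
    then obtain Q where Q: "1 = P * Q" unfolding dvd_on_def by auto
    then have "P \<noteq> 0" "Q \<noteq> 0" by auto
    then have "Polynomial.degree (P * Q) = Polynomial.degree P + Polynomial.degree Q"
      by (rule Polynomial.degree_mult_eq)
    then show False using P(2) Q[symmetric] by simp
  qed
  then show ?thesis using main P P0 unfolding prime_on_def by blast
qed

lemma unit_polys_const: "dvd_on A u 1 \<Longrightarrow> dvd_on (polys_over A) [:u:] 1"
proof -
  assume "dvd_on A u 1"
  then obtain v where "v \<in> A" "1 = u * v" unfolding dvd_on_def by auto
  then have "[:v:] \<in> polys_over A" "1 = [:u:] * [:v:]"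
    using polys.zero_closed by (auto simp: one_pCons mult.commute)
  then show ?thesis unfolding dvd_on_def by blast
qed

lemma factors_on_polys_const:
  assumes "factors_on A a ps"
  shows "factors_on (polys_over A) [:a:] (map (\<lambda>p. [:p:]) ps)"
proof -
  obtain u where u: "u \<in> A" "dvd_on A u 1" "\<forall>p\<in>set ps. prime_on A p" "a = u * prod_list ps"
    using assms unfolding factors_on_def by blast
  have "prod_list (map (\<lambda>p. [:p:]) ps) = [:prod_list ps:]"
    by (induction ps) (auto simp: one_pCons mult.commute)
  then have "[:a:] = [:u:] * prod_list (map (\<lambda>p. [:p:]) ps)"
    using u(4) by (simp add: mult.commute)
  moreover have "[:u:] \<in> polys_over A" using u polys.zero_closed by simp
  moreover have "\<forall>p\<in>set (map (\<lambda>p. [:p:]) ps). prime_on (polys_over A) p"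
    using u(3) prime_on_polys_const by auto
  ultimately show ?thesis unfolding factors_on_def using unit_polys_const[OF u(2)] by blast
qed

text \<open>Double induction. Splitting off a constant prime keeps the degree and shortens the
  factorization of the leading coefficient; a factorization into positive degrees lowers the degree;
  what admits neither is primitive and indecomposable, hence prime.\<close>

theorem ufd_on_polys_over:
  assumes ufd: "ufd_on A"
  shows "ufd_on (polys_over A)"
proof -
  let ?AP = "polys_over A"
  have "\<exists>qs. factors_on ?AP P qs" if "P \<in> ?AP" "P \<noteq> 0" for P
    using that
  proof (induction "Polynomial.degree P" arbitrary: P rule: less_induct)
    case less
    have claim: "\<exists>qs. factors_on ?AP Q qs"
      if "factors_on A (Polynomial.lead_coeff Q) ps" "Q \<in> ?AP" "Q \<noteq> 0" "Polynomial.degree Q = Polynomial.degree P" for ps Q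
      using that
    proof (induction "length ps" arbitrary: ps Q rule: less_induct)
      case inner: less
      consider "Polynomial.degree Q = 0" |
        p where "prime_on A p" "dvd_on ?AP [:p:] Q" |
        "Polynomial.degree Q > 0" "\<And>p. prime_on A p \<Longrightarrow> \<not> dvd_on ?AP [:p:] Q"
        by blast
      then show ?case
      proof cases
        case 1
        then obtain a where "Q = [:a:]" using degree_eq_zeroE by blast
        then show ?thesis using inner.prems(1) factors_on_polys_const[of a ps] by auto
      next
        case 2
        then obtain Q' where Q': "Q' \<in> ?AP" "Q = [:p:] * Q'" unfolding dvd_on_def by blast
        have p: "p \<noteq> 0" using 2 unfolding prime_on_def by auto
        have deg: "Polynomial.degree Q' = Polynomial.degree Q" using Q' p by simp
        have lead: "Polynomial.lead_coeff Q = p * Polynomial.lead_coeff Q'" using Q' p by (simp add: Polynomial.lead_coeff_smult)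
        then have "dvd_on A p (Polynomial.lead_coeff Q)"
          unfolding dvd_on_def using polys_over_coeff[OF Q'(1)] by blast
        then obtain b rs where "Polynomial.lead_coeff Q = p * b" "factors_on A b rs" "length ps = Suc (length rs)"
          using prime_on_dvd_factor[OF 2(1) inner.prems(1)] by blast
        then have "factors_on A (Polynomial.lead_coeff Q') rs" "length rs < length ps"
          using lead p by auto
        moreover have "Q' \<noteq> 0" using Q'(2) inner.prems(3) by auto
        moreover have "Polynomial.degree Q' = Polynomial.degree P"
          using deg inner.prems(4) by (rule trans)
        ultimately obtain qs where "factors_on ?AP Q' qs"
          using inner.hyps[of rs Q'] Q'(1) by blast
        then have "factors_on ?AP ([:p:] * Q') ([:p:] # qs)"
          using polys.factors_on_Cons prime_on_polys_const 2 by blast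
        then show ?thesis using Q' by blast
      next
        case 3
        show ?thesis
        proof (cases "\<exists>S R. S \<in> ?AP \<and> R \<in> ?AP \<and> Q = S * R \<and> Polynomial.degree S \<noteq> 0 \<and> Polynomial.degree R \<noteq> 0")
          case True
          then obtain S R where SR: "S \<in> ?AP" "R \<in> ?AP" "Q = S * R" "Polynomial.degree S \<noteq> 0" "Polynomial.degree R \<noteq> 0" by blast
          moreover have SR0: "S \<noteq> 0" "R \<noteq> 0" using SR inner.prems by auto
          ultimately have "Polynomial.degree S + Polynomial.degree R = Polynomial.degree P"
            using inner.prems(4) by (simp add: Polynomial.degree_mult_eq)
          then obtain qs rs where "factors_on ?AP S qs" "factors_on ?AP R rs"
            using less.hyps[of S, OF _ SR(1) SR0(1)] less.hyps[of R, OF _ SR(2) SR0(2)] SR(4,5)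
            by (metis add_less_cancel_left add_less_cancel_right add.left_neutral add.right_neutral gr0I)
          then show ?thesis using polys.factors_on_mult SR(3) by blast
        next
          case False
          then have "prime_on ?AP Q"
            using primitive_indecomposable_prime[OF ufd inner.prems(2) 3] by blast
          then have "factors_on ?AP Q [Q]"
            unfolding factors_on_def dvd_on_def by (intro bexI[of _ 1]) (auto intro: bexI[of _ 1] polys.one_closed)
          then show ?thesis by blast
        qed
      qed
    qed
    have "Polynomial.lead_coeff P \<in> A" "Polynomial.lead_coeff P \<noteq> 0"
      using less.prems polys_over_coeff by auto
    then obtain ps where "factors_on A (Polynomial.lead_coeff P) ps" using ufd unfolding ufd_on_def by blast
    then show ?case using claim less.prems by blast
  qed
  then show ?thesis unfolding ufd_on_def using idom_subring_polys_over by blast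
qed

end

section \<open>Weights\<close>

abbreviation const :: "'k::field \<Rightarrow> 'k mpol" where
  "const \<equiv> Poly_Mapping.single 0"

definition mpols :: "nat set \<Rightarrow> 'k::field mpol set" where
  "mpols V = {p. \<forall>m\<in>Poly_Mapping.keys p. Poly_Mapping.keys m \<subseteq> V}"

definition weight :: "(nat \<Rightarrow> int) \<Rightarrow> (nat \<Rightarrow>\<^sub>0 nat) \<Rightarrow> int" where
  "weight \<delta> m = (\<Sum>i\<in>Poly_Mapping.keys m. \<delta> i * int (Poly_Mapping.lookup m i))"

definition weight_ge :: "(nat \<Rightarrow> int) \<Rightarrow> int \<Rightarrow> 'k::field mpol set" where
  "weight_ge \<delta> a = {p. \<forall>m\<in>Poly_Mapping.keys p. a \<le> weight \<delta> m}"

lemma carrier_mpol_ring: "carrier (mpol_ring N) = mpols {1..N}"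
  unfolding mpol_ring_def mpols_def by simp

lemma keys_add_nat: "Poly_Mapping.keys (m + m' :: nat \<Rightarrow>\<^sub>0 nat) = Poly_Mapping.keys m \<union> Poly_Mapping.keys m'"
  by (auto simp: in_keys_iff lookup_add)

lemma weight_superset:
  "finite S \<Longrightarrow> Poly_Mapping.keys m \<subseteq> S \<Longrightarrow> weight \<delta> m = (\<Sum>i\<in>S. \<delta> i * int (Poly_Mapping.lookup m i))"
  unfolding weight_def by (rule sum.mono_neutral_left) (auto simp: in_keys_iff)

lemma weight_add: "weight \<delta> (m + m') = weight \<delta> m + weight \<delta> m'"
proof -
  let ?S = "Poly_Mapping.keys m \<union> Poly_Mapping.keys m'"
  have "weight \<delta> (m + m') = (\<Sum>i\<in>?S. \<delta> i * int (Poly_Mapping.lookup (m + m') i))"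
    by (rule weight_superset) (auto simp: keys_add_nat)
  also have "\<dots> = (\<Sum>i\<in>?S. \<delta> i * int (Poly_Mapping.lookup m i)) + (\<Sum>i\<in>?S. \<delta> i * int (Poly_Mapping.lookup m' i))"
    by (simp add: lookup_add sum.distrib[symmetric] algebra_simps)
  also have "\<dots> = weight \<delta> m + weight \<delta> m'"
    by (simp add: weight_superset[of ?S])
  finally show ?thesis .
qed

lemma weight_0 [simp]: "weight \<delta> 0 = 0"
  unfolding weight_def by simp

lemma weight_single [simp]: "weight \<delta> (Poly_Mapping.single i n) = \<delta> i * int n"
  unfolding weight_def by (cases "n = 0") auto

text \<open>Weight -1 on the foreign variables makes membership in the subring a weight bound like
  any other, so that closure and factors are treated by the same lemmas.\<close>

lemma mpols_weight: "mpols V = weight_ge (\<lambda>i. if i \<in> V then 0 else - 1) 0"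
proof -
  have "Poly_Mapping.keys m \<subseteq> V \<longleftrightarrow> 0 \<le> weight (\<lambda>i. if i \<in> V then 0 else - 1) m" for m
  proof
    assume "Poly_Mapping.keys m \<subseteq> V"
    then show "0 \<le> weight (\<lambda>i. if i \<in> V then 0 else - 1) m"
      unfolding weight_def by (intro sum_nonneg) auto
  next
    assume *: "0 \<le> weight (\<lambda>i. if i \<in> V then 0 else - 1) m"
    show "Poly_Mapping.keys m \<subseteq> V"
    proof (rule ccontr)
      assume "\<not> Poly_Mapping.keys m \<subseteq> V"
      then obtain j where j: "j \<in> Poly_Mapping.keys m" "j \<notin> V" by auto
      then have "weight (\<lambda>i. if i \<in> V then 0 else - 1) m < (\<Sum>i\<in>Poly_Mapping.keys m. 0)"
        unfolding weight_def by (intro sum_strict_mono_ex1 ballI bexI[of _ j]) (auto simp: in_keys_iff)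
      then show False using * by simp
    qed
  qed
  then show ?thesis unfolding mpols_def weight_ge_def by auto
qed

lemma weight_ge_0 [simp]: "0 \<in> weight_ge \<delta> a"
  unfolding weight_ge_def by simp

lemma weight_ge_add: "p \<in> weight_ge \<delta> a \<Longrightarrow> q \<in> weight_ge \<delta> a \<Longrightarrow> p + q \<in> weight_ge \<delta> a"
  unfolding weight_ge_def using keys_add[of p q] by auto

lemma keys_uminus_mpol: "Poly_Mapping.keys (- p :: 'k::field mpol) = Poly_Mapping.keys p"
  by (auto simp: in_keys_iff)

lemma weight_ge_uminus: "p \<in> weight_ge \<delta> a \<Longrightarrow> - p \<in> weight_ge \<delta> a"
  unfolding weight_ge_def by (simp add: keys_uminus_mpol)

lemma weight_ge_diff: "p \<in> weight_ge \<delta> a \<Longrightarrow> q \<in> weight_ge \<delta> a \<Longrightarrow> p - q \<in> weight_ge \<delta> a"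
  by (metis weight_ge_add weight_ge_uminus diff_conv_add_uminus)

lemma weight_ge_sum: "(\<And>i. i \<in> I \<Longrightarrow> h i \<in> weight_ge \<delta> a) \<Longrightarrow> sum h I \<in> weight_ge \<delta> a"
  by (induction I rule: infinite_finite_induct) (auto intro: weight_ge_add)

lemma weight_ge_mult: "p \<in> weight_ge \<delta> a \<Longrightarrow> q \<in> weight_ge \<delta> b \<Longrightarrow> p * q \<in> weight_ge \<delta> (a + b)"
  unfolding weight_ge_def using keys_mult[of p q] by (fastforce simp: weight_add)

lemma weight_ge_mono: "b \<le> a \<Longrightarrow> p \<in> weight_ge \<delta> a \<Longrightarrow> p \<in> weight_ge \<delta> b"
  unfolding weight_ge_def by auto

lemma weight_ge_single: "a \<le> weight \<delta> m \<Longrightarrow> Poly_Mapping.single m c \<in> weight_ge \<delta> a"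
  unfolding weight_ge_def by auto

lemma weight_ge_var: "a \<le> \<delta> i \<Longrightarrow> var i \<in> weight_ge \<delta> a"
  unfolding var_def by (rule weight_ge_single) simp

lemma weight_ge_const: "a \<le> 0 \<Longrightarrow> const c \<in> weight_ge \<delta> a"
  by (rule weight_ge_single) simp

lemma weight_ge_1: "a \<le> 0 \<Longrightarrow> 1 \<in> weight_ge \<delta> a"
  using weight_ge_const[of a 1] by simp

lemma weight_ge_prod:
  "(\<And>i. i \<in> I \<Longrightarrow> h i \<in> weight_ge \<delta> (a i)) \<Longrightarrow> prod h I \<in> weight_ge \<delta> (sum a I)"
  by (induction I rule: infinite_finite_induct) (auto intro: weight_ge_mult weight_ge_1)

lemma weight_ge_power: "p \<in> weight_ge \<delta> a \<Longrightarrow> p ^ n \<in> weight_ge \<delta> (a * int n)"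
proof (induction n)
  case (Suc n)
  then have "p * p ^ n \<in> weight_ge \<delta> (a + a * int n)" by (intro weight_ge_mult)
  then show ?case by (simp add: algebra_simps)
qed (auto intro: weight_ge_1)

lemma idom_subring_mpols: "idom_subring (mpols V)"
  unfolding mpols_weight
  by standard (auto intro: weight_ge_1 weight_ge_diff weight_ge_mult[of _ _ 0 _ 0, simplified])

global_interpretation mpols: idom_subring "mpols V"
  by (rule idom_subring_mpols)

lemma var_in_mpols: "i \<in> V \<Longrightarrow> var i \<in> mpols V"
  unfolding mpols_def var_def by auto

lemma const_in_mpols: "const c \<in> mpols V"
  unfolding mpols_def by auto

lemma mpols_mono: "V \<subseteq> V' \<Longrightarrow> mpols V \<subseteq> mpols V'"
  unfolding mpols_def by blast

lemma var_nonzero [simp]: "var i \<noteq> 0"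
  unfolding var_def by (metis lookup_single_eq lookup_zero zero_neq_one)

lemma obtain_min_weight:
  assumes "p \<noteq> 0"
  obtains b where "p \<in> weight_ge \<delta> b" "p \<notin> weight_ge \<delta> (b + 1)"
proof -
  define b where "b = Min (weight \<delta> ` Poly_Mapping.keys p)"
  have ne: "Poly_Mapping.keys p \<noteq> {}" using assms by simp
  have "p \<in> weight_ge \<delta> b" unfolding weight_ge_def b_def by auto
  moreover have "b \<in> weight \<delta> ` Poly_Mapping.keys p"
    unfolding b_def using ne by (intro Min_in) auto
  then have "p \<notin> weight_ge \<delta> (b + 1)" unfolding weight_ge_def by force
  ultimately show thesis using that by blast
qed

lemma mpol_sum_singles: "p = (\<Sum>m\<in>Poly_Mapping.keys p. Poly_Mapping.single m (Poly_Mapping.lookup p m))"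
proof (rule poly_mapping_eqI)
  fix m
  let ?c = "\<lambda>m. Poly_Mapping.single m (Poly_Mapping.lookup p m)"
  have "Poly_Mapping.lookup (\<Sum>m\<in>Poly_Mapping.keys p. ?c m) m = (\<Sum>m'\<in>Poly_Mapping.keys p. if m' = m then Poly_Mapping.lookup p m' else 0)"
    unfolding lookup_sum by (rule sum.cong) (auto simp: lookup_single when_def)
  also have "\<dots> = Poly_Mapping.lookup p m" by (auto simp: in_keys_iff)
  finally show "Poly_Mapping.lookup p m = Poly_Mapping.lookup (\<Sum>m\<in>Poly_Mapping.keys p. ?c m) m" ..
qed

lemma weight_ge_split:
  assumes "p \<in> weight_ge \<delta> a"
  obtains p0 p1 where "p = p0 + p1" "p1 \<in> weight_ge \<delta> (a + 1)" "\<forall>m\<in>Poly_Mapping.keys p0. weight \<delta> m = a"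
proof -
  let ?c = "\<lambda>m. Poly_Mapping.single m (Poly_Mapping.lookup p m)"
  define K where "K = {m \<in> Poly_Mapping.keys p. weight \<delta> m = a}"
  have "p = (\<Sum>m\<in>Poly_Mapping.keys p. ?c m)" by (rule mpol_sum_singles)
  also have "\<dots> = sum ?c K + sum ?c (Poly_Mapping.keys p - K)"
    unfolding K_def by (subst add.commute, rule sum.subset_diff) auto
  finally have "p = sum ?c K + sum ?c (Poly_Mapping.keys p - K)" .
  moreover have "sum ?c (Poly_Mapping.keys p - K) \<in> weight_ge \<delta> (a + 1)"
    using assms unfolding K_def weight_ge_def[of \<delta> a] by (intro weight_ge_sum weight_ge_single) force
  moreover have "\<forall>m\<in>Poly_Mapping.keys (sum ?c K). weight \<delta> m = a"
    using keys_sum[of ?c K] unfolding K_def by (fastforce split: if_splits)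
  ultimately show thesis using that by blast
qed

text \<open>The parts of lowest weight have a nonzero product, since polynomials form a domain;
  everything else in the product has larger weight.\<close>

lemma lowest_weight_mult:
  assumes "p \<in> weight_ge \<delta> a" "p \<notin> weight_ge \<delta> (a + 1)" "q \<in> weight_ge \<delta> b" "q \<notin> weight_ge \<delta> (b + 1)"
  shows "p * q \<notin> weight_ge \<delta> (a + b + 1)"
proof
  assume pq: "p * q \<in> weight_ge \<delta> (a + b + 1)"
  obtain p0 p1 where p: "p = p0 + p1" "p1 \<in> weight_ge \<delta> (a + 1)" "\<forall>m\<in>Poly_Mapping.keys p0. weight \<delta> m = a"
    using weight_ge_split[OF assms(1)] .
  obtain q0 q1 where q: "q = q0 + q1" "q1 \<in> weight_ge \<delta> (b + 1)" "\<forall>m\<in>Poly_Mapping.keys q0. weight \<delta> m = b"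
    using weight_ge_split[OF assms(3)] .
  have "p0 \<noteq> 0" "q0 \<noteq> 0" using p q assms by auto
  then obtain m where m: "m \<in> Poly_Mapping.keys (p0 * q0)"
    using keys_eq_empty by (metis all_not_in_conv mult_eq_0_iff)
  then have "weight \<delta> m = a + b"
    using keys_mult[of p0 q0] p(3) q(3) by (force simp: weight_add)
  moreover have "p0 \<in> weight_ge \<delta> a" using p(3) unfolding weight_ge_def by auto
  then have "p0 * q1 \<in> weight_ge \<delta> (a + b + 1)" "p1 * q \<in> weight_ge \<delta> (a + b + 1)"
    using weight_ge_mult[of p0 \<delta> a q1 "b + 1"] weight_ge_mult[of p1 \<delta> "a + 1" q b] p q assms(3)
    by (simp_all add: algebra_simps)
  then have "p * q - p0 * q1 - p1 * q \<in> weight_ge \<delta> (a + b + 1)" using pq by (intro weight_ge_diff)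
  then have "p0 * q0 \<in> weight_ge \<delta> (a + b + 1)" using p(1) q(1) by (simp add: algebra_simps)
  ultimately show False using m unfolding weight_ge_def by force
qed

text \<open>Lowest weight is additive, like a valuation. Applied to \<open>h\<close> and to the
  binomials, this decides by weights alone which cofactors are admissible.\<close>

lemma weight_ge_cancel:
  assumes "p \<in> weight_ge \<delta> a" "p \<notin> weight_ge \<delta> (a + 1)" "p * q \<in> weight_ge \<delta> (a + b)"
  shows "q \<in> weight_ge \<delta> b"
proof (cases "q = 0")
  case False
  then obtain c where c: "q \<in> weight_ge \<delta> c" "q \<notin> weight_ge \<delta> (c + 1)" by (rule obtain_min_weight)
  have "b \<le> c"
  proof (rule ccontr)
    assume "\<not> b \<le> c"
    then have "p * q \<in> weight_ge \<delta> (a + c + 1)" using assms(3) by (auto elim: weight_ge_mono[rotated])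
    then show False using lowest_weight_mult assms c by blast
  qed
  then show ?thesis using c weight_ge_mono by blast
qed simp

text \<open>With weight -1 on the variables outside V no monomial has positive weight; a negative
  lowest weight of one factor could only be offset by a positive one of the other.\<close>

lemma mpols_divisor:
  assumes "p * q \<in> mpols V" "p * q \<noteq> 0"
  shows "p \<in> mpols V"
proof -
  let ?\<delta> = "\<lambda>i. if i \<in> V then 0 else - 1 :: int"
  have nonpos: "weight ?\<delta> m \<le> 0" for m unfolding weight_def by (rule sum_nonpos) auto
  have neg: "r \<notin> weight_ge ?\<delta> 1" if nz: "r \<noteq> 0" for r :: "'a mpol"
  proof -
    obtain m where "m \<in> Poly_Mapping.keys r" using nz keys_eq_empty by blast
    then have "1 \<le> weight ?\<delta> m" if "r \<in> weight_ge ?\<delta> 1"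
      using that unfolding weight_ge_def by blast
    then show ?thesis using nonpos[of m] by fastforce
  qed
  obtain a where a: "p \<in> weight_ge ?\<delta> a" "p \<notin> weight_ge ?\<delta> (a + 1)"
    using obtain_min_weight assms(2) by (metis mult_zero_left)
  have "a \<ge> 0"
  proof (rule ccontr)
    assume "\<not> a \<ge> 0"
    then have "p * q \<in> weight_ge ?\<delta> (a + 1)" using assms(1) weight_ge_mono[of "a + 1" 0] unfolding mpols_weight by simp
    then have "q \<in> weight_ge ?\<delta> 1" using weight_ge_cancel[OF a] by blast
    then show False using neg assms(2) by auto
  qed
  then show ?thesis using a weight_ge_mono unfolding mpols_weight by blast
qed

section \<open>Substitution\<close>

definition monom_subst :: "(nat \<Rightarrow> 'k::field mpol) \<Rightarrow> (nat \<Rightarrow>\<^sub>0 nat) \<Rightarrow> 'k mpol" where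
  "monom_subst G m = (\<Prod>i\<in>Poly_Mapping.keys m. G i ^ Poly_Mapping.lookup m i)"

lemma monom_subst_superset:
  "finite S \<Longrightarrow> Poly_Mapping.keys m \<subseteq> S \<Longrightarrow> monom_subst G m = (\<Prod>i\<in>S. G i ^ Poly_Mapping.lookup m i)"
  unfolding monom_subst_def by (rule prod.mono_neutral_left) (auto simp: in_keys_iff)

lemma monom_subst_add: "monom_subst G (m + m') = monom_subst G m * monom_subst G m'"
proof -
  let ?S = "Poly_Mapping.keys m \<union> Poly_Mapping.keys m'"
  have "monom_subst G (m + m') = (\<Prod>i\<in>?S. G i ^ Poly_Mapping.lookup (m + m') i)"
    by (rule monom_subst_superset) (auto simp: keys_add_nat)
  also have "\<dots> = (\<Prod>i\<in>?S. G i ^ Poly_Mapping.lookup m i) * (\<Prod>i\<in>?S. G i ^ Poly_Mapping.lookup m' i)"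
    by (simp add: lookup_add power_add prod.distrib[symmetric])
  also have "\<dots> = monom_subst G m * monom_subst G m'"
    by (simp add: monom_subst_superset[of ?S])
  finally show ?thesis .
qed

lemma monom_subst_0 [simp]: "monom_subst G 0 = 1"
  unfolding monom_subst_def by simp

lemma mpol_subst_superset:
  assumes "finite S" "Poly_Mapping.keys p \<subseteq> S"
  shows "mpol_subst G p = (\<Sum>m\<in>S. const (Poly_Mapping.lookup p m) * monom_subst G m)"
  unfolding mpol_subst_def monom_subst_def[symmetric] using assms
  by (intro sum.mono_neutral_left) (auto simp: in_keys_iff)

lemma mpol_subst_add: "mpol_subst G (p + q) = mpol_subst G p + mpol_subst G q"
proof -
  let ?S = "Poly_Mapping.keys p \<union> Poly_Mapping.keys q"
  have "mpol_subst G (p + q) = (\<Sum>m\<in>?S. const (Poly_Mapping.lookup (p + q) m) * monom_subst G m)"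
    using keys_add[of p q] by (intro mpol_subst_superset) auto
  also have "\<dots> = (\<Sum>m\<in>?S. const (Poly_Mapping.lookup p m) * monom_subst G m) + (\<Sum>m\<in>?S. const (Poly_Mapping.lookup q m) * monom_subst G m)"
    by (simp add: lookup_add single_add distrib_right sum.distrib)
  also have "\<dots> = mpol_subst G p + mpol_subst G q"
    by (simp add: mpol_subst_superset[of ?S])
  finally show ?thesis .
qed

lemma mpol_subst_0 [simp]: "mpol_subst G 0 = 0"
  unfolding mpol_subst_def by simp

lemma mpol_subst_sum: "mpol_subst G (sum h I) = (\<Sum>i\<in>I. mpol_subst G (h i))"
  by (induction I rule: infinite_finite_induct) (auto simp: mpol_subst_add)

lemma mpol_subst_single: "mpol_subst G (Poly_Mapping.single m c) = const c * monom_subst G m"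
  by (subst mpol_subst_superset[of "{m}"]) auto

lemma mpol_subst_const [simp]: "mpol_subst G (const c) = const c"
  by (simp add: mpol_subst_single)

lemma mpol_subst_1 [simp]: "mpol_subst G 1 = 1"
  using mpol_subst_const[of G 1] by simp

lemma mpol_subst_var [simp]: "mpol_subst G (var i) = G i"
  unfolding var_def mpol_subst_single by (simp add: monom_subst_def)

lemma mpol_subst_mult: "mpol_subst G (p * q) = mpol_subst G p * mpol_subst G q"
proof -
  have "p * q =
      (\<Sum>m\<in>Poly_Mapping.keys p. \<Sum>m'\<in>Poly_Mapping.keys q.
        Poly_Mapping.single m (Poly_Mapping.lookup p m) * Poly_Mapping.single m' (Poly_Mapping.lookup q m'))"
    by (simp only: sum_product[symmetric] mpol_sum_singles[symmetric])
  then have "mpol_subst G (p * q) = mpol_subst G (\<Sum>m\<in>Poly_Mapping.keys p. \<Sum>m'\<in>Poly_Mapping.keys q.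
        Poly_Mapping.single m (Poly_Mapping.lookup p m) * Poly_Mapping.single m' (Poly_Mapping.lookup q m'))"
    by (rule arg_cong)
  also have "\<dots> = (\<Sum>m\<in>Poly_Mapping.keys p. \<Sum>m'\<in>Poly_Mapping.keys q.
      mpol_subst G (Poly_Mapping.single m (Poly_Mapping.lookup p m)) * mpol_subst G (Poly_Mapping.single m' (Poly_Mapping.lookup q m')))"
    unfolding mpol_subst_sum mult_single mpol_subst_single monom_subst_add
    by (intro sum.cong refl) (metis (no_types, lifting) add.right_neutral mult.assoc mult.left_commute mult_single)
  also have "\<dots> = mpol_subst G (\<Sum>m\<in>Poly_Mapping.keys p. Poly_Mapping.single m (Poly_Mapping.lookup p m)) *
      mpol_subst G (\<Sum>m\<in>Poly_Mapping.keys q. Poly_Mapping.single m (Poly_Mapping.lookup q m))"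
    unfolding mpol_subst_sum by (simp only: sum_product)
  finally show ?thesis by (simp only: mpol_sum_singles[symmetric])
qed

lemma mpol_subst_uminus: "mpol_subst G (- p) = - mpol_subst G p"
  using mpol_subst_add[of G p "- p"] by (simp add: add_eq_0_iff)

lemma mpol_subst_diff: "mpol_subst G (p - q) = mpol_subst G p - mpol_subst G q"
  using mpol_subst_add[of G p "- q"] by (simp add: mpol_subst_uminus)

lemma mpol_subst_power: "mpol_subst G (p ^ n) = mpol_subst G p ^ n"
  by (induction n) (auto simp: mpol_subst_mult)

lemma monom_subst_var: "monom_subst var m = Poly_Mapping.single m 1"
proof -
  have pow: "var i ^ n = Poly_Mapping.single (Poly_Mapping.single i n) (1::'a)" for i n
    by (induction n) (auto simp: var_def mult_single single_add[symmetric])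
  have "(\<Prod>i\<in>I. Poly_Mapping.single (h i) (1::'a)) = Poly_Mapping.single (\<Sum>i\<in>I. h i) 1" if "finite I" for I and h :: "nat \<Rightarrow> nat \<Rightarrow>\<^sub>0 nat"
    using that by (induction I) (auto simp: mult_single)
  then have "monom_subst var m = Poly_Mapping.single (\<Sum>i\<in>Poly_Mapping.keys m. Poly_Mapping.single i (Poly_Mapping.lookup m i)) (1::'a)"
    unfolding monom_subst_def pow by simp
  also have "(\<Sum>i\<in>Poly_Mapping.keys m. Poly_Mapping.single i (Poly_Mapping.lookup m i)) = m"
  proof (rule poly_mapping_eqI)
    fix j
    have "Poly_Mapping.lookup (\<Sum>i\<in>Poly_Mapping.keys m. Poly_Mapping.single i (Poly_Mapping.lookup m i)) j = (\<Sum>i\<in>Poly_Mapping.keys m. if i = j then Poly_Mapping.lookup m i else 0)"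
      unfolding lookup_sum by (rule sum.cong) (auto simp: lookup_single when_def)
    then show "Poly_Mapping.lookup (\<Sum>i\<in>Poly_Mapping.keys m. Poly_Mapping.single i (Poly_Mapping.lookup m i)) j = Poly_Mapping.lookup m j"
      by (auto simp: in_keys_iff)
  qed
  finally show ?thesis .
qed

lemma mpol_subst_cong:
  assumes "p \<in> mpols V" "\<And>i. i \<in> V \<Longrightarrow> G i = G' i"
  shows "mpol_subst G p = mpol_subst G' p"
  unfolding mpol_subst_def using assms
  by (intro sum.cong arg_cong2[of _ _ _ _ "(*)"] prod.cong) (auto simp: mpols_def subset_iff)

lemma mpol_subst_ident: "mpol_subst var p = p"
proof -
  have "mpol_subst var p = (\<Sum>m\<in>Poly_Mapping.keys p. Poly_Mapping.single m (Poly_Mapping.lookup p m))"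
    by (subst mpol_subst_superset[of "Poly_Mapping.keys p"]) (simp_all add: monom_subst_var mult_single)
  then show ?thesis using mpol_sum_singles by metis
qed

lemma mpol_subst_fix:
  assumes "p \<in> mpols V" "\<And>i. i \<in> V \<Longrightarrow> G i = var i"
  shows "mpol_subst G p = p"
  by (rule trans[OF mpol_subst_cong[OF assms] mpol_subst_ident])


lemma mpol_subst_in_subring:
  assumes "idom_subring B" "p \<in> mpols V" "\<And>i. i \<in> V \<Longrightarrow> G i \<in> B" "\<And>c. const c \<in> B"
  shows "mpol_subst G p \<in> B"
proof -
  interpret idom_subring B by fact
  show ?thesis unfolding mpol_subst_def using assms(2-4)
    by (intro sum_closed mult_closed prod_closed power_closed) (auto simp: mpols_def)
qed

lemma mpol_subst_weight_ge:
  assumes "p \<in> mpols V" "p \<in> weight_ge \<delta> a" "\<And>i. i \<in> V \<Longrightarrow> G i \<in> weight_ge \<delta>' (\<delta> i)"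
  shows "mpol_subst G p \<in> weight_ge \<delta>' a"
  unfolding mpol_subst_def
proof (intro weight_ge_sum)
  fix m assume m: "m \<in> Poly_Mapping.keys p"
  have "(\<Prod>i\<in>Poly_Mapping.keys m. G i ^ Poly_Mapping.lookup m i) \<in> weight_ge \<delta>' (weight \<delta> m)"
    unfolding weight_def using assms m by (intro weight_ge_prod weight_ge_power) (auto simp: mpols_def)
  then have "const (Poly_Mapping.lookup p m) * (\<Prod>i\<in>Poly_Mapping.keys m. G i ^ Poly_Mapping.lookup m i) \<in> weight_ge \<delta>' (0 + weight \<delta> m)"
    by (intro weight_ge_mult weight_ge_const) simp_all
  then show "const (Poly_Mapping.lookup p m) * (\<Prod>i\<in>Poly_Mapping.keys m. G i ^ Poly_Mapping.lookup m i) \<in> weight_ge \<delta>' a"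
    using assms(2) m weight_ge_mono unfolding weight_ge_def[of \<delta> a] by fastforce
qed

text \<open>Singles out one variable, which makes roots, synthetic division and induction on
  coefficients of the univariate \<open>poly\<close> available.\<close>

lemma mpols_fresh_poly:
  assumes "p \<in> mpols V"
  obtains P where "P \<in> polys_over (mpols (V - {v}))" "p = poly P (var v)"
proof -
  have mono: "\<exists>P\<in>polys_over (mpols (V - {v})). Poly_Mapping.single m c = poly P (var v)"
    if m: "Poly_Mapping.keys m \<subseteq> V" for m and c :: 'a
  proof -
    let ?r = "\<Prod>i\<in>Poly_Mapping.keys m - {v}. var i ^ Poly_Mapping.lookup m i"
    have "Poly_Mapping.single m c = const c * monom_subst var m"
      unfolding monom_subst_var mult_single by simp
    also have "monom_subst var m = ?r * var v ^ Poly_Mapping.lookup m v"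
      by (subst monom_subst_superset[of "insert v (Poly_Mapping.keys m)"]) (auto simp: prod.insert_remove mult.commute)
    finally have "Poly_Mapping.single m c = poly (Polynomial.monom (const c * ?r) (Poly_Mapping.lookup m v)) (var v)"
      by (simp add: poly_monom mult.assoc)
    moreover have "const c * ?r \<in> mpols (V - {v})"
      using m by (intro mpols.mult_closed mpols.prod_closed mpols.power_closed const_in_mpols var_in_mpols) auto
    then have "Polynomial.monom (const c * ?r) (Poly_Mapping.lookup m v) \<in> polys_over (mpols (V - {v}))"
      unfolding polys_over_def by (auto simp: mpols.zero_closed)
    ultimately show ?thesis by blast
  qed
  interpret PP: idom_subring "polys_over (mpols (V - {v}))"
    by (rule mpols.idom_subring_polys_over)
  have "\<exists>P\<in>polys_over (mpols (V - {v})). (\<Sum>m\<in>S. Poly_Mapping.single m (Poly_Mapping.lookup p m)) = poly P (var v)"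
    if "S \<subseteq> Poly_Mapping.keys p" for S
    using finite_subset[OF that finite_keys] that
  proof (induction S)
    case empty
    then show ?case using PP.zero_closed by (auto intro: bexI[of _ 0])
  next
    case (insert m S)
    then obtain P where "P \<in> polys_over (mpols (V - {v}))" "(\<Sum>m\<in>S. Poly_Mapping.single m (Poly_Mapping.lookup p m)) = poly P (var v)"
      by auto
    moreover obtain Q where "Q \<in> polys_over (mpols (V - {v}))" "Poly_Mapping.single m (Poly_Mapping.lookup p m) = poly Q (var v)"
      using mono[of m] insert.prems assms unfolding mpols_def by blast
    ultimately show ?case using insert.hyps PP.add_closed
      by (intro bexI[of _ "Q + P"]) auto
  qed
  from this[of "Poly_Mapping.keys p"] show thesis using that mpol_sum_singles[of p] by auto
qed

lemma poly_fresh_closed: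
  assumes "P \<in> polys_over (mpols V)" "r \<in> mpols V'" "V \<subseteq> V'"
  shows "poly P r \<in> mpols V'"
  using assms(1)
  by (induction P) (use assms mpols_mono[OF assms(3)] in \<open>auto intro!: mpols.add_closed mpols.mult_closed mpols.zero_closed\<close>)

text \<open>The constant coefficient is free of v and yet a multiple of \<open>var v\<close>, so it
  vanishes, and one factor \<open>f * var v\<close> cancels. The general factor f is there for the
  evaluation that sends s to f t.\<close>

lemma poly_fresh_scaled_inj:
  assumes "P \<in> polys_over (mpols V)" "v \<notin> V" "f \<noteq> 0" "poly P (f * var v) = 0"
  shows "P = 0"
  using assms(1,4)
proof (induction P)
  case (pCons a P)
  let ?\<delta> = "\<lambda>i. if i = v then 1 else 0 :: int"
  have a: "a \<in> mpols V" "P \<in> polys_over (mpols V)" using pCons.prems by auto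
  have eq: "a = - (f * var v * poly P (f * var v))" using pCons.prems by (simp add: eq_neg_iff_add_eq_0)
  have "f * var v * poly P (f * var v) \<in> weight_ge ?\<delta> (0 + 1 + 0)"
    by (intro weight_ge_mult weight_ge_var) (auto simp: weight_ge_def weight_def sum_nonneg)
  then have *: "a \<in> weight_ge ?\<delta> 1" unfolding eq by (auto intro: weight_ge_uminus)
  have "a = 0"
  proof (rule ccontr)
    assume "a \<noteq> 0"
    then obtain m where m: "m \<in> Poly_Mapping.keys a" using keys_eq_empty by blast
    then have "weight ?\<delta> m = 0"
      unfolding weight_def using a(1) assms(2) by (intro sum.neutral) (auto simp: mpols_def)
    then show False using m * unfolding weight_ge_def by force
  qed
  then have "poly P (f * var v) = 0" using eq assms(3) by auto
  then show ?case using pCons.IH a \<open>a = 0\<close> by simp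
qed simp

lemma poly_fresh_inj:
  "P \<in> polys_over (mpols V) \<Longrightarrow> v \<notin> V \<Longrightarrow> poly P (var v) = 0 \<Longrightarrow> P = 0"
  using poly_fresh_scaled_inj[of P V v 1] by simp

lemma mpol_subst_poly_fresh:
  assumes "P \<in> polys_over (mpols V)" "\<And>i. i \<in> V \<Longrightarrow> G i = var i"
  shows "mpol_subst G (poly P r) = poly P (mpol_subst G r)"
  using assms(1)
  by (induction P) (auto simp: mpol_subst_add mpol_subst_mult mpol_subst_fix[OF _ assms(2)])

text \<open>Factor theorem: substituting for v evaluates a univariate polynomial at r, and synthetic
  division by r keeps all coefficients free of v.\<close>

lemma mpol_subst_eq_0_dvd:
  assumes "p \<in> mpols V" "r \<in> mpols (V - {v})" "v \<in> V" "mpol_subst (var(v := r)) p = 0"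
  obtains q where "q \<in> mpols V" "p = (var v - r) * q"
proof -
  obtain P where P: "P \<in> polys_over (mpols (V - {v}))" "p = poly P (var v)"
    using mpols_fresh_poly[OF assms(1)] .
  have "poly P r = 0"
    using assms(4) mpol_subst_poly_fresh[OF P(1), of "var(v := r)" "var v"] unfolding P(2) by simp
  then have "P = [:- r, 1:] * synthetic_div P r"
    using synthetic_div_correct'[of r P] by simp
  then have "poly P (var v) = poly ([:- r, 1:] * synthetic_div P r) (var v)" by (rule arg_cong)
  then have "p = (var v - r) * poly (synthetic_div P r) (var v)"
    using P(2) by (simp add: algebra_simps)
  moreover have "Q \<in> polys_over (mpols (V - {v})) \<Longrightarrow> synthetic_div Q r \<in> polys_over (mpols (V - {v}))" for Q
    by (induction Q) (auto simp: poly_fresh_closed[OF _ assms(2)] idom_subring.zero_closed[OF mpols.idom_subring_polys_over] synthetic_div_pCons)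
  then have "poly (synthetic_div P r) (var v) \<in> mpols V"
    using P(1) assms(3) by (intro poly_fresh_closed[of _ "V - {v}"] var_in_mpols) auto
  ultimately show thesis using that by blast
qed

lemma const_mult_eq: "const a * const b = const (a * b)"
  by (simp add: mult_single)

text \<open>As a univariate polynomial in v over a domain, p has finitely many roots, while the
  elements l u are pairwise distinct. The value l = 0 is excluded as well because the binomial must
  keep its second term, see \<open>binomial_weight\<close>.\<close>

lemma exists_nonvanishing_subst:
  fixes p :: "'k::field mpol"
  assumes "infinite (UNIV :: 'k set)" "p \<in> mpols V" "p \<noteq> 0" "u \<in> mpols (V - {v})" "u \<noteq> 0"
  obtains l :: 'k where "l \<noteq> 0" "mpol_subst (var(v := const l * u)) p \<noteq> 0"
proof -
  obtain P where P: "P \<in> polys_over (mpols (V - {v}))" "p = poly P (var v)"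
    using mpols_fresh_poly[OF assms(2)] .
  have "P \<noteq> 0" using P assms(3) by auto
  then have fin: "finite {x. poly P x = 0}" by (rule poly_roots_finite)
  have "inj_on (\<lambda>l::'k. const l * u) (UNIV - {0})"
    using assms(5) by (auto intro!: inj_onI) (metis lookup_single_eq)
  then have "infinite ((\<lambda>l::'k. const l * u) ` (UNIV - {0}))"
    using assms(1) by (simp add: finite_image_iff)
  then obtain x where "x \<in> (\<lambda>l::'k. const l * u) ` (UNIV - {0})" "poly P x \<noteq> 0"
    using fin by (metis (mono_tags, lifting) finite_subset mem_Collect_eq subsetI)
  then obtain l where "l \<noteq> 0" "poly P (const l * u) \<noteq> 0" by auto
  moreover have "mpol_subst (var(v := const l * u)) p = poly P (const l * u)"
    unfolding P(2) using mpol_subst_poly_fresh[OF P(1), of "var(v := const l * u)" "var v"] by simp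
  ultimately show thesis using that by auto
qed

section \<open>Regular sequences by successive elimination\<close>

definition adjoin_ideal :: "'a::idom set \<Rightarrow> 'a set \<Rightarrow> 'a \<Rightarrow> 'a set" where
  "adjoin_ideal B K a = {k + a * b | k b. k \<in> K \<and> b \<in> B}"

text \<open>\<open>as\<close> is a regular sequence on \<open>B / K\<close>, up to the requirement that the last quotient be nonzero.\<close>

primrec regular_mod :: "'a::idom set \<Rightarrow> 'a set \<Rightarrow> 'a list \<Rightarrow> bool" where
  "regular_mod B K [] = True"
| "regular_mod B K (a # as) \<longleftrightarrow>
     a \<in> B \<and> (\<forall>b\<in>B. a * b \<in> K \<longrightarrow> b \<in> K) \<and> regular_mod B (adjoin_ideal B K a) as"

text \<open>With K the full preimage of K', the map \<phi> identifies the two quotients, and the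
  preimages match again after each adjunction. It serves both for the substitutions and for the
  evaluation onto the Rees algebra.\<close>

lemma regular_mod_quotient:
  fixes \<phi> :: "'a::idom \<Rightarrow> 'b::idom"
  assumes "idom_subring B"
    and diff: "\<And>x y. x \<in> B \<Longrightarrow> y \<in> B \<Longrightarrow> \<phi> (x - y) = \<phi> x - \<phi> y"
    and mult: "\<And>x y. x \<in> B \<Longrightarrow> y \<in> B \<Longrightarrow> \<phi> (x * y) = \<phi> x * \<phi> y"
    and "K = {b \<in> B. \<phi> b \<in> K'}" "set as \<subseteq> B"
  shows "regular_mod B K as \<longleftrightarrow> regular_mod (\<phi> ` B) K' (map \<phi> as)"
  using assms(4,5)
proof (induction as arbitrary: K K')
  case (Cons a as)
  interpret idom_subring B by fact
  have a: "a \<in> B" "set as \<subseteq> B" using Cons.prems by auto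
  have "adjoin_ideal B K a = {b \<in> B. \<phi> b \<in> adjoin_ideal (\<phi> ` B) K' (\<phi> a)}"
  proof (intro equalityI subsetI)
    fix x assume "x \<in> adjoin_ideal B K a"
    then obtain k b where x: "x = k + a * b" "k \<in> K" "b \<in> B" unfolding adjoin_ideal_def by auto
    have kB: "k \<in> B" "\<phi> k \<in> K'" using x Cons.prems by auto
    have xB: "x \<in> B" using x kB a by (auto intro: add_closed mult_closed)
    have "\<phi> k = \<phi> x - \<phi> (a * b)" using diff[OF xB, of "a * b"] x a mult_closed by simp
    then have "\<phi> x = \<phi> k + \<phi> a * \<phi> b" using mult a x by simp
    then show "x \<in> {b \<in> B. \<phi> b \<in> adjoin_ideal (\<phi> ` B) K' (\<phi> a)}"
      unfolding adjoin_ideal_def using xB kB x by blast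
  next
    fix x assume "x \<in> {b \<in> B. \<phi> b \<in> adjoin_ideal (\<phi> ` B) K' (\<phi> a)}"
    then obtain k' b where x: "x \<in> B" "\<phi> x = k' + \<phi> a * \<phi> b" "k' \<in> K'" "b \<in> B"
      unfolding adjoin_ideal_def by auto
    have ab: "a * b \<in> B" using a x by (auto intro: mult_closed)
    have "\<phi> (x - a * b) = k'" using diff[OF x(1) ab] mult[OF a(1) x(4)] x by simp
    then have "x - a * b \<in> K" using Cons.prems(1) x ab diff_closed by auto
    moreover have "x = (x - a * b) + a * b" by simp
    ultimately show "x \<in> adjoin_ideal B K a"
      unfolding adjoin_ideal_def using x(4) by blast
  qed
  then have "regular_mod B (adjoin_ideal B K a) as \<longleftrightarrow>
      regular_mod (\<phi> ` B) (adjoin_ideal (\<phi> ` B) K' (\<phi> a)) (map \<phi> as)"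
    using Cons.IH a by blast
  moreover have "(\<forall>b\<in>B. a * b \<in> K \<longrightarrow> b \<in> K) \<longleftrightarrow> (\<forall>b\<in>\<phi> ` B. \<phi> a * b \<in> K' \<longrightarrow> b \<in> K')"
    using Cons.prems(1) mult a mult_closed by auto
  ultimately show ?case using a by auto
qed simp

text \<open>On all variables and with \<open>tower_weight n 0\<close>, the bound 0 gives the algebra
  B and the bound - (d - 2) gives N.\<close>

definition wpols :: "nat set \<Rightarrow> (nat \<Rightarrow> int) \<Rightarrow> int \<Rightarrow> 'k::field mpol set" where
  "wpols V \<delta> a = mpols V \<inter> weight_ge \<delta> a"

lemma idom_subring_wpols: "idom_subring (wpols V \<delta> 0)"
  unfolding wpols_def
  by standard (auto intro: weight_ge_1 weight_ge_diff weight_ge_mult[of _ _ 0 _ 0, simplified]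
      mpols.one_closed mpols.diff_closed mpols.mult_closed)

lemma wpols_mult: "p \<in> wpols V \<delta> a \<Longrightarrow> q \<in> wpols V \<delta> b \<Longrightarrow> p * q \<in> wpols V \<delta> (a + b)"
  unfolding wpols_def by (auto intro: weight_ge_mult mpols.mult_closed)

text \<open>One elimination. If a b = q p for a = var v - r, the substitution kills p, so p is a
  multiple of a; as the lowest weight of a is exactly 0, the cofactor obeys the same bound as p, and
  b lies in q N. Modulo a the pair is replaced by its image. The remaining sequence does not involve
  v and is its own preimage, which is why it must satisfy the old weight bound too.\<close>

lemma regular_mod_substitution:
  fixes q r :: "'k::field mpol"
  assumes v: "v \<in> V" "r \<in> mpols (V - {v})" and e: "e \<ge> 0"
    and a: "var v - r \<in> weight_ge \<delta> 0" "var v - r \<notin> weight_ge \<delta> 1"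
    and q: "q \<in> wpols V \<delta> e" "mpol_subst (var(v := r)) q \<noteq> 0"
    and image: "\<And>m. m \<le> 0 \<Longrightarrow> mpol_subst (var(v := r)) ` wpols V \<delta> m = wpols (V - {v}) \<delta>' m"
    and as: "set as \<subseteq> wpols (V - {v}) \<delta> 0"
    and reg: "regular_mod (wpols (V - {v}) \<delta>' 0)
      ((*) (mpol_subst (var(v := r)) q) ` wpols (V - {v}) \<delta>' (- e)) as"
  shows "regular_mod (wpols V \<delta> 0) ((*) q ` wpols V \<delta> (- e)) ((var v - r) # as)"
proof -
  let ?\<psi> = "mpol_subst (var(v := r))" and ?a = "var v - r"
  let ?B = "wpols V \<delta> 0 :: 'k mpol set" and ?N = "wpols V \<delta> (- e) :: 'k mpol set"
  let ?K = "(*) q ` ?N"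
  interpret B: idom_subring ?B by (rule idom_subring_wpols)
  have aV: "?a \<in> mpols V"
    using v mpols_mono[of "V - {v}" V] by (intro mpols.diff_closed var_in_mpols) auto
  then have aB: "?a \<in> ?B" using a unfolding wpols_def by auto
  have \<psi>a: "?\<psi> ?a = 0"
    using mpol_subst_fix[OF v(2), of "var(v := r)"] by (simp add: mpol_subst_diff)
  have ker: "\<exists>p'\<in>wpols V \<delta> m. p = ?a * p'" if p: "p \<in> wpols V \<delta> m" and p0: "?\<psi> p = 0" for p m
  proof -
    have "p \<in> mpols V" using p unfolding wpols_def by auto
    then obtain p' where p': "p' \<in> mpols V" "p = ?a * p'"
      using mpol_subst_eq_0_dvd[OF _ v(2,1)] p0 by blast
    then have "p' \<in> weight_ge \<delta> m"
      using weight_ge_cancel[of ?a \<delta> 0 p' m] a p unfolding wpols_def by auto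
    then show ?thesis using p' unfolding wpols_def by blast
  qed
  have qN: "q * p \<in> ?B" if "p \<in> ?N" for p
    using wpols_mult[OF q(1) that] by simp
  have 1: "\<forall>b\<in>?B. ?a * b \<in> ?K \<longrightarrow> b \<in> ?K"
  proof (intro ballI impI)
    fix b assume b: "b \<in> ?B" "?a * b \<in> ?K"
    then obtain p where p: "p \<in> ?N" "?a * b = q * p" by auto
    then have "?\<psi> q * ?\<psi> p = ?\<psi> ?a * ?\<psi> b" by (metis mpol_subst_mult)
    then have "?\<psi> p = 0" using \<psi>a q(2) by simp
    then obtain p' where "p' \<in> ?N" "p = ?a * p'" using ker p(1) by blast
    moreover have "?a \<noteq> 0" using a(2) by auto
    ultimately have "b = q * p'" using p(2) by (metis mult.left_commute mult_left_cancel)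
    then show "b \<in> ?K" using \<open>p' \<in> ?N\<close> by blast
  qed
  have 2: "adjoin_ideal ?B ?K ?a = {b \<in> ?B. ?\<psi> b \<in> (*) (?\<psi> q) ` wpols (V - {v}) \<delta>' (- e)}"
  proof (intro equalityI subsetI)
    fix x assume "x \<in> adjoin_ideal ?B ?K ?a"
    then obtain p b where x: "x = q * p + ?a * b" "p \<in> ?N" "b \<in> ?B" unfolding adjoin_ideal_def by auto
    then have "x \<in> ?B" using aB qN by (auto intro: B.add_closed B.mult_closed)
    moreover have "?\<psi> x = ?\<psi> q * ?\<psi> p" unfolding x(1) mpol_subst_add mpol_subst_mult \<psi>a by simp
    moreover have "?\<psi> p \<in> wpols (V - {v}) \<delta>' (- e)" using image[of "- e"] e x(2) by auto
    ultimately show "x \<in> {b \<in> ?B. ?\<psi> b \<in> (*) (?\<psi> q) ` wpols (V - {v}) \<delta>' (- e)}" by blast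
  next
    fix x assume x: "x \<in> {b \<in> ?B. ?\<psi> b \<in> (*) (?\<psi> q) ` wpols (V - {v}) \<delta>' (- e)}"
    then obtain y where y: "y \<in> wpols (V - {v}) \<delta>' (- e)" "?\<psi> x = ?\<psi> q * y" by blast
    then have "y \<in> ?\<psi> ` ?N" using image[of "- e"] e by simp
    then obtain p where p: "p \<in> ?N" "?\<psi> x = ?\<psi> q * ?\<psi> p" using y(2) by blast
    have "x - q * p \<in> ?B" using x qN[OF p(1)] B.diff_closed by blast
    moreover have "?\<psi> (x - q * p) = 0" unfolding mpol_subst_diff mpol_subst_mult p(2) by simp
    ultimately obtain b where "b \<in> ?B" "x - q * p = ?a * b" using ker by blast
    then have "x = q * p + ?a * b" "b \<in> ?B" by (simp_all add: algebra_simps)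
    then show "x \<in> adjoin_ideal ?B ?K ?a" unfolding adjoin_ideal_def using p(1) by blast
  qed
  have "?\<psi> b = b" if "b \<in> set as" for b
    using that as by (intro mpol_subst_fix[of b "V - {v}"]) (auto simp: wpols_def)
  then have "map ?\<psi> as = as" by (intro map_idI)
  moreover have "set as \<subseteq> ?B" using as mpols_mono[of "V - {v}" V] unfolding wpols_def by auto
  ultimately have "regular_mod ?B (adjoin_ideal ?B ?K ?a) as"
    using regular_mod_quotient[OF idom_subring_wpols mpol_subst_diff mpol_subst_mult 2, of as] reg image[of 0] by simp
  then show ?thesis using 1 aB by simp
qed

text \<open>Index \<open>0\<close> stands for \<open>s\<close>, index \<open>n + 2\<close> for \<open>w\<close>. Once \<open>x\<^sub>1, \<dots>, x\<^sub>i\<close> are eliminated through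
  \<open>x\<^sub>j \<mapsto> l x\<^sub>j\<^sub>+\<^sub>1 s\<close>, the image of \<open>B\<close> contains \<open>x\<^sub>i\<^sub>+\<^sub>1\<close> times every power of \<open>s\<close> up to \<open>i + 1\<close>.\<close>

definition tower_weight :: "nat \<Rightarrow> nat \<Rightarrow> nat \<Rightarrow> int" where
  "tower_weight n i j = (if j = 0 then - 1 else if j = Suc i then int (Suc i) else if j \<le> n then 1 else 0)"

lemma var_mult_var_0: "const l * (var j * var 0) = Poly_Mapping.single (Poly_Mapping.single j 1 + Poly_Mapping.single 0 1) l"
  unfolding var_def by (simp add: mult_single)

text \<open>The monomial x_j s has weight 0 and survives because l is nonzero, so the lowest weight
  is exactly 0 even where v has positive weight.\<close>

lemma binomial_weight:
  fixes l :: "'k::field"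
  assumes "l \<noteq> 0" "\<delta> v \<ge> 0" "\<delta> j + \<delta> 0 = 0" "j \<noteq> 0"
  shows "var v - const l * (var j * var 0) \<in> weight_ge \<delta> 0"
    "var v - const l * (var j * var 0) \<notin> weight_ge \<delta> 1"
proof -
  let ?m = "Poly_Mapping.single j (1::nat) + Poly_Mapping.single 0 1"
  have w: "weight \<delta> ?m = 0" using assms by (simp add: weight_add)
  show "var v - const l * (var j * var 0) \<in> weight_ge \<delta> 0"
    unfolding var_mult_var_0 using assms w by (intro weight_ge_diff weight_ge_var weight_ge_single) auto
  have "Poly_Mapping.single v 1 \<noteq> ?m"
  proof
    assume *: "Poly_Mapping.single v 1 = ?m"
    have "Poly_Mapping.keys ?m = {j, 0}" by (simp add: keys_add_nat insert_commute)
    then have "{v} = {j, 0}" using * by (metis keys_single zero_neq_one)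
    then show False using assms(4) by auto
  qed
  then have "Poly_Mapping.lookup (var v - const l * (var j * var 0)) ?m = - l"
    unfolding var_mult_var_0 lookup_minus by (simp add: var_def lookup_single_not_eq)
  then have "?m \<in> Poly_Mapping.keys (var v - const l * (var j * var 0))"
    using assms(1) by (simp add: in_keys_iff)
  then show "var v - const l * (var j * var 0) \<notin> weight_ge \<delta> 1"
    using w unfolding weight_ge_def by force
qed

text \<open>Meant for w and \<open>x\<^sub>n\<^sub>+\<^sub>1\<close>, which have weight 0 like x_1
  s: the substitution is then a retraction and no weight has to change.\<close>

lemma subst_image_same_weight:
  fixes r :: "'k::field mpol"
  assumes "r \<in> mpols (V - {v})" "r \<in> weight_ge \<delta> (\<delta> v)"
  shows "mpol_subst (var(v := r)) ` wpols V \<delta> m = wpols (V - {v}) \<delta> m"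
proof
  show "mpol_subst (var(v := r)) ` wpols V \<delta> m \<subseteq> wpols (V - {v}) \<delta> m"
    unfolding wpols_def using assms
    by (auto intro!: mpol_subst_weight_ge[of _ V] mpol_subst_in_subring[OF idom_subring_mpols, of _ V]
        weight_ge_var const_in_mpols var_in_mpols)
  show "wpols (V - {v}) \<delta> m \<subseteq> mpol_subst (var(v := r)) ` wpols V \<delta> m"
  proof
    fix p :: "'k mpol" assume p: "p \<in> wpols (V - {v}) \<delta> m"
    then have "mpol_subst (var(v := r)) p = p"
      by (intro mpol_subst_fix[of p "V - {v}"]) (auto simp: wpols_def)
    moreover have "p \<in> wpols V \<delta> m" using p mpols_mono[of "V - {v}" V] unfolding wpols_def by auto
    ultimately show "p \<in> mpol_subst (var(v := r)) ` wpols V \<delta> m" by force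
  qed
qed

text \<open>The inclusion from right to left is the point: in a monomial admissible for the new
  weights, factors x_(i+2) s are traded back for x_(i+1). Each trade raises the old weight by i + 1,
  just the amount by which the new weight of x_(i+2) exceeds the old one.\<close>

lemma subst_image_tower:
  fixes l :: "'k::field"
  assumes l: "l \<noteq> 0" and i: "Suc (Suc i) \<le> n" and m: "m \<le> 0"
  defines "V \<equiv> insert 0 {Suc i..n}" and "v \<equiv> Suc i" and "r \<equiv> const l * (var (Suc (Suc i)) * var 0)"
  shows "mpol_subst (var(v := r)) ` wpols V (tower_weight n i) m = wpols (V - {v}) (tower_weight n (Suc i)) m"
proof
  let ?\<delta> = "tower_weight n i" and ?\<delta>' = "tower_weight n (Suc i)" and ?\<psi> = "mpol_subst (var(v := r))"
  have V': "V - {v} = insert 0 {Suc (Suc i)..n}" unfolding V_def v_def by auto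
  have rV: "r \<in> mpols (V - {v})"
    unfolding r_def V' using i by (intro mpols.mult_closed const_in_mpols var_in_mpols) auto
  show "?\<psi> ` wpols V ?\<delta> m \<subseteq> wpols (V - {v}) ?\<delta>' m"
  proof -
    have "r \<in> weight_ge ?\<delta>' (?\<delta> v)"
      unfolding r_def var_mult_var_0 v_def by (rule weight_ge_single) (simp add: weight_add tower_weight_def)
    moreover have "?\<delta> j \<le> ?\<delta>' j" if "j \<in> V" "j \<noteq> v" for j
      using that i unfolding V_def v_def tower_weight_def by auto
    ultimately show ?thesis unfolding wpols_def using rV
      by (auto intro!: mpol_subst_weight_ge[of _ V] mpol_subst_in_subring[OF idom_subring_mpols, of _ V]
          weight_ge_var const_in_mpols var_in_mpols)
  qed
  have mono: "\<exists>p\<in>wpols V ?\<delta> m. ?\<psi> p = Poly_Mapping.single f c"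
    if f: "Poly_Mapping.keys f \<subseteq> V - {v}" "m \<le> weight ?\<delta>' f" for f and c :: 'k
  proof -
    define A where "A = Poly_Mapping.lookup f (Suc (Suc i))"
    define J where "J = Poly_Mapping.lookup f 0"
    \<comment> \<open>As many trades as the exponents allow. If A \<le> J, the whole excess weight
      is recovered; otherwise no s is left, the rest has nonnegative weight, and m \<le> 0
      suffices.\<close>
    define k where "k = min A J"
    define b where "b = Poly_Mapping.single (Suc (Suc i)) k + Poly_Mapping.single 0 k"
    define f' where "f' = f - b"
    have ff': "f = f' + b"
      unfolding f'_def by (rule poly_mapping_eqI)
        (auto simp: lookup_add lookup_minus b_def lookup_single when_def A_def J_def k_def)
    have kf': "Poly_Mapping.keys f' \<subseteq> V - {v}" using f(1) unfolding ff' keys_add_nat by auto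
    \<comment> \<open>Among the variables that can occur in f, only x_(i+2) changes its weight, from
      1 to i + 2.\<close>
    have "weight ?\<delta>' f = weight ?\<delta> f + int (Suc i) * int A"
    proof -
      let ?S = "insert (Suc (Suc i)) (Poly_Mapping.keys f)"
      have "weight ?\<delta>' f - weight ?\<delta> f = (\<Sum>j\<in>?S. (?\<delta>' j - ?\<delta> j) * int (Poly_Mapping.lookup f j))"
        by (simp add: weight_superset[of ?S f] subset_insertI sum_subtractf left_diff_distrib del: sum.insert)
      also have "\<dots> = (\<Sum>j\<in>?S. if j = Suc (Suc i) then int (Suc i) * int A else 0)"
        using f(1) i unfolding V' by (intro sum.cong) (auto simp: A_def tower_weight_def)
      also have "\<dots> = int (Suc i) * int A" by simp
      finally show ?thesis by simp
    qed
    moreover have "weight ?\<delta> f = weight ?\<delta> f'"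
      unfolding ff' weight_add b_def using i by (simp add: tower_weight_def)
    ultimately have wf': "weight ?\<delta>' f = weight ?\<delta> f' + int (Suc i) * int A" by simp
    have wm: "m \<le> int (Suc i) * int k + weight ?\<delta> f'"
    proof (cases "A \<le> J")
      case True
      then show ?thesis using f(2) wf' unfolding k_def by simp
    next
      case False
      then have "Poly_Mapping.lookup f' 0 = 0"
        unfolding f'_def by (simp add: lookup_minus b_def lookup_add J_def k_def lookup_single)
      then have "weight ?\<delta> f' \<ge> 0"
        unfolding weight_def by (intro sum_nonneg) (auto simp: tower_weight_def in_keys_iff)
      then show ?thesis using m by (smt (verit) mult_nonneg_nonneg of_nat_0_le_iff)
    qed
    \<comment> \<open>The coefficient cancels the power of l created by substituting into
      \<open>var v ^ k\<close>.\<close>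
    define p where "p = const (c / l ^ k) * (var v ^ k * Poly_Mapping.single f' 1)"
    have pow: "(const l * (var (Suc (Suc i)) * var 0)) ^ k = (Poly_Mapping.single b (l ^ k) :: 'k mpol)"
    proof -
      have "Poly_Mapping.single g l ^ k = (Poly_Mapping.single (\<Sum>j<k. g) (l ^ k) :: 'k mpol)" for g :: "nat \<Rightarrow>\<^sub>0 nat"
        by (induction k) (auto simp: mult_single add.commute simp del: sum_constant)
      moreover have "(\<Sum>j<k. Poly_Mapping.single (Suc (Suc i)) 1 + Poly_Mapping.single 0 (1::nat)) = b"
        by (rule poly_mapping_eqI) (unfold lookup_sum, auto simp: lookup_add b_def lookup_single when_def)
      ultimately show ?thesis unfolding var_mult_var_0 by (simp del: sum_constant)
    qed
    have "Poly_Mapping.single f' (1::'k) \<in> mpols (V - {v})" using kf' unfolding mpols_def by auto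
    then have "?\<psi> (Poly_Mapping.single f' 1) = Poly_Mapping.single f' 1"
      by (rule mpol_subst_fix) auto
    then have "?\<psi> p = const (c / l ^ k) * (r ^ k * Poly_Mapping.single f' 1)"
      unfolding p_def by (simp add: mpol_subst_mult mpol_subst_power)
    also have "\<dots> = Poly_Mapping.single f c"
      unfolding r_def pow ff' using l by (simp add: mult_single add.commute)
    finally have "?\<psi> p = Poly_Mapping.single f c" .
    moreover have "p \<in> mpols V"
      unfolding p_def using kf' i
      by (intro mpols.mult_closed mpols.power_closed const_in_mpols var_in_mpols) (auto simp: V_def v_def mpols_def)
    moreover have "p \<in> weight_ge ?\<delta> (0 + (?\<delta> v * int k + weight ?\<delta> f'))"
      unfolding p_def by (intro weight_ge_mult weight_ge_power weight_ge_var weight_ge_const weight_ge_single) auto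
    then have "p \<in> weight_ge ?\<delta> m"
      using wm by (elim weight_ge_mono[rotated]) (simp add: v_def tower_weight_def)
    ultimately show ?thesis unfolding wpols_def by blast
  qed
  show "wpols (V - {v}) ?\<delta>' m \<subseteq> ?\<psi> ` wpols V ?\<delta> m"
  proof
    fix p :: "'k mpol" assume p: "p \<in> wpols (V - {v}) ?\<delta>' m"
    have "\<forall>f\<in>Poly_Mapping.keys p. \<exists>p'\<in>wpols V ?\<delta> m. ?\<psi> p' = Poly_Mapping.single f (Poly_Mapping.lookup p f)"
      using mono p unfolding wpols_def mpols_def[of "V - {v}"] weight_ge_def[of ?\<delta>'] by auto
    then obtain H where H: "\<And>f. f \<in> Poly_Mapping.keys p \<Longrightarrow> H f \<in> wpols V ?\<delta> m \<and> ?\<psi> (H f) = Poly_Mapping.single f (Poly_Mapping.lookup p f)"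
      by metis
    have "?\<psi> (sum H (Poly_Mapping.keys p)) = (\<Sum>f\<in>Poly_Mapping.keys p. Poly_Mapping.single f (Poly_Mapping.lookup p f))"
      unfolding mpol_subst_sum using H by (intro sum.cong) auto
    then have "?\<psi> (sum H (Poly_Mapping.keys p)) = p" by (simp only: mpol_sum_singles[symmetric])
    moreover have "sum H (Poly_Mapping.keys p) \<in> wpols V ?\<delta> m"
      using H unfolding wpols_def by (auto intro!: mpols.sum_closed weight_ge_sum)
    ultimately show "p \<in> ?\<psi> ` wpols V ?\<delta> m" by (metis imageI)
  qed
qed

text \<open>The shape of the elements is recorded because it later places their lifts in the maximal
  ideal.\<close>

definition binomials :: "nat \<Rightarrow> 'k::field mpol set" where
  "binomials n = {var v - const l * (var j * var 0) | v l j. v \<in> {1..n + 2} \<and> j \<in> {1..n}}"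

lemma subst_wpols:
  assumes "\<And>i. i \<in> V \<Longrightarrow> i \<noteq> v \<Longrightarrow> \<delta> i \<le> \<delta>' i" "r \<in> mpols (V - {v})" "r \<in> weight_ge \<delta>' (\<delta> v)"
    "q \<in> wpols V \<delta> e"
  shows "mpol_subst (var(v := r)) q \<in> wpols (V - {v}) \<delta>' e"
  unfolding wpols_def using assms
  by (auto intro!: mpol_subst_weight_ge[of q V \<delta>] mpol_subst_in_subring[OF idom_subring_mpols, of q V]
      weight_ge_var const_in_mpols var_in_mpols simp: wpols_def)

text \<open>The recursion ends when only x_n and s remain. Bounds for all weights with j \<le> i are
  kept because elements found late must also be admissible in the algebras of the earlier
  eliminations, whose weights differ.\<close>

lemma tower_regular_sequence:
  fixes q :: "'k::field mpol"
  assumes k: "infinite (UNIV :: 'k set)" and "i < n" "e \<ge> 0"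
    and "q \<in> wpols (insert 0 {Suc i..n}) (tower_weight n i) e" "q \<noteq> 0"
  shows "\<exists>as. length as = n - Suc i \<and> set as \<subseteq> binomials n \<and>
    (\<forall>j\<le>i. set as \<subseteq> wpols (insert 0 {Suc i..n}) (tower_weight n j) 0) \<and>
    regular_mod (wpols (insert 0 {Suc i..n}) (tower_weight n i) 0)
      ((*) q ` wpols (insert 0 {Suc i..n}) (tower_weight n i) (- e)) as"
  using assms(2,4,5)
proof (induction "n - Suc i" arbitrary: i q)
  case 0
  then show ?case by (intro exI[of _ "[]"]) auto
next
  case (Suc d)
  let ?V = "insert 0 {Suc i..n}" and ?v = "Suc i" and ?u = "var (Suc (Suc i)) * var 0 :: 'k mpol"
  have i: "Suc (Suc i) \<le> n" using Suc by auto
  have V': "?V - {?v} = insert 0 {Suc (Suc i)..n}" by auto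
  have u: "?u \<in> mpols (?V - {?v})" "?u \<noteq> 0"
    unfolding V' using i by (auto intro!: mpols.mult_closed var_in_mpols)
  obtain l where l: "l \<noteq> 0" "mpol_subst (var(?v := const l * ?u)) q \<noteq> 0"
    using exists_nonvanishing_subst[OF k _ Suc.prems(3) u] Suc.prems(2) unfolding wpols_def by blast
  let ?r = "const l * ?u"
  have r: "?r \<in> mpols (?V - {?v})" using u(1) by (rule mpols.mult_closed[OF const_in_mpols])
  have rw: "?r \<in> weight_ge (tower_weight n (Suc i)) (tower_weight n i ?v)"
    unfolding var_mult_var_0 by (rule weight_ge_single) (simp add: weight_add tower_weight_def)
  have q': "mpol_subst (var(?v := ?r)) q \<in> wpols (?V - {?v}) (tower_weight n (Suc i)) e"
    by (rule subst_wpols[OF _ r rw Suc.prems(2)]) (use i in \<open>auto simp: tower_weight_def\<close>)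
  have "d = n - Suc (Suc i)" using Suc.hyps(2) by simp
  then obtain as where as: "length as = n - Suc (Suc i)"
    "set as \<subseteq> binomials n"
    "\<forall>j\<le>Suc i. set as \<subseteq> wpols (?V - {?v}) (tower_weight n j) 0"
    "regular_mod (wpols (?V - {?v}) (tower_weight n (Suc i)) 0)
      ((*) (mpol_subst (var(?v := ?r)) q) ` wpols (?V - {?v}) (tower_weight n (Suc i)) (- e)) as"
    using Suc.hyps(1)[of "Suc i" "mpol_subst (var(?v := ?r)) q"] i q' l unfolding V' by auto
  have a: "var ?v - ?r \<in> weight_ge (tower_weight n j) 0" "var ?v - ?r \<notin> weight_ge (tower_weight n j) 1" if "j \<le> i" for j
    using binomial_weight[OF l(1), of "tower_weight n j" ?v "Suc (Suc i)"] that i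
    by (auto simp: tower_weight_def)
  have aV: "var ?v - ?r \<in> mpols ?V"
    using r Suc.prems(1) mpols_mono[of "?V - {?v}" ?V] by (intro mpols.diff_closed var_in_mpols) auto
  have "regular_mod (wpols ?V (tower_weight n i) 0) ((*) q ` wpols ?V (tower_weight n i) (- e)) ((var ?v - ?r) # as)"
    using Suc.prems(1) as(3)
    by (intro regular_mod_substitution[OF _ r assms(3) a Suc.prems(2) l(2) _ _ as(4)]
        subst_image_tower[OF l(1) i]) auto
  moreover have "var ?v - ?r \<in> binomials n"
    unfolding binomials_def using i by fastforce
  moreover have "wpols (?V - {?v}) \<delta> 0 \<subseteq> (wpols ?V \<delta> 0 :: 'k mpol set)" for \<delta>
    using mpols_mono[of "?V - {?v}" ?V] unfolding wpols_def by auto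
  then have "set as \<subseteq> wpols ?V (tower_weight n j) 0" if "j \<le> i" for j
    using as(3) that by (meson le_SucI subset_trans)
  moreover have "var ?v - ?r \<in> wpols ?V (tower_weight n j) 0" if "j \<le> i" for j
    using aV a(1)[OF that] unfolding wpols_def by blast
  moreover have "length ((var ?v - ?r) # as) = n - Suc i" using as(1) i by simp
  ultimately show ?case using as(2) by (intro exI[of _ "(var ?v - ?r) # as"]) auto
qed

text \<open>The length is 2 for w and \<open>x\<^sub>n\<^sub>+\<^sub>1\<close>, plus n - 1 for the
  tower. Those two come first because they are traded for x_1 s, which needs x_1 still present with
  weight 1.\<close>

theorem weighted_regular_sequence:
  fixes h :: "'k::field mpol"
  assumes k: "infinite (UNIV :: 'k set)" and n: "n \<ge> 1" and e: "e \<ge> 0"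
    and h: "h \<in> wpols {0..n + 2} (tower_weight n 0) e" "h \<noteq> 0"
  shows "\<exists>as. length as = n + 1 \<and> set as \<subseteq> binomials n \<inter> wpols {0..n + 2} (tower_weight n 0) 0 \<and>
    regular_mod (wpols {0..n + 2} (tower_weight n 0) 0) ((*) h ` wpols {0..n + 2} (tower_weight n 0) (- e)) as"
proof -
  let ?\<delta> = "tower_weight n 0" and ?u = "var 1 * var 0 :: 'k mpol"
  have step: "\<exists>as. length as = Suc c \<and> set as \<subseteq> binomials n \<inter> wpols V ?\<delta> 0 \<and>
      regular_mod (wpols V ?\<delta> 0) ((*) q ` wpols V ?\<delta> (- e)) as"
    if v: "v \<in> V" "v \<in> {n + 1, n + 2}" "1 \<in> V" "0 \<in> V" and q: "q \<in> wpols V ?\<delta> e" "q \<noteq> 0"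
      and IH: "\<And>q :: 'k mpol. q \<in> wpols (V - {v}) ?\<delta> e \<Longrightarrow> q \<noteq> 0 \<Longrightarrow>
        \<exists>as. length as = c \<and> set as \<subseteq> binomials n \<inter> wpols (V - {v}) ?\<delta> 0 \<and>
          regular_mod (wpols (V - {v}) ?\<delta> 0) ((*) q ` wpols (V - {v}) ?\<delta> (- e)) as"
    for v V c and q :: "'k mpol"
  proof -
    have \<delta>v: "?\<delta> v = 0" using v n by (auto simp: tower_weight_def)
    have u: "?u \<in> mpols (V - {v})" "?u \<noteq> 0"
      using v n by (auto intro!: mpols.mult_closed var_in_mpols)
    obtain l where l: "l \<noteq> 0" "mpol_subst (var(v := const l * ?u)) q \<noteq> 0"
      using exists_nonvanishing_subst[OF k _ q(2) u] q(1) unfolding wpols_def by blast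
    let ?r = "const l * ?u"
    have r: "?r \<in> mpols (V - {v})" using u(1) by (rule mpols.mult_closed[OF const_in_mpols])
    have rw: "?r \<in> weight_ge ?\<delta> (?\<delta> v)"
      unfolding var_mult_var_0 \<delta>v by (rule weight_ge_single) (simp add: weight_add tower_weight_def)
    have q': "mpol_subst (var(v := ?r)) q \<in> wpols (V - {v}) ?\<delta> e"
      by (rule subst_wpols[OF _ r rw q(1)]) auto
    obtain as where as: "length as = c" "set as \<subseteq> binomials n \<inter> wpols (V - {v}) ?\<delta> 0"
      "regular_mod (wpols (V - {v}) ?\<delta> 0)
        ((*) (mpol_subst (var(v := ?r)) q) ` wpols (V - {v}) ?\<delta> (- e)) as"
      using IH[OF q' l(2)] by blast
    have a: "var v - ?r \<in> weight_ge ?\<delta> 0" "var v - ?r \<notin> weight_ge ?\<delta> 1"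
      using binomial_weight[OF l(1), of ?\<delta> v 1] \<delta>v by (auto simp: tower_weight_def)
    have aV: "var v - ?r \<in> mpols V"
      using r v mpols_mono[of "V - {v}" V] by (intro mpols.diff_closed var_in_mpols) auto
    have "regular_mod (wpols V ?\<delta> 0) ((*) q ` wpols V ?\<delta> (- e)) ((var v - ?r) # as)"
      using v(1) as(2)
      by (intro regular_mod_substitution[OF _ r e a q(1) l(2) _ _ as(3)]
          subst_image_same_weight[OF r rw]) auto
    moreover have "var v - ?r \<in> binomials n"
      unfolding binomials_def using v n by fastforce
    moreover have "wpols (V - {v}) \<delta> 0 \<subseteq> (wpols V \<delta> 0 :: 'k mpol set)" for \<delta>
      using mpols_mono[of "V - {v}" V] unfolding wpols_def by auto
    then have "set as \<subseteq> wpols V ?\<delta> 0" using as(2) by blast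
    moreover have "var v - ?r \<in> wpols V ?\<delta> 0" using aV a(1) unfolding wpols_def by blast
    moreover have "length ((var v - ?r) # as) = Suc c" using as(1) by simp
    ultimately show ?thesis using as(2) by (intro exI[of _ "(var v - ?r) # as"]) auto
  qed
  have V1: "{0..n + 2} - {n + 2} = {0..n + 1}" and V0: "{0..n + 1} - {n + 1} = {0..n}"
    and V: "insert 0 {Suc 0..n} = {0..n}" by auto
  have 0: "\<exists>as. length as = n - 1 \<and> set as \<subseteq> binomials n \<inter> wpols {0..n} ?\<delta> 0 \<and>
      regular_mod (wpols {0..n} ?\<delta> 0) ((*) q ` wpols {0..n} ?\<delta> (- e)) as"
    if "q \<in> wpols {0..n} ?\<delta> e" "q \<noteq> 0" for q :: "'k mpol"
    using tower_regular_sequence[OF k, of 0 n e q] that n e unfolding V by auto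
  have 1: "\<exists>as. length as = Suc (n - 1) \<and> set as \<subseteq> binomials n \<inter> wpols {0..n + 1} ?\<delta> 0 \<and>
      regular_mod (wpols {0..n + 1} ?\<delta> 0) ((*) q ` wpols {0..n + 1} ?\<delta> (- e)) as"
    if "q \<in> wpols {0..n + 1} ?\<delta> e" "q \<noteq> 0" for q :: "'k mpol"
    by (rule step[of "n + 1"]) (use that 0 n V0 in auto)
  have "\<exists>as. length as = Suc (Suc (n - 1)) \<and> set as \<subseteq> binomials n \<inter> wpols {0..n + 2} ?\<delta> 0 \<and>
      regular_mod (wpols {0..n + 2} ?\<delta> 0) ((*) h ` wpols {0..n + 2} ?\<delta> (- e)) as"
    by (rule step[of "n + 2"]) (use h 1 n V1 in auto)
  then show ?thesis using n by auto
qed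

section \<open>Unique factorization and coprime divisibility in k[x]\<close>

lemma ufd_on_image:
  fixes \<phi> :: "'a::idom \<Rightarrow> 'b::idom"
  assumes ufd: "ufd_on A" and inj: "inj_on \<phi> A" and one: "\<phi> 1 = 1"
    and diff: "\<And>x y. x \<in> A \<Longrightarrow> y \<in> A \<Longrightarrow> \<phi> (x - y) = \<phi> x - \<phi> y"
    and mult: "\<And>x y. x \<in> A \<Longrightarrow> y \<in> A \<Longrightarrow> \<phi> (x * y) = \<phi> x * \<phi> y"
  shows "ufd_on (\<phi> ` A)"
proof -
  interpret idom_subring A using ufd unfolding ufd_on_def by auto
  have dvd: "dvd_on (\<phi> ` A) (\<phi> a) (\<phi> b) \<longleftrightarrow> dvd_on A a b" if "a \<in> A" "b \<in> A" for a b
  proof -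
    have "\<phi> b = \<phi> a * \<phi> c \<longleftrightarrow> b = a * c" if "c \<in> A" for c
      using inj_on_eq_iff[OF inj \<open>b \<in> A\<close>, of "a * c"] mult[OF \<open>a \<in> A\<close> that]
        mult_closed[OF \<open>a \<in> A\<close> that] by simp
    then show ?thesis unfolding dvd_on_def by auto
  qed
  have dvd1: "dvd_on (\<phi> ` A) (\<phi> a) 1 \<longleftrightarrow> dvd_on A a 1" if "a \<in> A" for a
    using dvd[OF that one_closed] one by simp
  have zero: "\<phi> a = 0 \<longleftrightarrow> a = 0" if "a \<in> A" for a
    using diff[OF zero_closed zero_closed] inj_on_eq_iff[OF inj that zero_closed] by simp
  have prime: "prime_on (\<phi> ` A) (\<phi> p)" if p: "prime_on A p" for p
  proof -
    have pA: "p \<in> A" using p unfolding prime_on_def by auto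
    have "dvd_on (\<phi> ` A) (\<phi> p) (\<phi> a) \<or> dvd_on (\<phi> ` A) (\<phi> p) (\<phi> b)"
      if "a \<in> A" "b \<in> A" "dvd_on (\<phi> ` A) (\<phi> p) (\<phi> a * \<phi> b)" for a b
    proof -
      have "dvd_on A p (a * b)"
        using that dvd[OF pA mult_closed] mult by simp
      then show ?thesis using p that dvd pA unfolding prime_on_def by blast
    qed
    then show ?thesis using p pA dvd1 zero unfolding prime_on_def by auto
  qed
  have "idom_subring (\<phi> ` A)"
  proof
    show "1 \<in> \<phi> ` A" using one one_closed by (metis imageI)
    show "a - b \<in> \<phi> ` A" if "a \<in> \<phi> ` A" "b \<in> \<phi> ` A" for a b
      using that diff diff_closed by (auto simp: image_iff) metis
    show "a * b \<in> \<phi> ` A" if "a \<in> \<phi> ` A" "b \<in> \<phi> ` A" for a b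
      using that mult mult_closed by (auto simp: image_iff) metis
  qed
  moreover have "\<exists>qs. factors_on (\<phi> ` A) (\<phi> a) qs" if a: "a \<in> A" "a \<noteq> 0" for a
  proof -
    obtain ps where "factors_on A a ps" using ufd a unfolding ufd_on_def by blast
    then obtain u where u: "u \<in> A" "dvd_on A u 1" "\<forall>p\<in>set ps. prime_on A p" "a = u * prod_list ps"
      unfolding factors_on_def by blast
    have "prod_list ps \<in> A \<and> \<phi> (prod_list ps) = prod_list (map \<phi> ps)"
      using u(3) by (induction ps) (auto simp: one_closed mult_closed one mult prime_on_def)
    then have "\<phi> a = \<phi> u * prod_list (map \<phi> ps)" using u mult by simp
    moreover have "\<forall>p\<in>set (map \<phi> ps). prime_on (\<phi> ` A) p" using u prime by auto
    ultimately show ?thesis unfolding factors_on_def using u dvd1 by blast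
  qed
  ultimately show ?thesis unfolding ufd_on_def using zero by auto
qed

text \<open>Adjoining v amounts to evaluating \<open>polys_over\<close> at \<open>var v\<close>, an
  isomorphism onto the larger ring along which factorizations return from \<open>poly\<close> to the
  original type. Without variables every nonzero element is a unit.\<close>

theorem ufd_on_mpols: "finite V \<Longrightarrow> ufd_on (mpols V :: 'k::field mpol set)"
proof (induction V rule: finite_induct)
  case empty
  have "dvd_on (mpols {}) a 1" if a: "a \<in> mpols {}" "a \<noteq> 0" for a :: "'k mpol"
  proof -
    have "Poly_Mapping.keys a \<subseteq> {0}" using a unfolding mpols_def by auto
    then have "a = const (Poly_Mapping.lookup a 0)"
      by (intro poly_mapping_eqI) (auto simp: lookup_single when_def in_keys_iff)
    moreover from this have "Poly_Mapping.lookup a 0 \<noteq> 0" using a(2) by auto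
    ultimately have "1 = a * const (inverse (Poly_Mapping.lookup a 0))"
      by (metis const_mult_eq right_inverse single_one)
    then show ?thesis unfolding dvd_on_def using const_in_mpols by blast
  qed
  then show ?case unfolding ufd_on_def using mpols.factors_on_unit idom_subring_mpols by blast
next
  case (insert v V)
  let ?A = "polys_over (mpols V) :: 'k mpol poly set"
  have V: "insert v V - {v} = V" using insert by auto
  have "inj_on (\<lambda>P. poly P (var v)) ?A"
  proof (rule inj_onI)
    fix P Q assume PQ: "P \<in> ?A" "Q \<in> ?A" "poly P (var v) = poly Q (var v)"
    then have "poly (P - Q) (var v) = 0" by simp
    moreover have "P - Q \<in> ?A" using PQ idom_subring.diff_closed[OF mpols.idom_subring_polys_over] by blast
    ultimately show "P = Q" using poly_fresh_inj insert.hyps(2) by (metis eq_iff_diff_eq_0)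
  qed
  then have "ufd_on ((\<lambda>P. poly P (var v)) ` ?A)"
    using mpols.ufd_on_polys_over[OF insert.IH] by (intro ufd_on_image) auto
  moreover have "(\<lambda>P. poly P (var v)) ` ?A = mpols (insert v V)"
  proof (intro equalityI subsetI)
    fix p assume "p \<in> (\<lambda>P. poly P (var v)) ` ?A"
    then show "p \<in> mpols (insert v V)" using poly_fresh_closed[of _ V "var v" "insert v V"] var_in_mpols[of v "insert v V"] by auto
  next
    fix p :: "'k mpol" assume "p \<in> mpols (insert v V)"
    then show "p \<in> (\<lambda>P. poly P (var v)) ` ?A" using mpols_fresh_poly[of p "insert v V" v] unfolding V by blast
  qed
  ultimately show ?case by simp
qed

text \<open>Factors of a nonzero polynomial involve no new variables, so later arguments may use
  plain \<open>dvd\<close> on the whole type.\<close>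

lemma mpols_dvd_on:
  assumes "a dvd b" "b \<in> mpols V"
  shows "dvd_on (mpols V) a b"
proof (cases "b = 0")
  case True
  then show ?thesis unfolding dvd_on_def using mpols.zero_closed by (auto intro: bexI[of _ 0])
next
  case False
  obtain c where "b = a * c" using assms(1) by auto
  moreover from this have "c \<in> mpols V" using mpols_divisor[of c a V] assms(2) False by (simp add: mult.commute)
  ultimately show ?thesis unfolding dvd_on_def by blast
qed

lemma dvd_on_imp_dvd: "dvd_on A a b \<Longrightarrow> a dvd b"
  unfolding dvd_on_def by auto

text \<open>Euclid's lemma, removing the primes of f one at a time: none of them divides g, so each
  divides c.\<close>

lemma mpols_coprime_dvd:
  assumes "finite V" "f \<in> mpols V" "g \<in> mpols V" "c \<in> mpols V" "f \<noteq> 0"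
    and coprime: "\<And>p. p dvd f \<Longrightarrow> p dvd g \<Longrightarrow> p dvd 1"
    and "f dvd g * c"
  shows "f dvd c"
proof -
  have "f dvd c" if "factors_on (mpols V) f ps" "f \<in> mpols V" "c \<in> mpols V"
    "\<And>p. p dvd f \<Longrightarrow> p dvd g \<Longrightarrow> p dvd 1" "f dvd g * c" for ps f c
    using that
  proof (induction ps arbitrary: f c)
    case Nil
    then have "f dvd 1" unfolding factors_on_def by (auto dest: dvd_on_imp_dvd)
    then show ?case by (metis dvd_trans one_dvd)
  next
    case (Cons p ps)
    obtain b where b: "f = p * b" "prime_on (mpols V) p" "factors_on (mpols V) b ps"
      using mpols.factors_on_Cons_cancel[OF Cons.prems(1)] by blast
    have p: "p \<in> mpols V" "p \<noteq> 0" using b(2) unfolding prime_on_def by auto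
    have "p dvd g * c" using Cons.prems(5) b(1) by (metis dvd_mult_left)
    then have "dvd_on (mpols V) p (g * c)"
      using mpols_dvd_on mpols.mult_closed[OF assms(3) Cons.prems(3)] by blast
    then have "dvd_on (mpols V) p g \<or> dvd_on (mpols V) p c"
      using b(2) assms(3) Cons.prems(3) unfolding prime_on_def by blast
    moreover have "\<not> dvd_on (mpols V) p g"
    proof
      assume "dvd_on (mpols V) p g"
      then have "p dvd g" by (rule dvd_on_imp_dvd)
      moreover have "p dvd f" unfolding b(1) by simp
      ultimately have "p dvd 1" using Cons.prems(4) by blast
      then have "dvd_on (mpols V) p 1" using mpols.one_closed by (rule mpols_dvd_on)
      then show False using b(2) unfolding prime_on_def by blast
    qed
    ultimately obtain c' where c': "c' \<in> mpols V" "c = p * c'" unfolding dvd_on_def by blast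
    have "p * b dvd p * (g * c')" using Cons.prems(5) b(1) c'(2) by (simp add: mult.left_commute)
    then have "b dvd g * c'" using p by simp
    moreover have "b \<in> mpols V"
    proof (cases "b = 0")
      case False
      then show ?thesis using mpols_divisor[of b p V] Cons.prems(2) b(1) p by (simp add: mult.commute)
    qed (simp add: mpols.zero_closed)
    ultimately have "b dvd c'"
      using Cons.IH[OF b(3) _ c'(1)] Cons.prems(4) b(1) by (metis dvd_mult)
    then show ?case using b(1) c'(2) by (simp add: mult_dvd_mono)
  qed
  then show ?thesis using ufd_on_mpols[OF assms(1)] assms unfolding ufd_on_def by blast
qed

section \<open>The presentation of the Rees algebra\<close>

text \<open>The variable with index \<open>0\<close> is \<open>s\<close> in the source and \<open>t\<close> in the target.\<close>

definition rees_subst :: "nat \<Rightarrow> 'k::field mpol \<Rightarrow> 'k mpol \<Rightarrow> 'k mpol \<Rightarrow> 'k mpol" where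
  "rees_subst n f g = mpol_subst (var(0 := f * var 0, n + 2 := g * var 0))"

definition rees_eqn :: "nat \<Rightarrow> 'k::field mpol \<Rightarrow> 'k mpol \<Rightarrow> 'k mpol" where
  "rees_eqn n f g = g * var 0 - f * var (n + 2)"

locale coprime_pair =
  fixes n :: nat and f g :: "'k::field mpol"
  assumes f: "f \<in> mpols {1..n + 1}" "f \<noteq> 0" and g: "g \<in> mpols {1..n + 1}"
    and coprime: "\<And>p. p dvd f \<Longrightarrow> p dvd g \<Longrightarrow> p dvd 1"
begin

abbreviation "ev \<equiv> rees_subst n f g"
abbreviation "h \<equiv> rees_eqn n f g"

lemma ev_fix: "p \<in> mpols {1..n + 1} \<Longrightarrow> ev p = p"
  unfolding rees_subst_def by (rule mpol_subst_fix) auto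

lemma ev_h: "ev h = 0"
  using ev_fix[OF f(1)] ev_fix[OF g]
  unfolding rees_eqn_def rees_subst_def by (simp add: mpol_subst_diff mpol_subst_mult mult_ac)

lemma h_nonzero: "h \<noteq> 0"
proof
  assume "h = 0"
  then have "mpol_subst (var(0 := 0)) h = 0" by simp
  moreover have "mpol_subst (var(0 := 0)) f = f" by (rule mpol_subst_fix[OF f(1)]) auto
  ultimately show False using f(2) unfolding rees_eqn_def by (simp add: mpol_subst_diff mpol_subst_mult)
qed

lemma h_in_mpols: "h \<in> mpols {0..n + 2}"
proof -
  have "{1..n + 1} \<subseteq> {0..n + 2}" by auto
  then have "f \<in> mpols {0..n + 2}" "g \<in> mpols {0..n + 2}" using f g mpols_mono by blast+
  then show ?thesis unfolding rees_eqn_def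
    by (intro mpols.diff_closed mpols.mult_closed var_in_mpols) auto
qed

text \<open>Modulo f the equation becomes g s. A common divisor of f and g s does not involve s, so
  setting s = 1 shows that it divides g; hence f and g s are coprime.\<close>

lemma dvd_of_dvd_h_mult:
  assumes "Q \<in> mpols {0..n + 2}" "f dvd h * Q"
  shows "f dvd Q"
proof (rule mpols_coprime_dvd[of "{0..n + 2}"])
  have sub: "{1..n + 1} \<subseteq> {0..n + 2}" by auto
  show "f \<in> mpols {0..n + 2}" "g * var 0 \<in> mpols {0..n + 2}"
    using f g mpols_mono[OF sub] by (auto intro!: mpols.mult_closed var_in_mpols)
  show "p dvd 1" if p: "p dvd f" "p dvd g * var 0" for p
  proof -
    have pR: "p \<in> mpols {1..n + 1}"
      using p(1) f mpols_divisor by (metis dvdE)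
    obtain e where "g * var 0 = p * e" using p(2) by auto
    then have "mpol_subst (var(0 := 1)) (g * var 0) = mpol_subst (var(0 := 1)) (p * e)" by simp
    moreover have "mpol_subst (var(0 := 1)) g = g" "mpol_subst (var(0 := 1)) p = p"
      by (rule mpol_subst_fix[OF g] mpol_subst_fix[OF pR]; auto)+
    ultimately have "g = p * mpol_subst (var(0 := 1)) e" by (simp add: mpol_subst_mult)
    then have "p dvd g" by (metis dvd_triv_left)
    then show ?thesis using coprime p(1) by blast
  qed
  have "f dvd h * Q + f * (var (n + 2) * Q)" using assms(2) by (intro dvd_add) auto
  then show "f dvd g * var 0 * Q" unfolding rees_eqn_def by (simp add: algebra_simps)
qed (use assms f in auto)

text \<open>After multiplication by a power of \<open>f\<close>, the variable \<open>w\<close> can be eliminated modulo the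
  equation; the remainder vanishes, and the power of \<open>f\<close> is removed by coprimality.\<close>

lemma ev_eq_0_dvd:
  assumes p: "p \<in> mpols {0..n + 2}" "ev p = 0"
  shows "h dvd p"
proof -
  have V: "{0..n + 2} - {n + 2} = {0..n + 1}" by auto
  obtain P where P: "P \<in> polys_over (mpols {0..n + 1})" "p = poly P (var (n + 2))"
    using mpols_fresh_poly[OF p(1), of "n + 2"] unfolding V by blast
  have sub: "mpols {1..n + 1} \<subseteq> (mpols {0..n + 1} :: 'k mpol set)" by (rule mpols_mono) auto
  have "\<exists>k Q. \<exists>r\<in>mpols {0..n + 1}. f ^ k * poly P (var (n + 2)) = h * Q + r"
    using P(1)
  proof (induction P)
    case 0
    show ?case using mpols.zero_closed by (intro exI[of _ 0] bexI[of _ 0]) auto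
  next
    case (pCons c P)
    then obtain k Q r where IH: "r \<in> mpols {0..n + 1}" "f ^ k * poly P (var (n + 2)) = h * Q + r"
      by auto
    let ?w = "var (n + 2)"
    have "f ^ Suc k * poly (pCons c P) ?w = f ^ Suc k * c + f * ?w * (f ^ k * poly P ?w)"
      by (simp add: algebra_simps)
    \<comment> \<open>Horner step: f w is traded for g s at the cost of a multiple of h.\<close>
    also have "\<dots> = h * (f * ?w * Q - r) + (f ^ Suc k * c + g * var 0 * r)"
      unfolding IH(2) rees_eqn_def by (simp add: algebra_simps)
    finally have "f ^ Suc k * poly (pCons c P) ?w = h * (f * ?w * Q - r) + (f ^ Suc k * c + g * var 0 * r)" .
    moreover have "f ^ Suc k * c + g * var 0 * r \<in> mpols {0..n + 1}"
      using f g sub pCons.prems IH(1)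
      by (intro mpols.add_closed mpols.mult_closed mpols.power_closed var_in_mpols) auto
    ultimately show ?case by blast
  qed
  then obtain k Q r where r: "r \<in> mpols {0..n + 1}" "f ^ k * p = h * Q + r" unfolding P(2) by blast
  have "ev (f ^ k * p) = 0" using p(2) unfolding rees_subst_def by (simp add: mpol_subst_mult)
  then have "ev r = 0" using ev_h unfolding r(2) rees_subst_def by (simp add: mpol_subst_mult mpol_subst_add)
  have V': "{0..n + 1} - {0} = {1..n + 1}" by auto
  obtain S where S: "S \<in> polys_over (mpols {1..n + 1})" "r = poly S (var 0)"
    using mpols_fresh_poly[OF r(1), of 0] unfolding V' by blast
  \<comment> \<open>On polynomials without w the evaluation only sends s to f t, which is injective;
    so the remainder is zero.\<close>
  have "ev r = poly S (f * var 0)"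
    unfolding S(2) rees_subst_def by (subst mpol_subst_poly_fresh[OF S(1)]) auto
  then have "S = 0" using \<open>ev r = 0\<close> poly_fresh_scaled_inj[OF S(1) _ f(2)] by auto
  then have "f ^ k * p = h * Q" using r(2) S(2) by simp
  then show "h dvd p"
  proof (induction k arbitrary: Q)
    case (Suc k)
    show ?case
    proof (cases "p = 0")
      case False
      have "h * Q \<in> mpols {0..n + 2}" "h * Q \<noteq> 0"
        using Suc.prems[symmetric] p(1) f False mpols_mono[of "{1..n + 1}" "{0..n + 2}"]
        by (auto intro!: mpols.mult_closed mpols.power_closed)
      then have "Q \<in> mpols {0..n + 2}" using mpols_divisor[of Q h] by (simp add: mult.commute)
      moreover have "f dvd h * Q" unfolding Suc.prems[symmetric] by simp
      ultimately obtain Q' where "Q = f * Q'" using dvd_of_dvd_h_mult by (metis dvdE)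
      then have "f * (f ^ k * p) = f * (h * Q')" using Suc.prems by (simp add: mult_ac)
      then show ?thesis using Suc.IH f(2) by (metis mult_left_cancel)
    qed simp
  qed simp
qed

text \<open>Kernel elements are multiples of h, and as h has lowest weight e, the product has weight
  at least 0 exactly when the cofactor has weight at least - e. Membership in \<open>{0}\<close> is
  the form that \<open>regular_mod_quotient\<close> asks for.\<close>

lemma ev_kernel:
  assumes h: "h \<in> weight_ge \<delta> e" "h \<notin> weight_ge \<delta> (e + 1)"
  shows "(*) h ` wpols {0..n + 2} \<delta> (- e) = {p \<in> wpols {0..n + 2} \<delta> 0. ev p \<in> {0}}"
proof (intro equalityI subsetI)
  fix p assume "p \<in> (*) h ` wpols {0..n + 2} \<delta> (- e)"
  then obtain q where q: "q \<in> wpols {0..n + 2} \<delta> (- e)" "p = h * q" by auto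
  have "h \<in> wpols {0..n + 2} \<delta> e" using h(1) h_in_mpols unfolding wpols_def by blast
  then have "p \<in> wpols {0..n + 2} \<delta> 0" using wpols_mult[OF _ q(1)] q(2) by fastforce
  moreover have "ev p = 0" using ev_h unfolding q(2) rees_subst_def by (simp add: mpol_subst_mult)
  ultimately show "p \<in> {p \<in> wpols {0..n + 2} \<delta> 0. ev p \<in> {0}}" by blast
next
  fix p assume p: "p \<in> {p \<in> wpols {0..n + 2} \<delta> 0. ev p \<in> {0}}"
  then have pm: "p \<in> mpols {0..n + 2}" "p \<in> weight_ge \<delta> 0" "ev p = 0" unfolding wpols_def by auto
  then obtain q where q: "q \<in> mpols {0..n + 2}" "p = h * q"
    using mpols_dvd_on[OF ev_eq_0_dvd] unfolding dvd_on_def by blast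
  then have "q \<in> weight_ge \<delta> (- e)" using weight_ge_cancel[OF h, of q "- e"] pm by simp
  then show "p \<in> (*) h ` wpols {0..n + 2} \<delta> (- e)" using q unfolding wpols_def by blast
qed

end

text \<open>Without s and w, the weight is the total degree with
  \<open>x\<^sub>n\<^sub>+\<^sub>1\<close> left out.\<close>

lemma form_weight:
  assumes "form (n + 1) d p" "m \<in> Poly_Mapping.keys p" "n \<ge> 1"
  shows "weight (tower_weight n 0) m = int d - int (Poly_Mapping.lookup m (n + 1))"
proof -
  have m: "Poly_Mapping.keys m \<subseteq> {1..n + 1}" "(\<Sum>i\<in>Poly_Mapping.keys m. Poly_Mapping.lookup m i) = d"
    using assms unfolding form_def carrier_mpol_ring mpols_def by auto
  have "(\<Sum>i\<in>{1..n + 1}. Poly_Mapping.lookup m i) = d"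
    using m sum.mono_neutral_left[of "{1..n + 1}" "Poly_Mapping.keys m" "Poly_Mapping.lookup m"]
    by (auto simp: in_keys_iff)
  then have "int d = (\<Sum>i\<in>{1..n + 1}. int (Poly_Mapping.lookup m i))" by (metis of_nat_sum)
  also have "\<dots> = (\<Sum>i\<in>{1..n}. int (Poly_Mapping.lookup m i)) + int (Poly_Mapping.lookup m (n + 1))"
    by simp
  also have "(\<Sum>i\<in>{1..n}. int (Poly_Mapping.lookup m i)) = (\<Sum>i\<in>{1..n + 1}. tower_weight n 0 i * int (Poly_Mapping.lookup m i))"
    using assms(3) by (simp add: tower_weight_def cong: sum.cong) (rule sum.cong, auto)
  also have "\<dots> = weight (tower_weight n 0) m"
    using m(1) by (rule weight_superset[symmetric, rotated]) simp
  finally show ?thesis by simp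
qed

text \<open>A monoid of degree c has only the weights c and c - 1, so g s and f w both contribute
  only d - 1 and d - 2. The smaller one occurs because f or g involves
  \<open>x\<^sub>n\<^sub>+\<^sub>1\<close>; it cannot cancel, since setting s = 0 or w = 0 isolates
  either summand.\<close>

lemma rees_eqn_weight:
  fixes f g :: "'k::field mpol"
  assumes n: "n \<ge> 1" and d: "d \<ge> 2" and forms: "form (n + 1) (d - 1) f" "form (n + 1) d g"
    and mon: "var_monoid (n + 1) f" "var_monoid (n + 1) g"
    and inv: "involves (n + 1) f \<or> involves (n + 1) g"
  shows "rees_eqn n f g \<in> weight_ge (tower_weight n 0) (int d - 2)"
    "rees_eqn n f g \<notin> weight_ge (tower_weight n 0) (int d - 2 + 1)"
proof -
  let ?\<delta> = "tower_weight n 0"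
  have le1: "int (Poly_Mapping.lookup m (n + 1)) \<le> 1" if "m \<in> Poly_Mapping.keys f \<union> Poly_Mapping.keys g" for m
    using mon that unfolding var_monoid_def by fastforce
  have fw: "f \<in> weight_ge ?\<delta> (int d - 2)"
    unfolding weight_ge_def using form_weight[OF forms(1) _ n] le1 d by (force simp: of_nat_diff)
  have gw: "g \<in> weight_ge ?\<delta> (int d - 1)"
    unfolding weight_ge_def using form_weight[OF forms(2) _ n] le1 d by force
  have v0: "var 0 \<in> weight_ge ?\<delta> (- 1)" "var 0 \<notin> weight_ge ?\<delta> (- 1 + 1)"
    by (auto simp: weight_ge_def var_def tower_weight_def)
  have vw: "var (n + 2) \<in> weight_ge ?\<delta> 0" "var (n + 2) \<notin> weight_ge ?\<delta> (0 + 1)"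
    using n by (auto simp: weight_ge_def var_def tower_weight_def)
  have "g * var 0 \<in> weight_ge ?\<delta> (int d - 2)" "f * var (n + 2) \<in> weight_ge ?\<delta> (int d - 2)"
    using weight_ge_mult[OF gw v0(1)] weight_ge_mult[OF fw vw(1)] by simp_all
  then show "rees_eqn n f g \<in> weight_ge ?\<delta> (int d - 2)" unfolding rees_eqn_def by (rule weight_ge_diff)
  show "rees_eqn n f g \<notin> weight_ge ?\<delta> (int d - 2 + 1)"
  proof
    assume *: "rees_eqn n f g \<in> weight_ge ?\<delta> (int d - 2 + 1)"
    have fg: "f \<in> mpols {1..n + 1}" "g \<in> mpols {1..n + 1}"
      using forms unfolding form_def carrier_mpol_ring by auto
    have sub: "mpol_subst (var(i := 0)) (rees_eqn n f g) \<in> weight_ge ?\<delta> (int d - 2 + 1)" for i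
      by (rule mpol_subst_weight_ge[where V = UNIV, OF _ *]) (auto simp: mpols_def intro: weight_ge_var)
    have fix0: "mpol_subst (var(i := 0)) f = f" "mpol_subst (var(i := 0)) g = g" if "i \<notin> {1..n + 1}" for i
      using that by (intro mpol_subst_fix[OF fg(1)] mpol_subst_fix[OF fg(2)]; auto)+
    from inv show False
    proof
      assume "involves (n + 1) f"
      then obtain m where "m \<in> Poly_Mapping.keys f" "Poly_Mapping.lookup m (n + 1) \<noteq> 0"
        unfolding involves_def by auto
      then have "f \<notin> weight_ge ?\<delta> (int d - 2 + 1)"
        unfolding weight_ge_def using form_weight[OF forms(1) _ n, of m] d by (force simp: of_nat_diff)
      then have "f * var (n + 2) \<notin> weight_ge ?\<delta> (int d - 2 + 0 + 1)"
        using lowest_weight_mult[OF fw _ vw] by blast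
      moreover have "mpol_subst (var(0 := 0)) (rees_eqn n f g) = - (f * var (n + 2))"
        unfolding rees_eqn_def by (simp add: mpol_subst_diff mpol_subst_mult fix0)
      ultimately show False using sub[of 0] weight_ge_uminus by fastforce
    next
      assume "involves (n + 1) g"
      then obtain m where "m \<in> Poly_Mapping.keys g" "Poly_Mapping.lookup m (n + 1) \<noteq> 0"
        unfolding involves_def by auto
      then have "g \<notin> weight_ge ?\<delta> (int d - 1 + 1)"
        unfolding weight_ge_def using form_weight[OF forms(2) _ n, of m] by force
      then have "g * var 0 \<notin> weight_ge ?\<delta> (int d - 1 + - 1 + 1)"
        using lowest_weight_mult[OF gw _ v0] by blast
      moreover have "mpol_subst (var(n + 2 := 0)) (rees_eqn n f g) = g * var 0"
        unfolding rees_eqn_def by (simp add: mpol_subst_diff mpol_subst_mult fix0)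
      ultimately show False using sub[of "n + 2"] by simp
    qed
  qed
qed

section \<open>Chains of primes\<close>

definition prime_ideal_on :: "'a::idom set \<Rightarrow> 'a set \<Rightarrow> bool" where
  "prime_ideal_on L P \<longleftrightarrow> P \<subseteq> L \<and> 0 \<in> P \<and> (\<forall>x\<in>P. \<forall>y\<in>P. x + y \<in> P) \<and> (\<forall>x\<in>L. \<forall>y\<in>P. x * y \<in> P) \<and>
     1 \<notin> P \<and> (\<forall>x\<in>L. \<forall>y\<in>L. x * y \<in> P \<longrightarrow> x \<in> P \<or> y \<in> P)"

lemma prime_ideal_on_const:
  assumes "prime_ideal_on L P" "\<And>c. const c \<in> L" "const c \<in> P"
  shows "c = 0"
proof (rule ccontr)
  assume c: "c \<noteq> 0"
  have "const (inverse c) * const c \<in> P" using assms unfolding prime_ideal_on_def by blast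
  then have "1 \<in> P" using c by (simp add: mult_single)
  then show False using assms(1) unfolding prime_ideal_on_def by blast
qed

text \<open>Elements picked from the successive differences of a chain of primes are algebraically
  independent modulo the smallest one.\<close>

lemma prime_chain_independent:
  fixes P :: "nat \<Rightarrow> 'k::field mpol set"
  assumes L: "idom_subring L" "\<And>c. const c \<in> L"
    and P: "\<And>i. i \<le> r \<Longrightarrow> prime_ideal_on L (P i)"
    and q: "\<And>i. i < r \<Longrightarrow> P i \<subseteq> P (Suc i) \<and> q i \<in> P (Suc i) \<and> q i \<notin> P i"
    and "i \<le> r" "F \<in> mpols {i..<r}" "mpol_subst q F \<in> P i"
  shows "F = 0"
  using assms(5-7)
proof (induction i arbitrary: F rule: inc_induct)
  case base
  then have "Poly_Mapping.keys F \<subseteq> {0}" unfolding mpols_def by auto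
  then have F: "F = const (Poly_Mapping.lookup F 0)"
    by (intro poly_mapping_eqI) (auto simp: lookup_single when_def in_keys_iff)
  then have "const (Poly_Mapping.lookup F 0) \<in> P r" using base(2) by (metis mpol_subst_const)
  then show ?case using prime_ideal_on_const[OF P[of r] L(2)] F by (metis le_refl single_zero)
next
  case (step i)
  have V: "{i..<r} - {i} = {Suc i..<r}" by auto
  have qi: "q i \<in> L" using q[OF step.hyps(2)] P[of "Suc i"] step.hyps(2) unfolding prime_ideal_on_def by auto
  have PL: "P i \<subseteq> L" "P (Suc i) \<subseteq> L" and P': "prime_ideal_on L (P i)" "prime_ideal_on L (P (Suc i))"
    using P[of i] P[of "Suc i"] step.hyps(2) unfolding prime_ideal_on_def by auto
  have qL: "mpol_subst q G \<in> L" if "G \<in> mpols {i..<r}" for G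
  proof (rule mpol_subst_in_subring[OF L(1) that _ L(2)])
    fix j assume "j \<in> {i..<r}"
    then show "q j \<in> L" using q[of j] P[of "Suc j"] unfolding prime_ideal_on_def by auto
  qed
  have main: "G = 0" if "G \<in> polys_over (mpols {Suc i..<r})" "mpol_subst q (poly G (var i)) \<in> P i" for G
    using that
  proof (induction G)
    case (pCons a G)
    have a: "a \<in> mpols {Suc i..<r}" "G \<in> polys_over (mpols {Suc i..<r})" using pCons.prems(1) by auto
    have sub: "mpols {Suc i..<r} \<subseteq> (mpols {i..<r} :: 'k mpol set)" by (rule mpols_mono) auto
    let ?X = "mpol_subst q (poly G (var i))"
    have XL: "?X \<in> L"
      using a(2) step.hyps by (intro qL poly_fresh_closed[of G "{Suc i..<r}"] var_in_mpols) auto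
    have eq: "mpol_subst q (poly (pCons a G) (var i)) = mpol_subst q a + q i * ?X"
      by (simp add: mpol_subst_add mpol_subst_mult)
    \<comment> \<open>As q i lies in P (Suc i), modulo this prime only the constant coefficient of
      the relation is left, and it vanishes by induction. Then q i, being outside P i, is cancelled
      modulo P i.\<close>
    have "X * q i \<in> P (Suc i)" if "X \<in> L" for X
      using that q[OF step.hyps(2)] P'(2) unfolding prime_ideal_on_def by blast
    then have "- ?X * q i \<in> P (Suc i)" using XL idom_subring.uminus_closed[OF L(1)] by blast
    moreover have "mpol_subst q a + q i * ?X \<in> P (Suc i)"
      using pCons.prems(2) q[OF step.hyps(2)] unfolding eq by auto
    ultimately have "(mpol_subst q a + q i * ?X) + - ?X * q i \<in> P (Suc i)"
      using P'(2) unfolding prime_ideal_on_def by blast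
    then have "mpol_subst q a \<in> P (Suc i)" by (simp add: mult.commute)
    then have a0: "a = 0" using step.IH a(1) by blast
    then have "q i * ?X \<in> P i" using pCons.prems(2) unfolding eq by simp
    then have "?X \<in> P i" using P'(1) qi XL q[OF step.hyps(2)] unfolding prime_ideal_on_def by blast
    then show ?case using pCons.IH a a0 by simp
  qed simp
  obtain G where G: "G \<in> polys_over (mpols {Suc i..<r})" "F = poly G (var i)"
    using mpols_fresh_poly[OF step.prems(1), of i] unfolding V by blast
  then have "G = 0" using main step.prems(2) by blast
  then show ?case using G(2) by simp
qed

section \<open>Bounding algebraic independence by counting monomials\<close>

global_interpretation mpol_space: vector_space "\<lambda>c p. const c * p :: 'k::field mpol"
  by standard (simp_all add: distrib_left distrib_right single_add mult_single mult.assoc[symmetric])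

text \<open>Exponents are bounded variable by variable rather than by total degree, which gives the
  closed count \<open>(d + 1) ^ card S\<close>.\<close>

definition box :: "nat set \<Rightarrow> nat \<Rightarrow> (nat \<Rightarrow>\<^sub>0 nat) set" where
  "box S d = {m. Poly_Mapping.keys m \<subseteq> S \<and> (\<forall>j. Poly_Mapping.lookup m j \<le> d)}"

lemma card_box:
  assumes "finite S"
  shows "finite (box S d)" "card (box S d) = (d + 1) ^ card S"
proof -
  have inj: "inj_on (\<lambda>m. restrict (Poly_Mapping.lookup m) S) (box S d)"
  proof (rule inj_onI)
    fix m m' assume m: "m \<in> box S d" "m' \<in> box S d"
      "restrict (Poly_Mapping.lookup m) S = restrict (Poly_Mapping.lookup m') S"
    show "m = m'"
    proof (rule poly_mapping_eqI)
      fix j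
      show "Poly_Mapping.lookup m j = Poly_Mapping.lookup m' j"
      proof (cases "j \<in> S")
        case True
        then show ?thesis using m(3) by (metis restrict_apply')
      next
        case False
        then have "j \<notin> Poly_Mapping.keys m" "j \<notin> Poly_Mapping.keys m'" using m unfolding box_def by auto
        then show ?thesis by (simp add: in_keys_iff)
      qed
    qed
  qed
  have "(\<lambda>m. restrict (Poly_Mapping.lookup m) S) ` box S d = PiE S (\<lambda>_. {..d})"
  proof (intro equalityI subsetI)
    fix \<phi> assume "\<phi> \<in> (\<lambda>m. restrict (Poly_Mapping.lookup m) S) ` box S d"
    then show "\<phi> \<in> PiE S (\<lambda>_. {..d})" unfolding box_def by auto
  next
    fix \<phi> assume \<phi>: "\<phi> \<in> PiE S (\<lambda>_. {..d})"
    define m where "m = Abs_poly_mapping (\<lambda>j. if j \<in> S then \<phi> j else 0)"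
    have "finite {j. (if j \<in> S then \<phi> j else 0) \<noteq> 0}" using assms by (auto intro: finite_subset)
    then have m: "Poly_Mapping.lookup m = (\<lambda>j. if j \<in> S then \<phi> j else 0)"
      unfolding m_def by (rule lookup_Abs_poly_mapping)
    then have "m \<in> box S d" using \<phi> unfolding box_def by (auto simp: in_keys_iff split: if_splits)
    moreover have "restrict (Poly_Mapping.lookup m) S = \<phi>"
      unfolding m using \<phi> by (auto simp: restrict_def PiE_def extensional_def fun_eq_iff)
    ultimately show "\<phi> \<in> (\<lambda>m. restrict (Poly_Mapping.lookup m) S) ` box S d" by blast
  qed
  then have bij: "bij_betw (\<lambda>m. restrict (Poly_Mapping.lookup m) S) (box S d) (PiE S (\<lambda>_. {..d}))"
    using inj unfolding bij_betw_def by blast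
  show "finite (box S d)" using bij_betw_finite[OF bij] assms by (simp add: finite_PiE)
  show "card (box S d) = (d + 1) ^ card S"
    using bij_betw_same_card[OF bij] assms by (simp add: card_PiE)
qed

text \<open>A linear relation among distinct products of the q i is a polynomial relation, and so is
  the equality of two such products.\<close>

lemma independent_monom_subst:
  fixes q :: "nat \<Rightarrow> 'k::field mpol"
  assumes indep: "\<And>F. F \<in> mpols S \<Longrightarrow> mpol_subst q F = 0 \<Longrightarrow> F = 0"
    and M: "M \<subseteq> {m. Poly_Mapping.keys m \<subseteq> S}"
  shows "inj_on (monom_subst q) M" "mpol_space.independent (monom_subst q ` M)"
proof -
  show inj: "inj_on (monom_subst q) M"
  proof (rule inj_onI)
    fix m m' assume m: "m \<in> M" "m' \<in> M" "monom_subst q m = monom_subst q m'"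
    let ?F = "Poly_Mapping.single m 1 - Poly_Mapping.single m' 1 :: 'k mpol"
    have "?F \<in> mpols S" using m M by (intro mpols.diff_closed) (auto simp: mpols_def)
    moreover have "mpol_subst q ?F = 0" using m(3) by (simp add: mpol_subst_diff mpol_subst_single)
    ultimately have "Poly_Mapping.single m (1::'k) = Poly_Mapping.single m' 1" using indep by fastforce
    then show "m = m'" by (metis keys_single singleton_inject zero_neq_one)
  qed
  show "mpol_space.independent (monom_subst q ` M)"
  proof
    assume "mpol_space.dependent (monom_subst q ` M)"
    then obtain t u where t: "finite t" "t \<subseteq> monom_subst q ` M" "(\<Sum>v\<in>t. const (u v) * v) = 0" "\<exists>v\<in>t. u v \<noteq> 0"
      unfolding mpol_space.dependent_explicit by blast
    obtain T where T: "T \<subseteq> M" "t = monom_subst q ` T" using t(2) by (meson subset_imageE)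
    have injT: "inj_on (monom_subst q) T" using inj T(1) inj_on_subset by blast
    then have finT: "finite T" using t(1) T(2) finite_imageD by blast
    define F where "F = (\<Sum>m\<in>T. Poly_Mapping.single m (u (monom_subst q m)))"
    have "F \<in> mpols S"
      unfolding F_def using T(1) M by (intro mpols.sum_closed) (auto simp: mpols_def)
    moreover have "mpol_subst q F = (\<Sum>v\<in>t. const (u v) * v)"
      unfolding F_def T(2) mpol_subst_sum mpol_subst_single by (simp add: sum.reindex[OF injT])
    ultimately have F0: "F = 0" using indep t(3) by simp
    have "u (monom_subst q m) = 0" if "m \<in> T" for m
    proof -
      have "Poly_Mapping.lookup F m = (\<Sum>m'\<in>T. if m' = m then u (monom_subst q m') else 0)"
        unfolding F_def lookup_sum by (rule sum.cong) (auto simp: lookup_single when_def)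
      also have "\<dots> = u (monom_subst q m)" using that finT by simp
      finally show ?thesis using F0 by simp
    qed
    then show False using t(4) T(2) by auto
  qed
qed

lemma in_span_monomials:
  assumes "Poly_Mapping.keys p \<subseteq> M"
  shows "p \<in> mpol_space.span ((\<lambda>m. Poly_Mapping.single m 1) ` M)"
proof -
  have "(\<Sum>m\<in>Poly_Mapping.keys p. Poly_Mapping.single m (Poly_Mapping.lookup p m)) \<in>
      mpol_space.span ((\<lambda>m. Poly_Mapping.single m 1) ` M)"
  proof (rule mpol_space.span_sum)
    fix m assume "m \<in> Poly_Mapping.keys p"
    then have "const (Poly_Mapping.lookup p m) * Poly_Mapping.single m 1 \<in> mpol_space.span ((\<lambda>m. Poly_Mapping.single m 1) ` M)"
      using assms by (intro mpol_space.span_scale mpol_space.span_base) auto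
    then show "Poly_Mapping.single m (Poly_Mapping.lookup p m) \<in> mpol_space.span ((\<lambda>m. Poly_Mapping.single m 1) ` M)"
      by (simp add: mult_single)
  qed
  then show ?thesis by (simp only: mpol_sum_singles[symmetric])
qed

text \<open>Comparison of growth: \<open>(d + 1) ^ r\<close> products of the q i are linearly
  independent, yet lie in the span of \<open>(K * d + 1) ^ card V\<close> monomials. For r > card V
  and large d this is impossible.\<close>

lemma algebraically_independent_card_le:
  fixes q :: "nat \<Rightarrow> 'k::field mpol"
  assumes indep: "\<And>F. F \<in> mpols {0..<r} \<Longrightarrow> mpol_subst q F = 0 \<Longrightarrow> F = 0"
    and V: "finite V" and q: "\<And>i. i < r \<Longrightarrow> q i \<in> mpols V"
  shows "r \<le> card V"
proof (rule ccontr)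
  assume r: "\<not> r \<le> card V"
  define E where "E = (\<Union>i\<in>{0..<r}. \<Union>m\<in>Poly_Mapping.keys (q i). Poly_Mapping.lookup m ` Poly_Mapping.keys m)"
  define D where "D = Max (insert 0 E)"
  have "finite E" unfolding E_def by auto
  then have E: "x \<le> D" if "x \<in> E" for x unfolding D_def using that by simp
  have D: "Poly_Mapping.lookup m j \<le> D" if "i < r" "m \<in> Poly_Mapping.keys (q i)" for i m j
  proof (cases "j \<in> Poly_Mapping.keys m")
    case True
    then show ?thesis unfolding E_def using that by (intro E[unfolded E_def] UN_I[of i] UN_I[of m] imageI) auto
  qed (simp add: in_keys_iff)
  \<comment> \<open>Each q i has exponents at most D, so a product of r powers with exponents up to
    d has exponents at most D * r * d.\<close>
  define K where "K = D * r"
  have bound: "(d + 1) ^ r \<le> (K * d + 1) ^ card V" for d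
  proof -
    have keys: "Poly_Mapping.keys (monom_subst q m) \<subseteq> box V (K * d)" if m: "m \<in> box {0..<r} d" for m
    proof -
      let ?p = "Poly_Mapping.single m 1 :: 'k mpol"
      have pm: "?p \<in> mpols {0..<r}" using m unfolding mpols_def box_def by auto
      have p: "mpol_subst q ?p = monom_subst q m" by (simp add: mpol_subst_single)
      have "monom_subst q m \<in> mpols V"
        unfolding p[symmetric] using pm q by (intro mpol_subst_in_subring[OF idom_subring_mpols] const_in_mpols) auto
      \<comment> \<open>Weight -1 on the single variable j turns an upper bound for its exponent
        into a lower weight bound.\<close>
      moreover have "monom_subst q m \<in> weight_ge (\<lambda>i. if i = j then - 1 else 0) (- int (K * d))" for j
        unfolding p[symmetric]
      proof (rule mpol_subst_weight_ge[OF pm, where \<delta> = "\<lambda>_. - int D"])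
        have "weight (\<lambda>_. int D) m = (\<Sum>i\<in>{0..<r}. int D * int (Poly_Mapping.lookup m i))"
          using m unfolding box_def by (intro weight_superset) auto
        also have "\<dots> \<le> (\<Sum>i\<in>{0..<r}. int D * int d)"
          using m unfolding box_def by (intro sum_mono mult_left_mono) auto
        finally have "weight (\<lambda>_. int D) m \<le> (\<Sum>i\<in>{0..<r}. int D * int d)" .
        moreover have "weight (\<lambda>_. - int D) m = - weight (\<lambda>_. int D) m"
          unfolding weight_def by (simp add: sum_negf)
        ultimately show "?p \<in> weight_ge (\<lambda>_. - int D) (- int (K * d))"
          unfolding K_def by (intro weight_ge_single) (simp add: algebra_simps)
      next
        fix i assume "i \<in> {0..<r}"
        then show "q i \<in> weight_ge (\<lambda>i. if i = j then - 1 else 0) (- int D)"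
          unfolding weight_ge_def weight_def using D[of i _ j]
          by (auto simp: if_distrib[of "\<lambda>x. x * _"] cong: if_cong)
      qed
      ultimately show ?thesis
      proof -
        assume 1: "monom_subst q m \<in> mpols V"
          and 2: "\<And>j. monom_subst q m \<in> weight_ge (\<lambda>i. if i = j then - 1 else 0) (- int (K * d))"
        show ?thesis
        proof
          fix m' assume m': "m' \<in> Poly_Mapping.keys (monom_subst q m)"
          have "Poly_Mapping.lookup m' j \<le> K * d" for j
          proof -
            have "- int (K * d) \<le> weight (\<lambda>i. if i = j then - 1 else 0) m'" using 2[of j] m' unfolding weight_ge_def by blast
            also have "\<dots> = - int (Poly_Mapping.lookup m' j)"
              unfolding weight_def by (auto simp: if_distrib[of "\<lambda>x. x * _"] in_keys_iff cong: if_cong)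
            finally show ?thesis by linarith
          qed
          then show "m' \<in> box V (K * d)" using 1 m' unfolding box_def mpols_def by auto
        qed
      qed
    qed
    have M: "box {0..<r} d \<subseteq> {m. Poly_Mapping.keys m \<subseteq> {0..<r}}" unfolding box_def by auto
    let ?T = "(\<lambda>m. Poly_Mapping.single m (1::'k)) ` box V (K * d)"
    have "monom_subst q ` box {0..<r} d \<subseteq> mpol_space.span ?T"
      using in_span_monomials[OF keys] by blast
    then have "card (monom_subst q ` box {0..<r} d) \<le> card ?T"
      using mpol_space.independent_span_bound[of ?T] independent_monom_subst(2)[OF indep M] card_box(1)[OF V] by simp
    also have "\<dots> \<le> (K * d + 1) ^ card V" using card_image_le[OF card_box(1)[OF V]] card_box(2)[OF V] by metis
    finally show ?thesis
      using card_image[OF independent_monom_subst(1)[OF indep M]] card_box(2)[of "{0..<r}" d] by simp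
  qed
  define N where "N = card V"
  \<comment> \<open>Chosen so that ((K + 1) (d + 1)) ^ N equals (d + 1) ^ N * d, which is below (d +
    1) ^ (N + 1).\<close>
  define d where "d = (K + 1) ^ N"
  have "(d + 1) ^ N * (d + 1) \<le> (d + 1) ^ r"
    using r power_increasing[of "Suc N" r "d + 1"] unfolding N_def by (simp add: mult.commute)
  also have "\<dots> \<le> (K * d + 1) ^ N" using bound unfolding N_def .
  also have "\<dots> \<le> ((K + 1) * (d + 1)) ^ N" by (intro power_mono) (auto simp: algebra_simps)
  also have "\<dots> = (d + 1) ^ N * d" unfolding d_def by (simp only: power_mult_distrib mult.commute)
  finally show False by simp
qed

theorem prime_chain_length_le:
  fixes P :: "nat \<Rightarrow> 'k::field mpol set"
  assumes L: "idom_subring L" "\<And>c. const c \<in> L" "L \<subseteq> mpols V" "finite V"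
    and P: "\<And>i. i \<le> r \<Longrightarrow> prime_ideal_on L (P i)" "\<And>i. i < r \<Longrightarrow> P i \<subset> P (Suc i)"
  shows "r \<le> card V"
proof -
  have "\<forall>i. i < r \<longrightarrow> (\<exists>x. x \<in> P (Suc i) \<and> x \<notin> P i)" using P(2) by blast
  then obtain q where q: "\<And>i. i < r \<Longrightarrow> q i \<in> P (Suc i) \<and> q i \<notin> P i" by metis
  show ?thesis
  proof (rule algebraically_independent_card_le[OF _ L(4)])
    show "F = 0" if "F \<in> mpols {0..<r}" "mpol_subst q F = 0" for F
    proof (rule prime_chain_independent[OF L(1,2) P(1) _ _ that(1)])
      show "P i \<subseteq> P (Suc i) \<and> q i \<in> P (Suc i) \<and> q i \<notin> P i" if "i < r" for i
        using q[OF that] P(2)[OF that] by auto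
      show "mpol_subst q F \<in> P 0" using that(2) P(1)[of 0] unfolding prime_ideal_on_def by simp
    qed auto
    show "q i \<in> mpols V" if "i < r" for i
      using q[OF that] P(1)[of "Suc i"] that L(3) unfolding prime_ideal_on_def by auto
  qed
qed

section \<open>Transfer between HOL-Algebra rings and subsets of a domain\<close>

lemma regular_mod_nth:
  "regular_mod B K as \<longleftrightarrow> (\<forall>i<length as. as ! i \<in> B \<and>
     (\<forall>b\<in>B. as ! i * b \<in> foldl (adjoin_ideal B) K (take i as) \<longrightarrow> b \<in> foldl (adjoin_ideal B) K (take i as)))"
proof (induction as arbitrary: K)
  case (Cons a as)
  then show ?case by (auto simp: All_less_Suc2)
qed simp

text \<open>The notions of the statement live on carriers of records; an injective homomorphism into
  a domain moves generated ideals, regular sequences and prime chains to the setting of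
  subsets.\<close>

locale ring_embedding = cring A for A :: "('a, 'm) ring_scheme" (structure) +
  fixes \<Theta> :: "'a \<Rightarrow> 'b::idom"
  assumes inj: "inj_on \<Theta> (carrier A)"
    and hom_one: "\<Theta> \<one> = 1"
    and hom_add: "x \<in> carrier A \<Longrightarrow> y \<in> carrier A \<Longrightarrow> \<Theta> (x \<oplus> y) = \<Theta> x + \<Theta> y"
    and hom_mult: "x \<in> carrier A \<Longrightarrow> y \<in> carrier A \<Longrightarrow> \<Theta> (x \<otimes> y) = \<Theta> x * \<Theta> y"
begin

lemma hom_zero: "\<Theta> \<zero> = 0"
  using hom_add[of \<zero> \<zero>] by (metis add_cancel_right_right l_zero zero_closed)

lemma hom_uminus: "x \<in> carrier A \<Longrightarrow> \<Theta> (\<ominus> x) = - \<Theta> x"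
  using hom_add[of x "\<ominus> x"] hom_zero by (simp add: r_neg eq_neg_iff_add_eq_0 add.commute)

lemma hom_minus: "x \<in> carrier A \<Longrightarrow> y \<in> carrier A \<Longrightarrow> \<Theta> (x \<ominus> y) = \<Theta> x - \<Theta> y"
  unfolding a_minus_def by (simp add: hom_add hom_uminus)

lemma idom_subring_image: "idom_subring (\<Theta> ` carrier A)"
proof
  show "1 \<in> \<Theta> ` carrier A" by (metis hom_one imageI one_closed)
  show "a - b \<in> \<Theta> ` carrier A" if "a \<in> \<Theta> ` carrier A" "b \<in> \<Theta> ` carrier A" for a b
    using that by (auto simp flip: hom_minus)
  show "a * b \<in> \<Theta> ` carrier A" if "a \<in> \<Theta> ` carrier A" "b \<in> \<Theta> ` carrier A" for a b
    using that by (auto simp flip: hom_mult)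
qed

lemma image_mem_iff: "x \<in> carrier A \<Longrightarrow> S \<subseteq> carrier A \<Longrightarrow> \<Theta> x \<in> \<Theta> ` S \<longleftrightarrow> x \<in> S"
  using inj by (rule inj_on_image_mem_iff)

lemma genideal_insert_eq:
  assumes "a \<in> carrier A" "S \<subseteq> carrier A"
  shows "Idl (insert a S) = {k \<oplus> a \<otimes> b | k b. k \<in> Idl S \<and> b \<in> carrier A}"
proof (intro equalityI)
  have sub: "insert a S \<subseteq> carrier A" using assms by auto
  have S: "Idl S \<subseteq> Idl (insert a S)"
    using genideal_minimal[OF genideal_ideal[OF sub]] genideal_self[OF sub] by auto
  interpret I: ideal "Idl (insert a S)" A by (rule genideal_ideal[OF sub])
  show "{k \<oplus> a \<otimes> b | k b. k \<in> Idl S \<and> b \<in> carrier A} \<subseteq> Idl (insert a S)"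
    using S genideal_self[OF sub] by (auto intro!: I.a_closed I.I_r_closed)
  have "Idl (insert a S) \<subseteq> Idl S <+>\<^bsub>A\<^esub> PIdl a"
  proof (rule genideal_minimal)
    show "ideal (Idl S <+>\<^bsub>A\<^esub> PIdl a) A"
      using assms genideal_ideal cgenideal_ideal by (intro add_ideals) auto
    interpret J: ideal "Idl S" A by (rule genideal_ideal[OF assms(2)])
    interpret J': ideal "PIdl a" A by (rule cgenideal_ideal[OF assms(1)])
    have "a = \<zero> \<oplus> a" using assms by simp
    then have "a \<in> Idl S <+>\<^bsub>A\<^esub> PIdl a"
      unfolding set_add_def' using cgenideal_self[OF assms(1)] J.zero_closed by blast
    moreover have "s \<in> Idl S <+>\<^bsub>A\<^esub> PIdl a" if "s \<in> S" for s
    proof -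
      have "s = s \<oplus> \<zero>" using that assms by auto
      then show ?thesis
        unfolding set_add_def' using that genideal_self[OF assms(2)] J'.zero_closed by blast
    qed
    ultimately show "insert a S \<subseteq> Idl S <+>\<^bsub>A\<^esub> PIdl a" by auto
  qed
  moreover have "Idl S <+>\<^bsub>A\<^esub> PIdl a \<subseteq> {k \<oplus> a \<otimes> b | k b. k \<in> Idl S \<and> b \<in> carrier A}"
  proof
    fix x assume "x \<in> Idl S <+>\<^bsub>A\<^esub> PIdl a"
    then obtain k b where "x = k \<oplus> b \<otimes> a" "k \<in> Idl S" "b \<in> carrier A"
      unfolding set_add_def' cgenideal_def by blast
    then show "x \<in> {k \<oplus> a \<otimes> b | k b. k \<in> Idl S \<and> b \<in> carrier A}"
      using m_comm[OF _ assms(1)] by auto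
  qed
  ultimately show "Idl (insert a S) \<subseteq> {k \<oplus> a \<otimes> b | k b. k \<in> Idl S \<and> b \<in> carrier A}" by blast
qed

lemma genideal_empty: "Idl {} = {\<zero>}"
proof
  show "Idl {} \<subseteq> {\<zero>}" by (rule genideal_minimal[OF zeroideal]) simp
  interpret I: ideal "Idl {}" A by (rule genideal_ideal) simp
  show "{\<zero>} \<subseteq> Idl {}" using I.zero_closed by simp
qed

text \<open>Induction from the right fits \<open>foldl\<close>, which adjoins the last element last,
  and the initial segments in \<open>regular_sequence\<close>.\<close>

lemma image_genideal:
  "set as \<subseteq> carrier A \<Longrightarrow> \<Theta> ` (Idl (set as)) = foldl (adjoin_ideal (\<Theta> ` carrier A)) {0} (map \<Theta> as)"
proof (induction as rule: rev_induct)
  case Nil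
  then show ?case by (simp add: genideal_empty hom_zero)
next
  case (snoc a as)
  then have a: "a \<in> carrier A" "set as \<subseteq> carrier A" by auto
  have I: "Idl (set as) \<subseteq> carrier A"
    using genideal_ideal[OF a(2)] by (metis additive_subgroup.a_subset ideal.axioms(1))
  have "\<Theta> ` (Idl (set (as @ [a]))) = \<Theta> ` {k \<oplus> a \<otimes> b | k b. k \<in> Idl (set as) \<and> b \<in> carrier A}"
    using genideal_insert_eq[OF a] by simp
  also have "\<dots> = adjoin_ideal (\<Theta> ` carrier A) (\<Theta> ` (Idl (set as))) (\<Theta> a)"
  proof (intro equalityI subsetI)
    fix x assume "x \<in> \<Theta> ` {k \<oplus> a \<otimes> b | k b. k \<in> Idl (set as) \<and> b \<in> carrier A}"
    then obtain k b where "x = \<Theta> (k \<oplus> a \<otimes> b)" "k \<in> Idl (set as)" "b \<in> carrier A" by auto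
    then show "x \<in> adjoin_ideal (\<Theta> ` carrier A) (\<Theta> ` (Idl (set as))) (\<Theta> a)"
      unfolding adjoin_ideal_def using a I by (auto simp: hom_add hom_mult subset_iff)
  next
    fix x assume "x \<in> adjoin_ideal (\<Theta> ` carrier A) (\<Theta> ` (Idl (set as))) (\<Theta> a)"
    then obtain k b where "x = \<Theta> k + \<Theta> a * \<Theta> b" "k \<in> Idl (set as)" "b \<in> carrier A"
      unfolding adjoin_ideal_def by auto
    moreover from this have "x = \<Theta> (k \<oplus> a \<otimes> b)" using a I by (simp add: hom_add hom_mult subset_iff)
    ultimately show "x \<in> \<Theta> ` {k \<oplus> a \<otimes> b | k b. k \<in> Idl (set as) \<and> b \<in> carrier A}" by blast
  qed
  finally show ?case using snoc.IH[OF a(2)] by simp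
qed

lemma regular_sequence_transfer:
  assumes as: "set as \<subseteq> carrier A" and reg: "regular_mod (\<Theta> ` carrier A) {0} (map \<Theta> as)"
    and proper: "Idl (set as) \<noteq> carrier A"
  shows "regular_sequence A as"
  unfolding regular_sequence_def
proof (intro conjI allI impI ballI)
  fix i b assume i: "i < length as" and b: "b \<in> carrier A" and ab: "as ! i \<otimes> b \<in> Idl (set (take i as))"
  have ti: "set (take i as) \<subseteq> carrier A" using as set_take_subset by fastforce
  have I: "Idl (set (take i as)) \<subseteq> carrier A"
    using genideal_ideal[OF ti] by (metis additive_subgroup.a_subset ideal.axioms(1))
  have ai: "as ! i \<in> carrier A" using as i by (meson nth_mem subsetD)
  have "\<Theta> (as ! i) * \<Theta> b \<in> \<Theta> ` (Idl (set (take i as)))"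
    using ab hom_mult[OF ai b] by (metis imageI)
  then have "\<Theta> b \<in> \<Theta> ` (Idl (set (take i as)))"
    using reg i b unfolding regular_mod_nth image_genideal[OF ti] by (auto simp: take_map)
  then show "b \<in> Idl (set (take i as))" using image_mem_iff[OF b I] by simp
qed (use as proper in auto)

lemma primeideal_image:
  assumes "primeideal P A"
  shows "prime_ideal_on (\<Theta> ` carrier A) (\<Theta> ` P)"
proof -
  interpret P: primeideal P A by fact
  have sub: "P \<subseteq> carrier A" by (rule P.a_subset)
  have "\<one> \<notin> P" using P.one_imp_carrier P.I_notcarr by auto
  then have "1 \<notin> \<Theta> ` P" using image_mem_iff[OF one_closed sub] hom_one by simp
  moreover have "\<Theta> x + \<Theta> y \<in> \<Theta> ` P" if "x \<in> P" "y \<in> P" for x y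
    using that sub hom_add[of x y] P.a_closed by (metis imageI subsetD)
  moreover have "\<Theta> x * \<Theta> y \<in> \<Theta> ` P" if "x \<in> carrier A" "y \<in> P" for x y
    using that sub hom_mult[of x y] P.I_l_closed by (metis imageI subsetD)
  moreover have "\<Theta> x \<in> \<Theta> ` P \<or> \<Theta> y \<in> \<Theta> ` P" if xy: "x \<in> carrier A" "y \<in> carrier A" "\<Theta> x * \<Theta> y \<in> \<Theta> ` P" for x y
  proof -
    have "x \<otimes> y \<in> P" using xy hom_mult image_mem_iff[OF _ sub, of "x \<otimes> y"] by simp
    then show ?thesis using P.I_prime xy by blast
  qed
  moreover have "0 \<in> \<Theta> ` P" using hom_zero P.zero_closed by (metis imageI)
  ultimately show ?thesis unfolding prime_ideal_on_def using sub by (auto intro: imageI)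
qed

end

lemma krull_dim_le:
  fixes \<Theta> :: "'a \<Rightarrow> 'k::field mpol"
  assumes "ring_embedding A \<Theta>" "\<Theta> ` carrier A \<subseteq> mpols V" "finite V" "\<And>c. const c \<in> \<Theta> ` carrier A"
  shows "krull_dim A \<le> enat (card V)"
  unfolding krull_dim_def
proof (rule Sup_least)
  interpret ring_embedding A \<Theta> by fact
  fix x assume "x \<in> {enat r |r. \<exists>P. (\<forall>i\<le>r. primeideal (P i) A) \<and> (\<forall>i<r. P i \<subset> P (Suc i))}"
  then obtain r P where x: "x = enat r" and P: "\<And>i. i \<le> r \<Longrightarrow> primeideal (P i) A" "\<And>i. i < r \<Longrightarrow> P i \<subset> P (Suc i)"
    by blast
  have sub: "P i \<subseteq> carrier A" if "i \<le> r" for i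
    using P(1)[OF that] by (meson additive_subgroup.a_subset ideal.axioms(1) primeideal.axioms(1))
  have "r \<le> card V"
  proof (rule prime_chain_length_le[OF idom_subring_image assms(4,2,3), of _ "\<lambda>i. \<Theta> ` P i"])
    show "\<Theta> ` P i \<subset> \<Theta> ` P (Suc i)" if "i < r" for i
      using P(2)[OF that] sub[of i] sub[of "Suc i"] that inj
      by (metis inj_on_image_eq_iff image_mono psubset_eq Suc_leI less_imp_le)
  qed (use P(1) primeideal_image in auto)
  then show "x \<le> enat (card V)" using x by simp
qed

section \<open>Polynomials in \<open>t\<close> as polynomials in the variable with index \<open>0\<close>\<close>

lemma mpol_ring_simps:
  "monoid.mult (mpol_ring N) = (*)" "one (mpol_ring N) = 1" "ring.zero (mpol_ring N) = 0" "add (mpol_ring N) = (+)"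
  unfolding mpol_ring_def by simp_all

lemma cring_mpol_ring: "cring (mpol_ring N :: 'k::field mpol ring)"
proof (rule cringI)
  show "abelian_group (mpol_ring N :: 'k mpol ring)"
  proof (rule abelian_groupI)
    fix x :: "'k mpol" assume "x \<in> carrier (mpol_ring N)"
    then show "\<exists>y\<in>carrier (mpol_ring N). y \<oplus>\<^bsub>mpol_ring N\<^esub> x = \<zero>\<^bsub>mpol_ring N\<^esub>"
      unfolding carrier_mpol_ring mpol_ring_simps by (intro bexI[of _ "- x"]) (auto intro: mpols.uminus_closed)
  qed (auto simp: carrier_mpol_ring mpol_ring_simps mpols.add_closed mpols.zero_closed add_ac)
  show "comm_monoid (mpol_ring N :: 'k mpol ring)"
    by (rule comm_monoidI) (auto simp: carrier_mpol_ring mpol_ring_simps mpols.mult_closed mpols.one_closed mult_ac)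
qed (auto simp: mpol_ring_simps distrib_right)

lemma finsum_mpol_ring:
  fixes h :: "'i \<Rightarrow> 'k::field mpol"
  assumes "finite S" "h \<in> S \<rightarrow> carrier (mpol_ring N)"
  shows "finsum (mpol_ring N) h S = sum h S"
proof -
  interpret cring "mpol_ring N :: 'k mpol ring" by (rule cring_mpol_ring)
  show ?thesis using assms
    by (induction S) (auto simp: mpol_ring_simps)
qed

text \<open>Elements of \<open>UP\<close> are coefficient functions of finite support, hence
  univariate polynomials; evaluation at \<open>var 0\<close> is injective on them because index 0 is
  not among the variables of the coefficients.\<close>

definition poly_in_t :: "(nat \<Rightarrow> 'k::field mpol) \<Rightarrow> 'k mpol" where
  "poly_in_t p = poly (Abs_poly p) (var 0)"

lemma coeff_Abs_poly_up:
  assumes "p \<in> carrier (UP (mpol_ring N))"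
  shows "poly.coeff (Abs_poly p) = p"
proof -
  obtain b where "bound 0 b p" using assms unfolding UP_def up_def mpol_ring_simps by auto
  then have "\<forall>m>b. p m = 0" unfolding bound_def by auto
  then show ?thesis by (intro Abs_poly_inverse) (auto simp: MOST_nat)
qed

lemma up_coeff_carrier: "p \<in> carrier (UP (mpol_ring N)) \<Longrightarrow> p i \<in> mpols {1..N}"
  unfolding UP_def up_def carrier_mpol_ring by auto

lemma Abs_poly_up_polys_over:
  assumes "p \<in> carrier (UP (mpol_ring N))"
  shows "Abs_poly p \<in> polys_over (mpols {1..N})"
  unfolding polys_over_def mem_Collect_eq coeff_Abs_poly_up[OF assms]
  using up_coeff_carrier[OF assms] by blast

lemma UP_add_eq:
  "p \<in> carrier (UP R) \<Longrightarrow> q \<in> carrier (UP R) \<Longrightarrow> p \<oplus>\<^bsub>UP R\<^esub> q = (\<lambda>i. p i \<oplus>\<^bsub>R\<^esub> q i)"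
  unfolding UP_def by simp

lemma UP_mult_eq:
  "p \<in> carrier (UP R) \<Longrightarrow> q \<in> carrier (UP R) \<Longrightarrow>
    p \<otimes>\<^bsub>UP R\<^esub> q = (\<lambda>n. finsum R (\<lambda>i. p i \<otimes>\<^bsub>R\<^esub> q (n - i)) {..n})"
  unfolding UP_def by simp

lemma poly_in_t_embedding:
  "ring_embedding (UP (mpol_ring N :: 'k::field mpol ring)) poly_in_t"
proof -
  interpret R: cring "mpol_ring N :: 'k mpol ring" by (rule cring_mpol_ring)
  interpret U: UP_cring "mpol_ring N :: 'k mpol ring" "UP (mpol_ring N :: 'k mpol ring)"
    by unfold_locales simp
  let ?U = "UP (mpol_ring N :: 'k mpol ring)"
  interpret UP: cring ?U by (rule U.UP_cring)
  note co = coeff_Abs_poly_up[where N = N]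
  show ?thesis
  proof
    show "inj_on poly_in_t (carrier ?U)"
    proof (rule inj_onI)
      fix p q assume pq: "p \<in> carrier ?U" "q \<in> carrier ?U" "poly_in_t p = poly_in_t q"
      then have "Abs_poly p - Abs_poly q \<in> polys_over (mpols {1..N})"
        using Abs_poly_up_polys_over idom_subring.diff_closed[OF mpols.idom_subring_polys_over] by blast
      moreover have "poly (Abs_poly p - Abs_poly q) (var 0) = 0"
        using pq(3) unfolding poly_in_t_def by simp
      moreover have "0 \<notin> {1..N}" by simp
      ultimately have "Abs_poly p - Abs_poly q = 0" using poly_fresh_inj by blast
      then have "poly.coeff (Abs_poly p) = poly.coeff (Abs_poly q)" by simp
      then show "p = q" unfolding co[OF pq(1)] co[OF pq(2)] .
    qed
    have one: "\<one>\<^bsub>?U\<^esub> = (\<lambda>i. if i = 0 then 1 else 0)" unfolding UP_def mpol_ring_simps by simp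
    have "Abs_poly \<one>\<^bsub>?U\<^esub> = 1"
      by (rule poly_eqI) (unfold co[OF U.UP_one_closed], simp add: one)
    then show "poly_in_t \<one>\<^bsub>?U\<^esub> = 1" unfolding poly_in_t_def by simp
    fix p q assume pq: "p \<in> carrier ?U" "q \<in> carrier ?U"
    have "Abs_poly (p \<oplus>\<^bsub>?U\<^esub> q) = Abs_poly p + Abs_poly q"
      by (rule poly_eqI)
        (unfold co[OF U.UP_a_closed[OF pq]] Polynomial.coeff_add co[OF pq(1)] co[OF pq(2)],
          simp add: UP_add_eq[OF pq] mpol_ring_simps)
    then show "poly_in_t (p \<oplus>\<^bsub>?U\<^esub> q) = poly_in_t p + poly_in_t q" unfolding poly_in_t_def by simp
    have "Abs_poly (p \<otimes>\<^bsub>?U\<^esub> q) = Abs_poly p * Abs_poly q"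
    proof (rule poly_eqI)
      fix k
      have "poly.coeff (Abs_poly (p \<otimes>\<^bsub>?U\<^esub> q)) k = finsum (mpol_ring N) (\<lambda>i. p i * q (k - i)) {..k}"
        unfolding co[OF U.UP_mult_closed[OF pq]] unfolding UP_mult_eq[OF pq] mpol_ring_simps ..
      also have "\<dots> = (\<Sum>i\<le>k. p i * q (k - i))"
        using mpols.mult_closed[OF up_coeff_carrier[OF pq(1)] up_coeff_carrier[OF pq(2)]]
        by (intro finsum_mpol_ring) (simp_all add: Pi_iff carrier_mpol_ring del: One_nat_def)
      finally show "poly.coeff (Abs_poly (p \<otimes>\<^bsub>?U\<^esub> q)) k = poly.coeff (Abs_poly p * Abs_poly q) k"
        by (simp add: Polynomial.coeff_mult co[OF pq(1)] co[OF pq(2)])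
    qed
    then show "poly_in_t (p \<otimes>\<^bsub>?U\<^esub> q) = poly_in_t p * poly_in_t q" unfolding poly_in_t_def by simp
  qed
qed

lemma poly_in_t_monom:
  fixes a :: "'k::field mpol"
  assumes "a \<in> carrier (mpol_ring N)"
  shows "poly_in_t (UnivPoly.monom (UP (mpol_ring N)) a i) = a * var 0 ^ i"
proof -
  interpret U: UP_cring "mpol_ring N :: 'k mpol ring" "UP (mpol_ring N :: 'k mpol ring)"
    using cring_mpol_ring by (simp add: UP_cring_def)
  have m: "UnivPoly.monom (UP (mpol_ring N)) a i = (\<lambda>n. if n = i then a else 0)"
    using assms unfolding UP_def mpol_ring_simps by simp
  have "Abs_poly (UnivPoly.monom (UP (mpol_ring N)) a i) = Polynomial.monom a i"
  proof (rule poly_eqI)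
    fix n
    show "poly.coeff (Abs_poly (UnivPoly.monom (UP (mpol_ring N)) a i)) n = poly.coeff (Polynomial.monom a i) n"
      unfolding coeff_Abs_poly_up[OF U.monom_closed[OF assms]] unfolding m by auto
  qed
  then show ?thesis unfolding poly_in_t_def by (simp add: poly_monom)
qed

text \<open>B is generated by the x_i, w and the products x_j s: a monomial of weight at least 0
  that contains s must contain some x_j with j \<le> n in compensation, and x_j s, of weight 0, can
  be split off.\<close>

lemma wpols_tower_induct:
  fixes p :: "'k::field mpol"
  assumes n: "n \<ge> 1" and p: "p \<in> wpols {0..n + 2} (tower_weight n 0) 0"
    and add: "\<And>a b. a \<in> S \<Longrightarrow> b \<in> S \<Longrightarrow> a + b \<in> S" and mult: "\<And>a b. a \<in> S \<Longrightarrow> b \<in> S \<Longrightarrow> a * b \<in> S"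
    and const: "\<And>c. const c \<in> S" and var: "\<And>i. i \<in> {1..n + 2} \<Longrightarrow> var i \<in> S"
    and var0: "\<And>j. j \<in> {1..n} \<Longrightarrow> var j * var 0 \<in> S"
  shows "p \<in> S"
proof -
  let ?\<delta> = "tower_weight n 0"
  have mono: "Poly_Mapping.single m 1 \<in> S" if "Poly_Mapping.keys m \<subseteq> {0..n + 2}" "0 \<le> weight ?\<delta> m" for m
    using that
  proof (induction "\<Sum>i\<in>Poly_Mapping.keys m. Poly_Mapping.lookup m i" arbitrary: m rule: less_induct)
    case less
    have decr: "(\<Sum>i\<in>Poly_Mapping.keys m'. Poly_Mapping.lookup m' i) < (\<Sum>i\<in>Poly_Mapping.keys m. Poly_Mapping.lookup m i)"
      if m: "m = m' + b" and b: "b \<noteq> 0" for m' b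
    proof -
      have sup: "(\<Sum>i\<in>Poly_Mapping.keys m'. Poly_Mapping.lookup m' i) = (\<Sum>i\<in>Poly_Mapping.keys m. Poly_Mapping.lookup m' i)"
        by (rule sum.mono_neutral_left) (auto simp: m keys_add_nat in_keys_iff)
      obtain j where "j \<in> Poly_Mapping.keys b" using b keys_eq_empty by blast
      then show ?thesis
        unfolding sup by (intro sum_strict_mono_ex1 ballI bexI[of _ j]) (auto simp: m keys_add_nat lookup_add in_keys_iff)
    qed
    have step: "Poly_Mapping.single m 1 \<in> S"
      if m: "m = m' + b" and b: "b \<noteq> 0" and w: "0 \<le> weight ?\<delta> m'" and bS: "Poly_Mapping.single b 1 \<in> S" for m' b
    proof -
      have "Poly_Mapping.keys m' \<subseteq> {0..n + 2}" using less.prems(1) unfolding m keys_add_nat by auto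
      then have "Poly_Mapping.single m' 1 \<in> S" using less.hyps[OF decr[OF m b]] w by blast
      then have "Poly_Mapping.single m' 1 * Poly_Mapping.single b 1 \<in> S" using bS by (rule mult)
      then show ?thesis by (simp add: mult_single m)
    qed
    have nonneg: "0 \<le> ?\<delta> i" if "i \<noteq> 0" for i using that by (simp add: tower_weight_def)
    show ?case
    proof (cases "Poly_Mapping.lookup m 0 = 0")
      case True
      show ?thesis
      proof (cases "m = 0")
        case True
        then show ?thesis using const[of 1] by simp
      next
        case False
        then obtain j where j: "j \<in> Poly_Mapping.keys m" using keys_eq_empty by blast
        then have j0: "j \<noteq> 0" "j \<in> {1..n + 2}"
        proof -
          show "j \<noteq> 0" using j True by (metis in_keys_iff)
          then show "j \<in> {1..n + 2}" using j less.prems(1) by fastforce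
        qed
        define m' where "m' = m - Poly_Mapping.single j 1"
        have m: "m = m' + Poly_Mapping.single j 1"
          unfolding m'_def using j
          by (intro poly_mapping_eqI) (auto simp: lookup_add lookup_minus lookup_single when_def in_keys_iff)
        have "Poly_Mapping.lookup m' 0 = 0" using True unfolding m by (simp add: lookup_add)
        then have "0 \<notin> Poly_Mapping.keys m'" by (simp add: in_keys_iff)
        then have "0 \<le> weight ?\<delta> m'"
          unfolding weight_def using nonneg by (intro sum_nonneg mult_nonneg_nonneg) (metis, simp)
        moreover have "Poly_Mapping.single j 1 \<noteq> (0 :: nat \<Rightarrow>\<^sub>0 nat)" by (metis keys_single keys_zero insert_not_empty zero_neq_one)
        ultimately show ?thesis
          using step[OF m] var[OF j0(2)] unfolding var_def by blast
      qed
    next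
      case False
      have "\<exists>j\<in>Poly_Mapping.keys m. j \<in> {1..n}"
      proof (rule ccontr)
        assume no: "\<not> (\<exists>j\<in>Poly_Mapping.keys m. j \<in> {1..n})"
        have "weight ?\<delta> m = (\<Sum>i\<in>Poly_Mapping.keys m. if i = 0 then - int (Poly_Mapping.lookup m 0) else 0)"
          unfolding weight_def using no n by (intro sum.cong) (auto simp: tower_weight_def)
        also have "\<dots> = - int (Poly_Mapping.lookup m 0)" using False by (simp add: in_keys_iff)
        finally show False using less.prems(2) False by simp
      qed
      then obtain j where j: "j \<in> Poly_Mapping.keys m" "j \<in> {1..n}" by blast
      define b where "b = Poly_Mapping.single j (1::nat) + Poly_Mapping.single 0 1"
      define m' where "m' = m - b"
      have m: "m = m' + b"
        unfolding m'_def b_def using j False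
        by (intro poly_mapping_eqI) (auto simp: lookup_add lookup_minus lookup_single when_def in_keys_iff)
      have "weight ?\<delta> b = 0" unfolding b_def weight_add using j(2) by (simp add: tower_weight_def)
      then have w: "0 \<le> weight ?\<delta> m'" using less.prems(2) unfolding m weight_add by simp
      have "Poly_Mapping.lookup b 0 = 1" using j(2) unfolding b_def by (simp add: lookup_add lookup_single)
      then have b0: "b \<noteq> 0" by auto
      have "Poly_Mapping.single b 1 \<in> S"
        using var0[OF j(2)] var_mult_var_0[of 1 j] unfolding b_def by (metis mult_1 single_one)
      then show ?thesis using step[OF m b0 w] by blast
    qed
  qed
  have zero: "0 \<in> S" using const[of 0] by simp
  have single: "Poly_Mapping.single m (Poly_Mapping.lookup p m) \<in> S" if "m \<in> Poly_Mapping.keys p" for m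
  proof -
    have "const (Poly_Mapping.lookup p m) * Poly_Mapping.single m 1 \<in> S"
      using that p by (intro mult const mono) (auto simp: wpols_def mpols_def weight_ge_def)
    then show ?thesis by (simp add: mult_single)
  qed
  have "(\<Sum>m\<in>M. Poly_Mapping.single m (Poly_Mapping.lookup p m)) \<in> S" if "M \<subseteq> Poly_Mapping.keys p" for M
    using finite_subset[OF that finite_keys] that by (induction M) (auto intro: add zero single)
  from this[of "Poly_Mapping.keys p"] show ?thesis using mpol_sum_singles[of p] by simp
qed

section \<open>The Rees algebra as an image of B\<close>

declare One_nat_def [simp del]

locale dejonquieres_pair = coprime_pair n f g for n and f g :: "'k::field mpol" +
  assumes n: "n \<ge> 1"
begin

abbreviation "R \<equiv> mpol_ring (n + 1) :: 'k mpol ring"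
abbreviation "U \<equiv> UP R"
abbreviation "I \<equiv> base_ideal n f g"
abbreviation "A \<equiv> rees_algebra R I"
abbreviation "B \<equiv> wpols {0..n + 2} (tower_weight n 0) 0 :: 'k mpol set"

sublocale R: cring R by (rule cring_mpol_ring)

sublocale U: ring_embedding U poly_in_t by (rule poly_in_t_embedding)

lemma dejonq_map_carrier: "dejonq_map n f g ` {1..n + 1} \<subseteq> carrier R"
  unfolding carrier_mpol_ring dejonq_map_def using f g
  by (auto intro!: mpols.mult_closed var_in_mpols simp del: One_nat_def)

lemma ideal_I: "ideal I R"
  unfolding base_ideal_def by (rule R.genideal_ideal[OF dejonq_map_carrier])

lemma I_carrier: "I \<subseteq> carrier R"
  using ideal_I by (meson additive_subgroup.a_subset ideal.axioms(1))

lemma dejonq_map_in_I: "i \<in> {1..n + 1} \<Longrightarrow> dejonq_map n f g i \<in> I"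
  unfolding base_ideal_def using R.genideal_self[OF dejonq_map_carrier] by blast

definition gens :: "(nat \<Rightarrow> 'k mpol) set" where
  "gens = (\<lambda>r. UnivPoly.monom U r 0) ` carrier R \<union> (\<lambda>a. UnivPoly.monom U a 1) ` I"

lemma monom_carrier: "a \<in> carrier R \<Longrightarrow> UnivPoly.monom U a i \<in> carrier U"
proof -
  interpret UP_cring R U using cring_mpol_ring by (simp add: UP_cring_def)
  show "a \<in> carrier R \<Longrightarrow> UnivPoly.monom U a i \<in> carrier U" by (rule monom_closed)
qed

lemma gens_carrier: "gens \<subseteq> carrier U"
  unfolding gens_def using monom_carrier I_carrier by auto

lemma A_eq: "A = U\<lparr>carrier := generate_ring U gens\<rparr>"
  unfolding rees_algebra_def gens_def ..

lemma carrier_A: "carrier A = generate_ring U gens"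
  unfolding A_eq by simp

lemma carrier_A_subset: "carrier A \<subseteq> carrier U"
  unfolding carrier_A by (rule U.generate_ring_incl[OF gens_carrier])

sublocale A: ring_embedding A poly_in_t
proof -
  have "subcring (generate_ring U gens) U"
    by (rule U.subcringI'[OF U.generate_ring_is_subring[OF gens_carrier]])
  then have "cring A" unfolding A_eq using U.subcring_iff[OF U.generate_ring_incl[OF gens_carrier]] by simp
  moreover have "inj_on poly_in_t (carrier A)" using U.inj carrier_A_subset by (rule inj_on_subset)
  moreover have "x \<in> carrier U" if "x \<in> carrier A" for x using that carrier_A_subset by auto
  ultimately show "ring_embedding A poly_in_t"
    unfolding ring_embedding_def ring_embedding_axioms_def
    using U.hom_one U.hom_add U.hom_mult by (simp add: rees_algebra_def)
qed

lemma mpols_R_subset_B: "mpols {1..n + 1} \<subseteq> B"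
proof
  fix p :: "'k mpol" assume p: "p \<in> mpols {1..n + 1}"
  have "0 \<le> weight (tower_weight n 0) m" if "m \<in> Poly_Mapping.keys p" for m
    unfolding weight_def using that p
    by (intro sum_nonneg mult_nonneg_nonneg) (force simp: tower_weight_def mpols_def)+
  moreover have "{1..n + 1} \<subseteq> {0..n + 2}" by auto
  ultimately show "p \<in> B" using p mpols_mono unfolding wpols_def weight_ge_def by blast
qed

lemma ev_mult: "ev (a * b) = ev a * ev b" and ev_add: "ev (a + b) = ev a + ev b"
  and ev_diff: "ev (a - b) = ev a - ev b"
  unfolding rees_subst_def by (simp_all add: mpol_subst_mult mpol_subst_add mpol_subst_diff)

lemma ev_const: "ev (const c) = const c" unfolding rees_subst_def by simp

lemma ev_var: "ev (var i) = (if i = 0 then f * var 0 else if i = n + 2 then g * var 0 else var i)"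
  unfolding rees_subst_def by simp

lemma idom_subring_ev_B: "idom_subring (ev ` B)"
proof -
  interpret BB: idom_subring B by (rule idom_subring_wpols)
  show ?thesis
  proof
    show "1 \<in> ev ` B" using BB.one_closed ev_const[of 1] by (metis imageI single_one)
    show "a - b \<in> ev ` B" if "a \<in> ev ` B" "b \<in> ev ` B" for a b
      using that BB.diff_closed by (auto simp flip: ev_diff)
    show "a * b \<in> ev ` B" if "a \<in> ev ` B" "b \<in> ev ` B" for a b
      using that BB.mult_closed by (auto simp flip: ev_mult)
  qed
qed

lemma var_mult_var_0_in_B: "j \<in> {1..n} \<Longrightarrow> var j * var 0 \<in> B"
proof -
  assume j: "j \<in> {1..n}"
  have "const 1 * (var j * var 0) \<in> weight_ge (tower_weight n 0) 0"
    unfolding var_mult_var_0 using j by (intro weight_ge_single) (simp add: weight_add tower_weight_def del: single_one)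
  then show ?thesis
    unfolding wpols_def using j by (auto intro!: mpols.mult_closed var_in_mpols)
qed

lemma var_w_in_B: "var (n + 2) \<in> B"
  unfolding wpols_def by (auto intro!: var_in_mpols weight_ge_var simp: tower_weight_def)

text \<open>The elements a with a t in the image form an ideal, so the generators suffice: x_i f t
  comes from x_i s, and g t from w.\<close>

lemma I_times_t: "a \<in> I \<Longrightarrow> a * var 0 \<in> ev ` B"
proof -
  interpret L: idom_subring "ev ` B" by (rule idom_subring_ev_B)
  have R: "r \<in> ev ` B" if "r \<in> carrier R" for r
    using that ev_fix mpols_R_subset_B unfolding carrier_mpol_ring by (metis imageI subsetD)
  have "I \<subseteq> {a \<in> carrier R. a * var 0 \<in> ev ` B}"
    unfolding base_ideal_def
  proof (rule R.genideal_minimal)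
    show "ideal {a \<in> carrier R. a * var 0 \<in> ev ` B} R"
    proof (rule idealI[OF R.ring_axioms])
      show "subgroup {a \<in> carrier R. a * var 0 \<in> ev ` B} (add_monoid R)"
      proof (rule R.add.subgroupI)
        show "{a \<in> carrier R. a * var 0 \<in> ev ` B} \<noteq> {}"
          using R.zero_closed L.zero_closed by (auto simp: mpol_ring_simps)
      next
        fix a assume a: "a \<in> {a \<in> carrier R. a * var 0 \<in> ev ` B}"
        then have "a \<oplus>\<^bsub>R\<^esub> \<ominus>\<^bsub>R\<^esub> a = \<zero>\<^bsub>R\<^esub>" by (simp add: R.r_neg)
        then have "\<ominus>\<^bsub>R\<^esub> a = - a" by (simp add: mpol_ring_simps add_eq_0_iff)
        then show "\<ominus>\<^bsub>R\<^esub> a \<in> {a \<in> carrier R. a * var 0 \<in> ev ` B}"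
          using a L.uminus_closed R.a_inv_closed by fastforce
      next
        fix a b assume "a \<in> {a \<in> carrier R. a * var 0 \<in> ev ` B}" "b \<in> {a \<in> carrier R. a * var 0 \<in> ev ` B}"
        then show "a \<oplus>\<^bsub>R\<^esub> b \<in> {a \<in> carrier R. a * var 0 \<in> ev ` B}"
          using L.add_closed R.a_closed[of a b] by (simp add: mpol_ring_simps distrib_right)
      qed auto
    next
      fix a x assume a: "a \<in> {a \<in> carrier R. a * var 0 \<in> ev ` B}" and x: "x \<in> carrier R"
      then have "x * (a * var 0) \<in> ev ` B" using R L.mult_closed by blast
      then show "x \<otimes>\<^bsub>R\<^esub> a \<in> {a \<in> carrier R. a * var 0 \<in> ev ` B}" "a \<otimes>\<^bsub>R\<^esub> x \<in> {a \<in> carrier R. a * var 0 \<in> ev ` B}"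
        using a x R.m_closed[of x a] by (simp_all add: mpol_ring_simps mult_ac)
    qed
    have "dejonq_map n f g i * var 0 \<in> ev ` B" if "i \<in> {1..n + 1}" for i
    proof (cases "i \<le> n")
      case True
      then have "dejonq_map n f g i * var 0 = ev (var i * var 0)"
        using that by (simp add: dejonq_map_def ev_mult ev_var mult.assoc)
      then show ?thesis using var_mult_var_0_in_B[of i] True that by auto
    next
      case False
      then have "dejonq_map n f g i * var 0 = ev (var (n + 2))" by (simp add: dejonq_map_def ev_var)
      then show ?thesis using var_w_in_B by auto
    qed
    then show "dejonq_map n f g ` {1..n + 1} \<subseteq> {a \<in> carrier R. a * var 0 \<in> ev ` B}"
      using dejonq_map_carrier by blast
  qed
  then show "a \<in> I \<Longrightarrow> a * var 0 \<in> ev ` B" by blast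
qed

lemma monom_0_in_A: "r \<in> carrier R \<Longrightarrow> UnivPoly.monom U r 0 \<in> carrier A"
  unfolding carrier_A gens_def by (auto intro!: generate_ring.incl)

lemma monom_1_in_A: "a \<in> I \<Longrightarrow> UnivPoly.monom U a 1 \<in> carrier A"
  unfolding carrier_A gens_def by (auto intro!: generate_ring.incl)

text \<open>Together with \<open>ev_kernel\<close> this presents the Rees algebra as B / h N. Each
  inclusion is checked on generators, those of R[It] in one direction and those of B in the
  other.\<close>

lemma image_A: "poly_in_t ` carrier A = ev ` B"
proof (intro equalityI subsetI)
  interpret L: idom_subring "ev ` B" by (rule idom_subring_ev_B)
  have "x \<in> carrier U \<and> poly_in_t x \<in> ev ` B" if "x \<in> generate_ring U gens" for x
    using that
  proof (induction rule: generate_ring.induct)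
    case one
    then show ?case using L.one_closed by (simp add: U.hom_one)
  next
    case (incl x)
    then consider r where "r \<in> carrier R" "x = UnivPoly.monom U r 0" | a where "a \<in> I" "x = UnivPoly.monom U a 1"
      unfolding gens_def by auto
    then show ?case
    proof cases
      case 1
      then have "poly_in_t x = ev r" using poly_in_t_monom[OF 1(1), of 0] ev_fix unfolding carrier_mpol_ring by simp
      then show ?thesis using 1 mpols_R_subset_B monom_carrier unfolding carrier_mpol_ring by blast
    next
      case 2
      then show ?thesis using poly_in_t_monom[of a "n + 1" 1] I_carrier I_times_t monom_carrier by auto
    qed
  next
    case (a_inv x)
    then show ?case using L.uminus_closed by (simp add: U.hom_uminus)
  next
    case (eng_add x y)
    then show ?case using L.add_closed by (simp add: U.hom_add)
  next
    case (eng_mult x y)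
    then show ?case using L.mult_closed by (simp add: U.hom_mult)
  qed
  then show "y \<in> ev ` B" if "y \<in> poly_in_t ` carrier A" for y using that unfolding carrier_A by blast
next
  interpret L: idom_subring "poly_in_t ` carrier A" by (rule A.idom_subring_image)
  fix y assume "y \<in> ev ` B"
  then obtain p where p: "p \<in> B" "y = ev p" by auto
  have r: "r \<in> poly_in_t ` carrier A" if "r \<in> mpols {1..n + 1}" for r
    using poly_in_t_monom[of r "n + 1" 0] monom_0_in_A[of r] that unfolding carrier_mpol_ring
    by (metis imageI mult.right_neutral power_0)
  have a: "a * var 0 \<in> poly_in_t ` carrier A" if "a \<in> I" for a
  proof -
    have "poly_in_t (UnivPoly.monom U a 1) = a * var 0"
      using poly_in_t_monom[of a "n + 1" 1] I_carrier that by auto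
    then show ?thesis using monom_1_in_A[OF that] by (metis imageI)
  qed
  have "p \<in> {p. ev p \<in> poly_in_t ` carrier A}"
  proof (rule wpols_tower_induct[OF n p(1)])
    fix i assume i: "i \<in> {1..n + 2}"
    show "var i \<in> {p. ev p \<in> poly_in_t ` carrier A}"
    proof (cases "i = n + 2")
      case True
      then show ?thesis using a[OF dejonq_map_in_I[of "n + 1"]] by (simp add: ev_var dejonq_map_def)
    next
      case False
      then have "ev (var i) = var i" "var i \<in> mpols {1..n + 1}" using i by (auto simp: ev_var intro!: var_in_mpols)
      then show ?thesis using r by simp
    qed
  next
    fix j assume j: "j \<in> {1..n}"
    have "ev (var j * var 0) = dejonq_map n f g j * var 0"
      using j by (simp add: ev_mult ev_var dejonq_map_def mult.assoc)
    then show "var j * var 0 \<in> {p. ev p \<in> poly_in_t ` carrier A}"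
      using a[OF dejonq_map_in_I[of j]] j by simp
  qed (use r const_in_mpols in \<open>auto simp: ev_add ev_mult ev_const intro: L.add_closed L.mult_closed\<close>)
  then show "y \<in> poly_in_t ` carrier A" using p by simp
qed

text \<open>The lift is x_i or g t, minus l x_j f t; all of these are among the generators of the
  maximal ideal. The weight bound, meaning no constant term, is recorded for
  \<open>genideal_proper\<close>.\<close>

lemma binomial_lift:
  assumes a: "a \<in> binomials n" and g1: "g \<in> weight_ge (\<lambda>_. 1) 1"
  shows "\<exists>x\<in>carrier A. x \<in> rees_max_ideal (n + 1) I \<and> poly_in_t x = ev a \<and> ev a \<in> weight_ge (\<lambda>_. 1) 1"
proof -
  obtain v l j where a: "a = var v - const l * (var j * var 0)" "v \<in> {1..n + 2}" "j \<in> {1..n}"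
    using assms(1) unfolding binomials_def by blast
  let ?G = "(\<lambda>i. UnivPoly.monom U (var i) 0) ` {1..n + 1} \<union> (\<lambda>a. UnivPoly.monom U a 1) ` I"
  have var_R: "var i \<in> carrier R" if "i \<in> {1..n + 1}" for i
    using that unfolding carrier_mpol_ring by (rule var_in_mpols)
  have G: "?G \<subseteq> carrier A" using monom_0_in_A[OF var_R] monom_1_in_A by auto
  define J where "J = rees_max_ideal (n + 1) I"
  have J: "J = Idl\<^bsub>A\<^esub> ?G" unfolding J_def rees_max_ideal_def ..
  interpret J: ideal J A unfolding J by (rule A.genideal_ideal[OF G])
  have GJ: "?G \<subseteq> J" unfolding J by (rule A.genideal_self[OF G])
  have v: "\<exists>x\<in>J. poly_in_t x = ev (var v)"
  proof (cases "v = n + 2")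
    case True
    have "g \<in> I" using dejonq_map_in_I[of "n + 1"] by (simp add: dejonq_map_def)
    moreover from this have "poly_in_t (UnivPoly.monom U g 1) = ev (var v)"
      using poly_in_t_monom[of g "n + 1" 1] I_carrier True by (auto simp: ev_var)
    ultimately show ?thesis using GJ by blast
  next
    case False
    then have "v \<in> {1..n + 1}" using a(2) by auto
    moreover from this have "poly_in_t (UnivPoly.monom U (var v) 0) = ev (var v)"
      using poly_in_t_monom[OF var_R, of v 0] False by (auto simp: ev_var)
    ultimately show ?thesis using GJ by blast
  qed
  then obtain x where x: "x \<in> J" "poly_in_t x = ev (var v)" by blast
  have "const l \<in> carrier R" unfolding carrier_mpol_ring by (rule const_in_mpols)
  moreover have "var j * f \<in> I" using dejonq_map_in_I[of j] a(3) by (simp add: dejonq_map_def)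
  ultimately have lI: "const l * (var j * f) \<in> I"
    using ideal.I_l_closed[OF ideal_I] by (metis mpol_ring_simps(1))
  define y where "y = UnivPoly.monom U (const l * (var j * f)) 1"
  have y: "y \<in> J" using GJ lI unfolding y_def by blast
  have ty: "poly_in_t y = ev (const l * (var j * var 0))"
  proof -
    have "poly_in_t y = const l * (var j * f) * var 0"
      unfolding y_def using poly_in_t_monom[of "const l * (var j * f)" "n + 1" 1] lI I_carrier by auto
    moreover have "ev (const l * (var j * var 0)) = const l * (var j * (f * var 0))"
      using a(3) by (simp add: ev_mult ev_const ev_var)
    ultimately show ?thesis by (simp add: mult.assoc)
  qed
  have xy: "x \<in> carrier A" "y \<in> carrier A" using x y J.a_subset by auto
  have "x \<ominus>\<^bsub>A\<^esub> y \<in> J" using x(1) y unfolding a_minus_def by (intro J.a_closed J.a_inv_closed)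
  moreover have "poly_in_t (x \<ominus>\<^bsub>A\<^esub> y) = ev a"
    unfolding A.hom_minus[OF xy] x(2) ty a(1) ev_diff ..
  moreover have "ev a \<in> weight_ge (\<lambda>_. 1) 1"
  proof -
    have 0: "p \<in> weight_ge (\<lambda>_. 1) 0" for p :: "'k mpol"
      unfolding weight_ge_def weight_def by (auto intro: sum_nonneg)
    have v1: "(var i :: 'k mpol) \<in> weight_ge (\<lambda>_. 1) 1" for i :: nat by (rule weight_ge_var) simp
    have m1: "p * q \<in> weight_ge (\<lambda>_. 1) 1" if "q \<in> weight_ge (\<lambda>_. 1) 1" for p q :: "'k mpol"
      using weight_ge_mult[OF 0 that, of p] by simp
    have "ev (var v) \<in> weight_ge (\<lambda>_. 1) 1" using v1 m1 by (simp add: ev_var)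
    moreover have "ev (const l * (var j * var 0)) \<in> weight_ge (\<lambda>_. 1) 1"
      unfolding ev_mult using m1 v1 by (simp add: ev_var)
    ultimately show ?thesis unfolding a(1) ev_diff by (rule weight_ge_diff)
  qed
  ultimately show ?thesis using J.a_subset unfolding J_def by (intro bexI[of _ "x \<ominus>\<^bsub>A\<^esub> y"]) auto
qed

text \<open>The elements without constant term form a proper ideal.\<close>

lemma genideal_proper:
  assumes "set as \<subseteq> carrier A" "\<And>x. x \<in> set as \<Longrightarrow> poly_in_t x \<in> weight_ge (\<lambda>_. 1) 1"
  shows "Idl\<^bsub>A\<^esub> (set as) \<noteq> carrier A"
proof -
  let ?Z = "{x \<in> carrier A. poly_in_t x \<in> weight_ge (\<lambda>_. 1) 1}"
  have "ideal ?Z A"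
  proof (rule idealI[OF A.ring_axioms])
    show "subgroup ?Z (add_monoid A)"
      by (rule A.add.subgroupI)
        (auto simp: A.hom_add A.hom_uminus A.hom_zero intro: weight_ge_add weight_ge_uminus exI[of _ "\<zero>\<^bsub>A\<^esub>"])
    fix a x assume a: "a \<in> ?Z" and x: "x \<in> carrier A"
    have "poly_in_t x \<in> weight_ge (\<lambda>_. 1) 0" unfolding weight_ge_def weight_def by (auto intro: sum_nonneg)
    then have "poly_in_t x * poly_in_t a \<in> weight_ge (\<lambda>_. 1) (0 + 1)" using a by (intro weight_ge_mult) auto
    then show "x \<otimes>\<^bsub>A\<^esub> a \<in> ?Z" "a \<otimes>\<^bsub>A\<^esub> x \<in> ?Z" using a x by (simp_all add: A.hom_mult mult.commute)
  qed
  then have "Idl\<^bsub>A\<^esub> (set as) \<subseteq> ?Z" using assms by (intro A.genideal_minimal) auto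
  moreover have "\<one>\<^bsub>A\<^esub> \<notin> ?Z" by (simp add: A.hom_one weight_ge_def)
  ultimately show ?thesis using A.one_closed by blast
qed

text \<open>Regularity passes from B / h N through \<open>ev\<close> to the image of B with the zero
  ideal, and from there back through \<open>poly_in_t\<close> to the Rees algebra.\<close>

lemma depth_ge:
  assumes k: "infinite (UNIV :: 'k set)" and e: "e \<ge> 0" and g1: "g \<in> weight_ge (\<lambda>_. 1) 1"
    and h: "h \<in> weight_ge (tower_weight n 0) e" "h \<notin> weight_ge (tower_weight n 0) (e + 1)"
  shows "enat (n + 1) \<le> depth A (rees_max_ideal (n + 1) I)"
proof -
  have "h \<in> wpols {0..n + 2} (tower_weight n 0) e" using h(1) h_in_mpols unfolding wpols_def by blast
  then obtain as where as: "length as = n + 1" "set as \<subseteq> binomials n \<inter> B"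
    "regular_mod B ((*) h ` wpols {0..n + 2} (tower_weight n 0) (- e)) as"
    using weighted_regular_sequence[OF k n e _ h_nonzero] by blast
  have "regular_mod (ev ` B) {0} (map ev as)"
    using regular_mod_quotient[OF idom_subring_wpols ev_diff ev_mult ev_kernel[OF h], of as] as by blast
  moreover have "\<forall>a\<in>set as. \<exists>x\<in>carrier A. x \<in> rees_max_ideal (n + 1) I \<and> poly_in_t x = ev a \<and> ev a \<in> weight_ge (\<lambda>_. 1) 1"
    using binomial_lift[OF _ g1] as(2) by blast
  then obtain H where H: "\<And>a. a \<in> set as \<Longrightarrow> H a \<in> carrier A \<and> H a \<in> rees_max_ideal (n + 1) I \<and>
      poly_in_t (H a) = ev a \<and> ev a \<in> weight_ge (\<lambda>_. 1) 1"
    by metis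
  have "map poly_in_t (map H as) = map ev as" using H by simp
  moreover have "set (map H as) \<subseteq> carrier A" using H by auto
  moreover from this have "Idl\<^bsub>A\<^esub> (set (map H as)) \<noteq> carrier A" by (rule genideal_proper) (use H in auto)
  ultimately have "regular_sequence A (map H as)"
    using A.regular_sequence_transfer[of "map H as", unfolded image_A] by metis
  moreover have "set (map H as) \<subseteq> rees_max_ideal (n + 1) I" using H by auto
  ultimately show ?thesis
    unfolding depth_def using as(1) by (intro Sup_upper) (auto intro!: exI[of _ "map H as"])
qed

text \<open>The evaluation takes values in polynomials in the x_i and t, and these are n + 2
  variables.\<close>

lemma krull_dim_A_le: "krull_dim A \<le> enat (n + 2)"
proof -
  have "ev ` B \<subseteq> mpols {0..n + 1}"
  proof
    fix y assume "y \<in> ev ` B"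
    then obtain p where p: "p \<in> mpols {0..n + 2}" "y = ev p" unfolding wpols_def by auto
    have "f \<in> mpols {0..n + 1}" "g \<in> mpols {0..n + 1}"
      using f g mpols_mono[of "{1..n + 1}" "{0..n + 1}"] by auto
    then show "y \<in> mpols {0..n + 1}"
      unfolding p(2) rees_subst_def using p(1)
      by (intro mpol_subst_in_subring[OF idom_subring_mpols] const_in_mpols)
        (auto intro!: mpols.mult_closed var_in_mpols)
  qed
  moreover have "const c \<in> ev ` B" for c
    using mpols_R_subset_B const_in_mpols ev_const by (metis imageI subsetD)
  ultimately have "krull_dim A \<le> enat (card {0..n + 1})"
    using krull_dim_le[OF A.ring_embedding_axioms, of "{0..n + 1}"] unfolding image_A by simp
  then show ?thesis by (simp add: One_nat_def)
qed

end

theorem proposition2p9: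
  fixes n d :: nat and f g :: "'k::field mpol"
  assumes "infinite (UNIV :: 'k set)"
    and "n \<ge> 2"
    and "d \<ge> 2"
    and "generalized_dejonquieres n d f g"
  shows "almost_cohen_macaulay
           (rees_algebra (mpol_ring (n + 1)) (base_ideal n f g))
           (rees_max_ideal (n + 1) (base_ideal n f g))"
proof -
  let ?R = "mpol_ring (n + 1) :: 'k mpol ring"
  have forms: "form (n + 1) (d - 1) f" "form (n + 1) d g"
    and gcd: "\<one>\<^bsub>?R\<^esub> gcdof\<^bsub>?R\<^esub> f g"
    and mon: "var_monoid (n + 1) f" "var_monoid (n + 1) g"
    and inv: "involves (n + 1) f \<or> involves (n + 1) g"
    using assms(4) unfolding generalized_dejonquieres_def by auto
  have fg: "f \<in> mpols {1..n + 1}" "g \<in> mpols {1..n + 1}"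
    using forms unfolding form_def carrier_mpol_ring by auto
  have "weight (\<lambda>_. 1) m = int d" if "m \<in> Poly_Mapping.keys g" for m
    using forms(2) that unfolding form_def weight_def by (auto simp flip: of_nat_sum)
  then have g1: "g \<in> weight_ge (\<lambda>_. 1) 1" unfolding weight_ge_def using assms(3) by auto
  have not1: "\<not> g dvd 1"
  proof
    assume "g dvd 1"
    then obtain c where c: "1 = g * c" by auto
    have "c \<in> weight_ge (\<lambda>_. 1) 0" unfolding weight_ge_def weight_def by (auto intro: sum_nonneg)
    then have "g * c \<in> weight_ge (\<lambda>_. 1) (1 + 0)" using g1 weight_ge_mult by blast
    then show False unfolding c[symmetric] by (simp add: weight_ge_def)
  qed
  have gcd': "p dvd 1" if p: "p \<in> mpols {1..n + 1}" "dvd_on (mpols {1..n + 1}) p f" "dvd_on (mpols {1..n + 1}) p g" for p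
    using gcd p unfolding isgcd_def factor_def dvd_on_def carrier_mpol_ring mpol_ring_simps by (metis dvdI)
  \<comment> \<open>If f were zero, g would be a common divisor and hence a unit, against its
    positive degree.\<close>
  have f0: "f \<noteq> 0"
  proof
    assume "f = 0"
    then have "g dvd 1"
      using gcd'[OF fg(2)] mpols_dvd_on[OF _ fg(1), of g] mpols_dvd_on[OF _ fg(2), of g] by simp
    then show False using not1 by blast
  qed
  \<comment> \<open>The gcd hypothesis speaks of divisors inside the ring; since f is nonzero, all
    its divisors lie there.\<close>
  have coprime: "p dvd 1" if "p dvd f" "p dvd g" for p
  proof (rule gcd')
    obtain c where "f = p * c" using \<open>p dvd f\<close> by auto
    then show "p \<in> mpols {1..n + 1}" using mpols_divisor[of p c] fg(1) f0 by simp
    show "dvd_on (mpols {1..n + 1}) p f" "dvd_on (mpols {1..n + 1}) p g" using that fg mpols_dvd_on by auto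
  qed
  interpret dejonquieres_pair n f g
    using fg f0 coprime assms(2) by unfold_locales auto
  have n: "n \<ge> 1" using assms(2) by simp
  \<comment> \<open>Here e = d - 2, which is nonnegative by d \<ge> 2.\<close>
  have "enat (n + 1) \<le> depth A (rees_max_ideal (n + 1) I)"
    using depth_ge[OF assms(1) _ g1 rees_eqn_weight[OF n assms(3) forms mon inv]] assms(3) by simp
  moreover have "krull_dim A - 1 \<le> enat (n + 2) - 1"
    using krull_dim_A_le by (cases "krull_dim A") (auto simp: one_enat_def)
  moreover have "enat (n + 2) - 1 = enat (n + 1)" by (simp add: one_enat_def)
  ultimately show ?thesis unfolding almost_cohen_macaulay_def by simp
qed

end
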